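(* There is an absolute constant $C>0$ such that the following holds. Let $d=d(n)$ be natural numbers with $d\ge 10$ and $6d^3\le \log n$ (and $dn$ even). Let $G\sim\mathbb{G}_{n,d}$. Then, with probability $1-o(1)$ as $n\to\infty$, both of the following hold: the chromatic number of $G$ is strictly larger than $d/(4\log d)$, and the cohomological $k$-consistency algorithm for $\mathrm{CSP}(K_3)$ (3-colorability) accepts $G$ for every $k\le n\cdot d^{-Cd}$. Consequently, for no $k\le n\cdot d^{-Cd}$ does the cohomological $k$-consistency algorithm for $\mathrm{CSP}(K_3)$ distinguish $3$-colorable $n$-vertex graphs from $n$-vertex graphs that are not $d/(4\log d)$-colorable.
   Context: $\mathbb{G}_{n,d}$ denotes the uniform distribution over $d$-regular simple graphs on $n$ vertices. A graph $G=(V,E)$ is viewed as a relational structure with domain $V$ and one binary relation $\{(u,v),(v,u):\{u,v\}\in E\}$; $K_3$ is the complete graph on 3 vertices viewed the same way, so $G\to K_3$ (a homomorphism exists) iff $G$ is 3-colorable. Relational structures and CSPs: a signature $\sigma$ is a finite set of relation symbols with arities; a $\sigma$-structure $\mathbf{A}$ has a finite domain $A$ and relations $\Gamma^{\mathbf{A}}\subseteq A^{\mathrm{ar}(\Gamma)}$. A homomorphism $\mathbf{A}\to\mathbf{T}$ is a map $A\to T$ sending every tuple of $\Gamma^{\mathbf{A}}$ into $\Gamma^{\mathbf{T}}$ for every $\Gamma\in\sigma$. An instance of $\mathrm{CSP}(\mathbf{T})$ is a $\sigma$-structure $\mathbf{A}$ no tuple of whose relations has repeated entries. For $X\subseteq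 A$, $\mathbf{A}[X]$ is the substructure with domain $X$ whose relations consist of the tuples of $\mathbf{A}$ with all entries in $X$, and $\mathrm{Hom}(\mathbf{A}[X],\mathbf{T})$ is the set of homomorphisms $\mathbf{A}[X]\to\mathbf{T}$. Cohomological $k$-consistency: fix $\mathbf{T}$, an instance $\mathbf{A}$, and $k\ge1$. A collection $\kappa=\{\kappa(X): X\subseteq A,|X|\le k\}$ with $\kappa(X)\subseteq\mathrm{Hom}(\mathbf{A}[X],\mathbf{T})$ is $k$-consistent if for all $Y\subseteq X\subseteq A$ with $|X|\le k$: (extendability) every $\varphi\in\kappa(Y)$ is the restriction to $Y$ of some $\psi\in\kappa(X)$; (down-closure) for every $\psi\in\kappa(X)$, its restriction $\psi|_Y$ lies in $\kappa(Y)$. Every such collection contains a unique maximal $k$-consistent subcollection. For such $\kappa$, $L_k(\mathbf{A},\mathbf{T},\kappa)$ is the system of linear equations in variables $x_{X,\varphi}$ ($|X|\le k$, $\varphi\in\mathrm{Hom}(\mathbf{A}[X],\mathbf{T})$): $\sum_{\varphi\in\kappa(X)}x_{X,\varphi}=1$ for every $X$ with $|X|\le k$, and $\sum_{\varphi\in\kappa(X),\,\varphi|_Y=\psi}x_{X,\varphi}=x_{Y,\psi}$ for all $Y\subseteq X$, $|X|\le k$, $\psi\in\kappa(Y)$. The cohomological $k$-consistency algorithm for $\mathrm{CSP}(\mathbf{T})$ on input $\mathbf{A}$: initialize $\mathcal{H}(X)=\mathrm{Hom}(\mathbf{A}[X],\mathbf{T})$ for all $|X|\le k$; repeat until $\mathcal{H}$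 no longer changes: (a) replace $\mathcal{H}$ by its maximal $k$-consistent subcollection; (b) for each $X$ with $|X|\le k$ and each $\varphi\in\mathcal{H}(X)$, if $L_k(\mathbf{A},\mathbf{T},\mathcal{H})$ has no solution over $\mathbb{Z}$ with $x_{X,\varphi}=1$ and $x_{X,\psi}=0$ for all $\psi\in\mathcal{H}(X)\setminus\{\varphi\}$, then remove $\varphi$ from $\mathcal{H}(X)$ for the next iteration. Finally, reject if $\mathcal{H}(X)=\emptyset$ for some $X$, and accept otherwise. *)

theory Defs
  imports Complex_Main "HOL-Library.FuncSet"
begin

record 'a bstruct =
  sdom :: "'a set"
  srel :: "('a \<times> 'a) set"

definition hom_sub :: "'a bstruct \<Rightarrow> 'b bstruct \<Rightarrow> 'a set \<Rightarrow> ('a \<Rightarrow> 'b) set" where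
  "hom_sub A T X = {\<phi> \<in> X \<rightarrow>\<^sub>E sdom T.
      \<forall>(u,v)\<in>srel A. u \<in> X \<longrightarrow> v \<in> X \<longrightarrow> (\<phi> u, \<phi> v) \<in> srel T}"

definition relevant :: "'a bstruct \<Rightarrow> nat \<Rightarrow> 'a set \<Rightarrow> bool" where
  "relevant A k X \<longleftrightarrow> X \<subseteq> sdom A \<and> card X \<le> k"

definition k_consistent ::
  "'a bstruct \<Rightarrow> 'b bstruct \<Rightarrow> nat \<Rightarrow> ('a set \<Rightarrow> ('a \<Rightarrow> 'b) set) \<Rightarrow> bool" where
  "k_consistent A T k \<kappa> \<longleftrightarrow>
     (\<forall>X. relevant A k X \<longrightarrow> \<kappa> X \<subseteq> hom_sub A T X) \<and>
     (\<forall>X Y. relevant A k X \<longrightarrow> Y \<subseteq> X \<longrightarrow>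
        (\<forall>\<phi>\<in>\<kappa> Y. \<exists>\<psi>\<in>\<kappa> X. restrict \<psi> Y = \<phi>) \<and>
        (\<forall>\<psi>\<in>\<kappa> X. restrict \<psi> Y \<in> \<kappa> Y))"

definition max_consistent ::
  "'a bstruct \<Rightarrow> 'b bstruct \<Rightarrow> nat \<Rightarrow> ('a set \<Rightarrow> ('a \<Rightarrow> 'b) set) \<Rightarrow> ('a set \<Rightarrow> ('a \<Rightarrow> 'b) set)" where
  "max_consistent A T k \<kappa> = Sup {\<mu>. \<mu> \<le> \<kappa> \<and> k_consistent A T k \<mu>}"

definition Lk_solution ::
  "'a bstruct \<Rightarrow> 'b bstruct \<Rightarrow> nat \<Rightarrow> ('a set \<Rightarrow> ('a \<Rightarrow> 'b) set)
     \<Rightarrow> ('a set \<Rightarrow> ('a \<Rightarrow> 'b) \<Rightarrow> int) \<Rightarrow> bool" where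
  "Lk_solution A T k \<kappa> x \<longleftrightarrow>
     (\<forall>X. relevant A k X \<longrightarrow> (\<Sum>\<phi>\<in>\<kappa> X. x X \<phi>) = 1) \<and>
     (\<forall>X Y \<psi>. relevant A k X \<longrightarrow> Y \<subseteq> X \<longrightarrow> \<psi> \<in> \<kappa> Y \<longrightarrow>
        (\<Sum>\<phi>\<in>{\<phi>\<in>\<kappa> X. restrict \<phi> Y = \<psi>}. x X \<phi>) = x Y \<psi>)"

definition passes_test ::
  "'a bstruct \<Rightarrow> 'b bstruct \<Rightarrow> nat \<Rightarrow> ('a set \<Rightarrow> ('a \<Rightarrow> 'b) set) \<Rightarrow> 'a set \<Rightarrow> ('a \<Rightarrow> 'b) \<Rightarrow> bool" where
  "passes_test A T k \<kappa> X \<phi> \<longleftrightarrow>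
     (\<exists>x. Lk_solution A T k \<kappa> x \<and> x X \<phi> = 1 \<and> (\<forall>\<psi>\<in>\<kappa> X - {\<phi>}. x X \<psi> = 0))"

definition coh_step ::
  "'a bstruct \<Rightarrow> 'b bstruct \<Rightarrow> nat \<Rightarrow> ('a set \<Rightarrow> ('a \<Rightarrow> 'b) set) \<Rightarrow> ('a set \<Rightarrow> ('a \<Rightarrow> 'b) set)" where
  "coh_step A T k H =
     (let H1 = max_consistent A T k H in
      (\<lambda>X. {\<phi> \<in> H1 X. passes_test A T k H1 X \<phi>}))"

definition coh_init :: "'a bstruct \<Rightarrow> 'b bstruct \<Rightarrow> nat \<Rightarrow> ('a set \<Rightarrow> ('a \<Rightarrow> 'b) set)" where
  "coh_init A T k = (\<lambda>X. if relevant A k X then hom_sub A T X else {})"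

definition coh_accepts :: "'a bstruct \<Rightarrow> 'b bstruct \<Rightarrow> nat \<Rightarrow> bool" where
  "coh_accepts A T k \<longleftrightarrow>
     (\<exists>i. (coh_step A T k ^^ Suc i) (coh_init A T k) = (coh_step A T k ^^ i) (coh_init A T k) \<and>
          (\<forall>X. relevant A k X \<longrightarrow> (coh_step A T k ^^ i) (coh_init A T k) X \<noteq> {}))"

definition simple_graph :: "nat \<Rightarrow> (nat \<times> nat) set \<Rightarrow> bool" where
  "simple_graph n E \<longleftrightarrow> E \<subseteq> {0..<n} \<times> {0..<n} \<and> sym E \<and> irrefl E"

definition regular_graphs :: "nat \<Rightarrow> nat \<Rightarrow> (nat \<times> nat) set set" where
  "regular_graphs n d = {E. simple_graph n E \<and> (\<forall>u<n. card {v. (u,v) \<in> E} = d)}"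

definition prob_reg :: "nat \<Rightarrow> nat \<Rightarrow> ((nat \<times> nat) set \<Rightarrow> bool) \<Rightarrow> real" where
  "prob_reg n d P = real (card {E \<in> regular_graphs n d. P E}) / real (card (regular_graphs n d))"

definition graph_struct :: "nat \<Rightarrow> (nat \<times> nat) set \<Rightarrow> nat bstruct" where
  "graph_struct n E = \<lparr>sdom = {0..<n}, srel = E\<rparr>"

definition K3 :: "nat bstruct" where
  "K3 = \<lparr>sdom = {0,1,2}, srel = {(i,j). i \<in> {0,1,2} \<and> j \<in> {0,1,2} \<and> i \<noteq> j}\<rparr>"

definition colorable :: "nat \<Rightarrow> (nat \<times> nat) set \<Rightarrow> nat \<Rightarrow> bool" where
  "colorable n E c \<longleftrightarrow> (\<exists>f::nat \<Rightarrow> nat. (\<forall>v<n. f v < c) \<and> (\<forall>(u,v)\<in>E. f u \<noteq> f v))"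

definition chromatic_number :: "nat \<Rightarrow> (nat \<times> nat) set \<Rightarrow> nat" where
  "chromatic_number n E = (LEAST c. colorable n E c)"

end

theory Submission
  imports Defs "HOL-Library.Nat_Bijection"
begin

text \<open>
  The algorithm accepts as soon as there is a consistent family \<open>\<kappa>\<close> of nonempty sets of local
  colourings each of which passes its own integrality test. Here \<open>\<kappa> X\<close> consists of the colourings of
  \<open>X\<close> that extend to a closure of \<open>X\<close>. Vertices are ranked by a greedy \<open>(d + 1)\<close>-colouring, so that
  rank-decreasing paths have at most \<open>d + 1\<close> vertices; a set is closed if it contains the neighbours
  of smaller rank of its members and no small set outside it sends too many edges into it and itself.
  Local sparsity keeps closures small, and makes every colouring of a closed set extend to larger
  closed sets in such a way that the indicator of each new colour is an affine function of at most one
  indicator belonging to a smaller vertex. Hence standard monomials (for the colexicographic order) of a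
  closed set stay standard in larger closed sets, and ``constant term of the normal form'' is one integral
  functional that is compatible with all closed sets; evaluated at indicators of local colourings it
  solves the linear system. Applying this to colourings that extend a prescribed one gives the test.

  In a random regular graph both sparsity and the absence of large independent sets follow from edge
  switchings carried out directly on simple graphs, so that no configuration model is needed.
\<close>

section \<open>A criterion for acceptance\<close>

text \<open>The linear system demands agreement of marginals, so its solution is sought in the form
  \<open>L (point f X)\<close> with a single \<open>L\<close>: every equation then says that
  \<open>L\<close> respects one polynomial identity on the colourings of one closed set. The
  obstacle is that a monomial might be reducible in a large closed set and irreducible in a small
  one, so that normal forms would depend on the set. A section of the restriction map that does not
  raise weights carries reductions from the large set to the small one, and the shape of closed sets
  is dictated by the wish for such sections: a new vertex may only copy from a parent that precedes
  it. The exponent linear in \<open>d\<close> has two origins. Descending paths may enlarge a set by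
  a factor of about \<open>d ^ d\<close>. And completing a dense set along such paths leaves a
  surplus of edges over vertices of order \<open>1 / d\<close> per vertex only, so sparsity is
  needed at that precision; in the union bound a factor \<open>(s / n) ^ (s / (20 * d))\<close> then
  has to beat a power of \<open>d\<close> with exponent proportional to \<open>s\<close>, which
  forces \<open>s / n\<close> below some \<open>d ^ (- c * d)\<close>.\<close>

lemma max_consistent_le: "max_consistent A T k H \<le> H"
  unfolding max_consistent_def by (rule Sup_least) auto

lemma le_max_consistent:
  "\<kappa> \<le> H \<Longrightarrow> k_consistent A T k \<kappa> \<Longrightarrow> \<kappa> \<le> max_consistent A T k H"
  unfolding max_consistent_def by (rule Sup_upper) auto

lemma coh_step_le: "coh_step A T k H \<le> H"
  using max_consistent_le[of A T k H] unfolding coh_step_def Let_def le_fun_def by blast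

lemma relevant_subset: "relevant A k X \<Longrightarrow> finite (sdom A) \<Longrightarrow> Y \<subseteq> X \<Longrightarrow> relevant A k Y"
  unfolding relevant_def by (meson card_mono finite_subset le_trans subset_trans)

text \<open>A solution for \<open>\<kappa>\<close>, extended by zero, solves the larger system. The
  marginal equation at a colouring outside \<open>\<kappa> Y\<close> survives because down-closure
  forbids any member of \<open>\<kappa> Z\<close> to restrict to it. Finiteness of \<open>H\<close>
  matters because sums over infinite sets are zero by convention.\<close>

lemma passes_test_mono:
  assumes fin: "finite (sdom A)"
    and fH: "\<And>X. finite (H X)"
    and sub: "\<kappa> \<le> H"
    and cons: "k_consistent A T k \<kappa>"
    and rel: "relevant A k X"
    and pass: "passes_test A T k \<kappa> X f" and phi: "f \<in> \<kappa> X"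
  shows "passes_test A T k H X f"
proof -
  obtain x where x: "Lk_solution A T k \<kappa> x" "x X f = 1" "\<forall>g\<in>\<kappa> X - {f}. x X g = 0"
    using pass unfolding passes_test_def by blast
  define y where "y = (\<lambda>X g. if g \<in> \<kappa> X then x X g else 0)"
  have sub': "\<kappa> Z \<subseteq> H Z" for Z using sub by (auto simp: le_fun_def)
  have "Lk_solution A T k H y"
    unfolding Lk_solution_def
  proof (intro conjI allI impI)
    fix Z assume Z: "relevant A k Z"
    have "(\<Sum>f\<in>H Z. y Z f) = (\<Sum>f\<in>\<kappa> Z. y Z f)"
      by (rule sum.mono_neutral_right) (use fH sub' in \<open>auto simp: y_def\<close>)
    also have "\<dots> = (\<Sum>f\<in>\<kappa> Z. x Z f)" by (rule sum.cong) (auto simp: y_def)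
    finally show "(\<Sum>f\<in>H Z. y Z f) = 1" using x(1) Z unfolding Lk_solution_def by simp
  next
    fix Z Y g assume Z: "relevant A k Z" and Y: "Y \<subseteq> Z" and g: "g \<in> H Y"
    have eq: "(\<Sum>f\<in>{f\<in>H Z. restrict f Y = g}. y Z f) = (\<Sum>f\<in>{f\<in>\<kappa> Z. restrict f Y = g}. x Z f)"
    proof -
      have "(\<Sum>f\<in>{f\<in>H Z. restrict f Y = g}. y Z f) = (\<Sum>f\<in>{f\<in>\<kappa> Z. restrict f Y = g}. y Z f)"
        by (rule sum.mono_neutral_right) (use fH sub' in \<open>auto simp: y_def\<close>)
      also have "\<dots> = (\<Sum>f\<in>{f\<in>\<kappa> Z. restrict f Y = g}. x Z f)"
        by (rule sum.cong) (auto simp: y_def)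
      finally show ?thesis .
    qed
    show "(\<Sum>f\<in>{f\<in>H Z. restrict f Y = g}. y Z f) = y Y g"
    proof (cases "g \<in> \<kappa> Y")
      case True
      then show ?thesis using eq x(1) Z Y unfolding Lk_solution_def by (simp add: y_def)
    next
      case False
      have "{f\<in>\<kappa> Z. restrict f Y = g} = {}"
        using False cons Z Y unfolding k_consistent_def by blast
      then have "(\<Sum>f\<in>{f\<in>\<kappa> Z. restrict f Y = g}. x Z f) = 0"
        by (simp only: sum.empty)
      then show ?thesis using eq False unfolding y_def by argo
    qed
  qed
  moreover have "y X f = 1" using x(2) phi by (simp add: y_def)
  moreover have "\<forall>g\<in>H X - {f}. y X g = 0" using x(3) by (auto simp: y_def)
  ultimately show ?thesis unfolding passes_test_def by blast
qed

lemma finite_coh_init: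
  assumes "finite (sdom A)" "finite (sdom T)"
  shows "finite (coh_init A T k X)"
proof (cases "relevant A k X")
  case True
  then have "finite X" using assms(1) unfolding relevant_def by (meson finite_subset)
  then have "finite (X \<rightarrow>\<^sub>E sdom T)" using assms(2) by (intro finite_PiE) auto
  then show ?thesis unfolding coh_init_def hom_sub_def by (auto intro: finite_subset)
qed (simp add: coh_init_def)

lemma decseq_finite_stabilises:
  fixes S :: "nat \<Rightarrow> 'a set"
  assumes "finite (S 0)" "\<And>i. S (Suc i) \<subseteq> S i"
  shows "\<exists>i. S (Suc i) = S i"
proof (rule ccontr)
  assume neg: "\<not> ?thesis"
  have fin: "finite (S i)" for i
    by (induction i) (use assms in \<open>auto dest: finite_subset\<close>)
  have "card (S i) + i \<le> card (S 0)" for i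
  proof (induction i)
    case (Suc i)
    have "card (S (Suc i)) < card (S i)"
      using assms(2)[of i] neg fin[of i] by (intro psubset_card_mono) auto
    then show ?case using Suc by simp
  qed simp
  from this[of "Suc (card (S 0))"] show False by simp
qed

text \<open>\<open>\<kappa>\<close> stays below every stage of the run: consistency protects it from
  \<open>max_consistent\<close>, and a test passed inside \<open>\<kappa>\<close> is passed inside
  any larger collection. The stages decrease within a finite set, so they reach a fixed point above
  the nonempty \<open>\<kappa>\<close>. Since collections are total functions,
  \<open>\<kappa>\<close> must be empty off the relevant sets to lie below
  \<open>coh_init\<close>.\<close>

lemma coh_acceptsI:
  assumes fA: "finite (sdom A)" and fT: "finite (sdom T)"
    and cons: "k_consistent A T k \<kappa>"
    and ne: "\<And>X. relevant A k X \<Longrightarrow> \<kappa> X \<noteq> {}"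
    and irr: "\<And>X. \<not> relevant A k X \<Longrightarrow> \<kappa> X = {}"
    and pass: "\<And>X f. relevant A k X \<Longrightarrow> f \<in> \<kappa> X \<Longrightarrow> passes_test A T k \<kappa> X f"
  shows "coh_accepts A T k"
proof -
  define H where "H = (\<lambda>i. (coh_step A T k ^^ i) (coh_init A T k))"
  have HS: "H (Suc i) = coh_step A T k (H i)" for i by (simp add: H_def)
  have dec: "H (Suc i) \<le> H i" for i unfolding HS by (rule coh_step_le)
  have init: "H i \<le> coh_init A T k" for i
  proof (induction i)
    case 0 then show ?case by (simp add: H_def)
  next
    case (Suc i) then show ?case using dec[of i] by (rule order_trans[rotated])
  qed
  have lower: "\<kappa> \<le> H i" for i
  proof (induction i)
    case 0
    show ?case
      using cons irr unfolding H_def coh_init_def k_consistent_def le_fun_def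
      by auto
  next
    case (Suc i)
    let ?H1 = "max_consistent A T k (H i)"
    have k1: "\<kappa> \<le> ?H1" by (rule le_max_consistent[OF Suc cons])
    have f1: "finite (?H1 X)" for X
    proof -
      have "?H1 X \<subseteq> coh_init A T k X"
        using max_consistent_le[of A T k "H i"] init[of i] unfolding le_fun_def by blast
      then show ?thesis using finite_coh_init[OF fA fT] finite_subset by blast
    qed
    show ?case unfolding HS coh_step_def Let_def le_fun_def
    proof (intro allI subsetI)
      fix X f assume f: "f \<in> \<kappa> X"
      then have rel: "relevant A k X" using irr by blast
      have "f \<in> ?H1 X" using k1 f unfolding le_fun_def by blast
      moreover have "passes_test A T k ?H1 X f"
        by (rule passes_test_mono[OF fA f1 k1 cons rel pass[OF rel f] f])
      ultimately show "f \<in> {f \<in> ?H1 X. passes_test A T k ?H1 X f}" by simp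
    qed
  qed
  \<comment> \<open>Packing a stage into one finite set of pairs reduces termination to a decreasing
    sequence of finite sets.\<close>
  define S where "S = (\<lambda>i. SIGMA X:{X. relevant A k X}. H i X)"
  have "finite {X. relevant A k X}"
    by (rule finite_subset[of _ "Pow (sdom A)"]) (use fA in \<open>auto simp: relevant_def\<close>)
  then have "finite (S 0)"
    unfolding S_def using finite_coh_init[OF fA fT, of k] by (auto simp: H_def)
  moreover have "S (Suc i) \<subseteq> S i" for i
    using dec[of i] unfolding S_def le_fun_def by blast
  ultimately obtain i where i: "S (Suc i) = S i" using decseq_finite_stabilises by blast
  have "H (Suc i) X = H i X" for X
  proof (cases "relevant A k X")
    case True
    have "H j X = {f. (X, f) \<in> S j}" for j using True by (auto simp: S_def)
    then show ?thesis using i by simp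
  next
    case False
    then have "coh_init A T k X = {}" by (simp add: coh_init_def)
    then show ?thesis using init unfolding le_fun_def by (metis subset_empty)
  qed
  then have "H (Suc i) = H i" by auto
  moreover have "H i X \<noteq> {}" if "relevant A k X" for X
    using ne[OF that] lower[of i] unfolding le_fun_def by blast
  ultimately show ?thesis unfolding coh_accepts_def H_def by blast
qed

section \<open>Standard monomials and an integral functional\<close>

text \<open>A 0/1 point is represented by the set \<open>p\<close> of its coordinates equal to 1 and
  a squarefree monomial by its set of variables, so evaluation is inclusion.\<close>

definition mon :: "nat set \<Rightarrow> nat set \<Rightarrow> int" where
  "mon m p = of_bool (m \<subseteq> p)"

abbreviation comb :: "nat set \<Rightarrow> (nat set \<Rightarrow> int) \<Rightarrow> nat set \<Rightarrow> int" where
  "comb N c p \<equiv> (\<Sum>m\<in>Pow N. c m * mon m p)"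

abbreviation wt :: "nat set \<Rightarrow> nat" where
  "wt \<equiv> set_encode"

text \<open>Monomials are ordered by \<open>wt\<close>, the colexicographic order.\<close>

definition lowspan :: "nat set set \<Rightarrow> nat set \<Rightarrow> nat \<Rightarrow> (nat set \<Rightarrow> int) set" where
  "lowspan P N w = {f. \<exists>c. (\<forall>m. c m \<noteq> 0 \<longrightarrow> m \<subseteq> N \<and> wt m < w) \<and>
     (\<forall>p\<in>P. f p = comb N c p)}"

lemma lowspan_cong: "f \<in> lowspan P N w \<Longrightarrow> (\<And>p. p \<in> P \<Longrightarrow> g p = f p) \<Longrightarrow> g \<in> lowspan P N w"
  unfolding lowspan_def by auto

lemma lowspan_mono: "w \<le> w' \<Longrightarrow> lowspan P N w \<subseteq> lowspan P N w'"
  unfolding lowspan_def by (intro Collect_mono ex_mono) (auto dest: less_le_trans)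

lemma lowspan_zero: "(\<lambda>p. 0) \<in> lowspan P N w"
  unfolding lowspan_def by (auto intro!: exI[of _ "\<lambda>_. 0"])

lemma lowspan_add:
  assumes "f \<in> lowspan P N w" "g \<in> lowspan P N w"
  shows "(\<lambda>p. f p + g p) \<in> lowspan P N w"
proof -
  obtain c d where
    "\<forall>m. c m \<noteq> 0 \<longrightarrow> m \<subseteq> N \<and> wt m < w" "\<forall>p\<in>P. f p = comb N c p"
    "\<forall>m. d m \<noteq> 0 \<longrightarrow> m \<subseteq> N \<and> wt m < w" "\<forall>p\<in>P. g p = comb N d p"
    using assms unfolding lowspan_def by blast
  then show ?thesis unfolding lowspan_def
    by (intro CollectI exI[of _ "\<lambda>m. c m + d m"] conjI allI impI)
       (metis add.right_neutral, metis add.right_neutral, simp add: distrib_right sum.distrib)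
qed

lemma lowspan_scale:
  assumes "f \<in> lowspan P N w"
  shows "(\<lambda>p. a * f p) \<in> lowspan P N w"
proof -
  obtain c where
    "\<forall>m. c m \<noteq> 0 \<longrightarrow> m \<subseteq> N \<and> wt m < w" "\<forall>p\<in>P. f p = comb N c p"
    using assms unfolding lowspan_def by blast
  then show ?thesis unfolding lowspan_def
    by (intro CollectI exI[of _ "\<lambda>m. a * c m"]) (auto simp: sum_distrib_left mult.assoc)
qed

lemma lowspan_sum:
  assumes "\<And>i. i \<in> I \<Longrightarrow> f i \<in> lowspan P N w"
  shows "(\<lambda>p. \<Sum>i\<in>I. f i p) \<in> lowspan P N w"
proof (cases "finite I")
  case True
  then show ?thesis using assms
    by (induction I rule: finite_induct) (auto intro: lowspan_zero lowspan_add)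
qed (simp add: lowspan_zero)

lemma lowspan_mon:
  assumes "finite N" "m \<subseteq> N" "wt m < w"
  shows "mon m \<in> lowspan P N w"
proof -
  have "(\<Sum>m'\<in>Pow N. of_bool (m' = m) * mon m' p) = mon m p" for p
  proof -
    have "(\<Sum>m'\<in>Pow N. of_bool (m' = m) * mon m' p) = (\<Sum>m'\<in>Pow N. if m' = m then mon m' p else 0)"
      by (rule sum.cong) auto
    then show ?thesis using assms by simp
  qed
  then show ?thesis using assms unfolding lowspan_def
    by (intro CollectI exI[of _ "\<lambda>m'. of_bool (m' = m)"]) auto
qed

lemma set_encode_insert_le: "finite m \<Longrightarrow> wt (insert e m) \<le> wt m + 2 ^ e"
  by (cases "e \<in> m") (auto simp: insert_absorb)

lemma set_encode_less_power:
  assumes "finite m" "\<And>e. e \<in> m \<Longrightarrow> e < b"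
  shows "wt m < 2 ^ b"
proof -
  have "wt m \<le> (\<Sum>i<b. 2 ^ i)"
    unfolding set_encode_def by (rule sum_mono2) (use assms in auto)
  also have "\<dots> < (2::nat) ^ b" by (induction b) auto
  finally show ?thesis .
qed

text \<open>Variables are idempotent on 0/1 points, so multiplication by the variable
  \<open>e\<close> turns \<open>m\<close> into \<open>insert e m\<close>, whose weight grows by
  \<open>2 ^ e\<close> or not at all.\<close>

lemma lowspan_mult_var:
  assumes "finite N" "e \<in> N" "f \<in> lowspan P N w"
  shows "(\<lambda>p. f p * of_bool (e \<in> p)) \<in> lowspan P N (w + 2 ^ e)"
proof -
  obtain c where c: "\<forall>m. c m \<noteq> 0 \<longrightarrow> m \<subseteq> N \<and> wt m < w"
     "\<forall>p\<in>P. f p = comb N c p"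
    using assms unfolding lowspan_def by blast
  have "(\<lambda>p. \<Sum>m\<in>Pow N. c m * mon (insert e m) p) \<in> lowspan P N (w + 2 ^ e)"
  proof (rule lowspan_sum)
    fix m assume m: "m \<in> Pow N"
    show "(\<lambda>p. c m * mon (insert e m) p) \<in> lowspan P N (w + 2 ^ e)"
    proof (cases "c m = 0")
      case False
      have "wt (insert e m) < w + 2 ^ e"
        using set_encode_insert_le[of m e] c(1) False m assms(1)
        by (meson PowD add_less_mono1 finite_subset le_less_trans)
      then show ?thesis using m assms by (intro lowspan_scale lowspan_mon) auto
    qed (simp add: lowspan_zero)
  qed
  then show ?thesis
    by (rule lowspan_cong) (auto simp: c(2) sum_distrib_right mon_def intro!: sum.cong)
qed

lemma sum_Pow_insert:
  fixes f :: "'a set \<Rightarrow> 'b::comm_monoid_add"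
  assumes "finite A" "b \<notin> A"
  shows "sum f (Pow (insert b A)) = sum f (Pow A) + (\<Sum>m\<in>Pow A. f (insert b m))"
proof -
  have "sum f (Pow (insert b A)) = sum f (Pow A) + sum f (insert b ` Pow A)"
    unfolding Pow_insert by (rule sum.union_disjoint) (use assms in auto)
  also have "sum f (insert b ` Pow A) = (\<Sum>m\<in>Pow A. f (insert b m))"
    by (subst sum.reindex) (use assms in \<open>auto simp: inj_on_def o_def\<close>)
  finally show ?thesis .
qed

text \<open>Moebius inversion on the Boolean cube: coefficients are iterated differences and hence
  integers. One variable \<open>b\<close> is split off at a time, \<open>k1\<close> describing the
  face without \<open>b\<close> and \<open>k2\<close> the difference of the two faces.\<close>

lemma mon_interpolation:
  fixes F :: "nat set \<Rightarrow> int"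
  assumes "finite A"
  shows "\<exists>k. \<forall>y. y \<subseteq> A \<longrightarrow> F y = comb A k y"
  using assms
proof (induction A arbitrary: F rule: finite_induct)
  case empty
  then show ?case by (auto simp: mon_def intro!: exI[of _ "\<lambda>_. F {}"])
next
  case (insert b A)
  obtain k1 where k1: "\<And>y. y \<subseteq> A \<Longrightarrow> F y = comb A k1 y"
    using insert.IH[of F] by blast
  obtain k2 where k2: "\<And>y. y \<subseteq> A \<Longrightarrow> F (insert b y) - F y = comb A k2 y"
    using insert.IH[of "\<lambda>y. F (insert b y) - F y"] by blast
  define k where "k = (\<lambda>m. if b \<in> m then k2 (m - {b}) else k1 m)"
  have "F y = comb (insert b A) k y" if "y \<subseteq> insert b A" for y
  proof -
    have 1: "comb A k y = comb A k1 (y - {b})"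
      by (rule sum.cong) (use insert.hyps in \<open>auto simp: k_def mon_def\<close>)
    have 2: "(\<Sum>m\<in>Pow A. k (insert b m) * mon (insert b m) y) =
        of_bool (b \<in> y) * comb A k2 (y - {b})"
      unfolding sum_distrib_left
    proof (rule sum.cong)
      fix m assume "m \<in> Pow A"
      then have "b \<notin> m" using insert.hyps by auto
      then show "k (insert b m) * mon (insert b m) y = of_bool (b \<in> y) * (k2 m * mon m (y - {b}))"
        by (auto simp: k_def mon_def)
    qed simp
    have y: "y - {b} \<subseteq> A" using that by auto
    show ?thesis
      unfolding sum_Pow_insert[OF insert.hyps] 1 2 k1[OF y, symmetric] k2[OF y, symmetric]
      by (cases "b \<in> y") (auto simp: insert_absorb)
  qed
  then show ?case by blast
qed

text \<open>This saturation is what makes standard monomials a basis over the integers and not merely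
  over the rationals; it rests on the points being 0/1 vectors.\<close>

lemma lowspan_saturated:
  assumes "finite N" "m \<subseteq> N" "P \<subseteq> Pow N" "a \<noteq> 0"
    "(\<lambda>p. a * mon m p) \<in> lowspan P N (wt m)"
  shows "mon m \<in> lowspan P N (wt m)"
  using assms
proof (induction N arbitrary: m P rule: finite_linorder_max_induct)
  case empty
  then have m: "m = {}" by simp
  have "wt m = 0" using m by simp
  then have "\<And>p. p \<in> P \<Longrightarrow> a * mon m p = 0"
    using empty.prems unfolding lowspan_def by auto
  then have "\<And>p. p \<in> P \<Longrightarrow> mon m p = 0" using empty.prems by simp
  then show ?case by (intro lowspan_cong[OF lowspan_zero]) auto
next
  case (insert b A)
  have bA: "b \<notin> A" using insert.hyps by auto
  have small: "wt m' < 2 ^ b" if "m' \<subseteq> A" for m'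
    using that insert.hyps by (intro set_encode_less_power) (auto intro: finite_subset)
  have fin: "finite m'" if "m' \<subseteq> insert b A" for m'
    using that insert.hyps(1) by (auto intro: finite_subset)
  obtain c where c: "\<And>m'. c m' \<noteq> 0 \<Longrightarrow> m' \<subseteq> insert b A \<and> wt m' < wt m"
     "\<And>p. p \<in> P \<Longrightarrow> a * mon m p = comb (insert b A) c p"
    using insert.prems(4) unfolding lowspan_def by blast
  show ?case
  proof (cases "b \<in> m")
    case False
    then have mA: "m \<subseteq> A" using insert.prems by auto
    \<comment> \<open>Since \<open>m\<close> avoids the largest variable,
      \<open>wt m < 2 ^ b\<close>; the relation therefore involves no monomial with
      \<open>b\<close>, and the points may be projected along \<open>b\<close>.\<close>
    have cA: "m' \<subseteq> A" if "c m' \<noteq> 0" for m'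
    proof -
      have "wt m' < 2 ^ b" using c(1)[OF that] small[OF mA] by auto
      moreover have "2 ^ b \<le> wt m'" if "b \<in> m'"
        using that fin[of m'] c(1)[OF \<open>c m' \<noteq> 0\<close>]
        unfolding set_encode_def by (intro member_le_sum) auto
      ultimately show ?thesis using c(1)[OF that] by (meson leD subset_insert)
    qed
    have sumA: "(\<Sum>m'\<in>Pow (insert b A). c m' * g m') = (\<Sum>m'\<in>Pow A. c m' * g m')" for g :: "nat set \<Rightarrow> int"
      by (rule sum.mono_neutral_right) (use insert.hyps cA in auto)
    have drop: "mon m' (p - {b}) = mon m' p" if "m' \<subseteq> A" for m' p
      using that bA by (auto simp: mon_def)
    have h: "(\<lambda>p. a * mon m p) \<in> lowspan ((\<lambda>p. p - {b}) ` P) A (wt m)"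
      unfolding lowspan_def
    proof (intro CollectI exI[of _ c] conjI allI impI ballI)
      fix q assume "q \<in> (\<lambda>p. p - {b}) ` P"
      then obtain p where p: "p \<in> P" "q = p - {b}" by blast
      have "comb A c q = comb A c p"
        by (rule sum.cong) (auto simp: p drop)
      then show "a * mon m q = comb A c q"
        using c(2)[OF p(1)] sumA[of "\<lambda>m'. mon m' p"] by (simp add: p drop[OF mA])
    qed (use c(1) cA in blast)+
    have "(\<lambda>p. p - {b}) ` P \<subseteq> Pow A" using insert.prems(2) by auto
    from insert.IH[OF mA this insert.prems(3) h]
    have "mon m \<in> lowspan ((\<lambda>p. p - {b}) ` P) A (wt m)" .
    then obtain c' where c'0: "\<forall>m'. c' m' \<noteq> 0 \<longrightarrow> m' \<subseteq> A \<and> wt m' < wt m"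
     "\<forall>q\<in>(\<lambda>p. p - {b}) ` P. mon m q = comb A c' q"
      unfolding lowspan_def by (elim CollectE exE conjE)
    have c': "\<And>m'. c' m' \<noteq> 0 \<Longrightarrow> m' \<subseteq> A \<and> wt m' < wt m"
     "\<And>p. p \<in> P \<Longrightarrow> mon m (p - {b}) = comb A c' (p - {b})"
      using c'0 by auto
    have "(\<lambda>p. \<Sum>m'\<in>Pow A. c' m' * mon m' p) \<in> lowspan P (insert b A) (wt m)"
    proof (rule lowspan_sum)
      fix m' assume "m' \<in> Pow A"
      then show "(\<lambda>p. c' m' * mon m' p) \<in> lowspan P (insert b A) (wt m)"
        using c'(1)[of m'] insert.hyps(1)
        by (cases "c' m' = 0") (auto intro!: lowspan_zero lowspan_scale lowspan_mon)
    qed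
    then show ?thesis
    proof (rule lowspan_cong)
      fix p assume p: "p \<in> P"
      have "comb A c' (p - {b}) = comb A c' p"
        by (rule sum.cong) (auto simp: drop)
      then show "mon m p = comb A c' p"
        using c'(2)[OF p] drop[OF mA] by simp
    qed
  next
    case True
    define m0 where "m0 = m - {b}"
    have m0: "m0 \<subseteq> A" "b \<notin> m0" "m = insert b m0" "finite m0"
      using True insert.prems(1) fin[OF insert.prems(1)] by (auto simp: m0_def)
    have wm: "wt m = 2 ^ b + wt m0" using m0 by simp
    have wins: "wt (insert b m') = 2 ^ b + wt m'" if "m' \<subseteq> A" for m'
      using that bA fin[of m'] by (subst set_encode_insert) auto
    \<comment> \<open>On pairs of points that differ only in \<open>b\<close>, the two instances of
      the relation subtract to a relation of the same shape for \<open>m0\<close>, with coefficients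
      \<open>c (insert b m')\<close>. Induction applies to it.\<close>
    define Y where "Y = {y \<in> Pow A. y \<in> P \<and> insert b y \<in> P}"
    have "(\<lambda>y. a * mon m0 y) \<in> lowspan Y A (wt m0)"
      unfolding lowspan_def
    proof (intro CollectI exI[of _ "\<lambda>m'. if m' \<subseteq> A then c (insert b m') else 0"] conjI allI impI ballI)
      fix m' assume "(if m' \<subseteq> A then c (insert b m') else 0) \<noteq> 0"
      then have m': "m' \<subseteq> A" "c (insert b m') \<noteq> 0" by (auto split: if_splits)
      then show "m' \<subseteq> A" by simp
      show "wt m' < wt m0"
        using c(1)[OF m'(2)] wm wins[OF m'(1)] by simp
    next
      fix y assume "y \<in> Y"
      then have y: "y \<subseteq> A" "y \<in> P" "insert b y \<in> P" "b \<notin> y" using bA by (auto simp: Y_def)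
      have "a * mon m y = comb A c y
          + (\<Sum>m'\<in>Pow A. c (insert b m') * mon (insert b m') y)"
        using c(2)[OF y(2)] by (simp add: sum_Pow_insert[OF insert.hyps(1) bA])
      moreover have "mon m y = 0" "\<And>m'. mon (insert b m') y = 0"
        using y(4) True by (auto simp: mon_def)
      ultimately have 1: "0 = comb A c y" by simp
      have "a * mon m (insert b y) = comb A c (insert b y)
          + (\<Sum>m'\<in>Pow A. c (insert b m') * mon (insert b m') (insert b y))"
        using c(2)[OF y(3)] by (simp add: sum_Pow_insert[OF insert.hyps(1) bA])
      moreover have "comb A c (insert b y) = comb A c y"
        by (rule sum.cong) (use bA in \<open>auto simp: mon_def\<close>)
      moreover have "(\<Sum>m'\<in>Pow A. c (insert b m') * mon (insert b m') (insert b y)) =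
          (\<Sum>m'\<in>Pow A. (if m' \<subseteq> A then c (insert b m') else 0) * mon m' y)"
        by (rule sum.cong) (use bA in \<open>auto simp: mon_def\<close>)
      moreover have "mon m (insert b y) = mon m0 y" using m0 by (auto simp: mon_def)
      ultimately show "a * mon m0 y = (\<Sum>m'\<in>Pow A. (if m' \<subseteq> A then c (insert b m') else 0) * mon m' y)"
        using 1 by simp
    qed
    moreover have "Y \<subseteq> Pow A" by (auto simp: Y_def)
    ultimately have "mon m0 \<in> lowspan Y A (wt m0)"
      using insert.IH[OF m0(1) _ insert.prems(3)] by simp
    then obtain c1 where c1': "\<forall>m'. c1 m' \<noteq> 0 \<longrightarrow> m' \<subseteq> A \<and> wt m' < wt m0"
      "\<forall>y\<in>Y. mon m0 y = comb A c1 y"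
      unfolding lowspan_def by (elim CollectE exE conjE)
    have c1: "\<And>m'. c1 m' \<noteq> 0 \<Longrightarrow> m' \<subseteq> A \<and> wt m' < wt m0"
      "\<And>y. y \<in> Y \<Longrightarrow> mon m0 y = comb A c1 y"
      using c1' by auto
    define g where "g = (\<lambda>y. mon m0 y - comb A c1 y)"
    \<comment> \<open>The error left after lifting \<open>c1\<close> back to monomials with
      \<open>b\<close> is \<open>g y\<close> at points containing \<open>b\<close> and 0 elsewhere.
      As \<open>g\<close> vanishes on \<open>Y\<close>, this is a function of the other coordinates
      alone, and any such function is affordable: every monomial without \<open>b\<close> weighs
      less than \<open>m\<close>.\<close>
    obtain k where k: "\<And>y. y \<subseteq> A \<Longrightarrow>
        (if insert b y \<in> P then g y else 0) = comb A k y"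
      using mon_interpolation[OF insert.hyps(1), of "\<lambda>y. if insert b y \<in> P then g y else 0"] by blast
    have "(\<lambda>p. comb A k p + (\<Sum>m'\<in>Pow A. c1 m' * mon (insert b m') p))
        \<in> lowspan P (insert b A) (wt m)"
    proof (intro lowspan_add lowspan_sum)
      fix m' assume m': "m' \<in> Pow A"
      show "(\<lambda>p. k m' * mon m' p) \<in> lowspan P (insert b A) (wt m)"
        using m' small[of m'] wm insert.hyps(1) by (intro lowspan_scale lowspan_mon) auto
      show "(\<lambda>p. c1 m' * mon (insert b m') p) \<in> lowspan P (insert b A) (wt m)"
        using m' c1(1)[of m'] wm wins[of m'] insert.hyps(1)
        by (cases "c1 m' = 0") (auto intro!: lowspan_zero lowspan_scale lowspan_mon)
    qed
    then show ?thesis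
    proof (rule lowspan_cong)
      fix p assume p: "p \<in> P"
      define y where "y = p - {b}"
      have yA: "y \<subseteq> A" using p insert.prems(2) by (auto simp: y_def)
      have 1: "comb A k p = comb A k y"
        by (rule sum.cong) (use bA in \<open>auto simp: mon_def y_def\<close>)
      have 2: "(\<Sum>m'\<in>Pow A. c1 m' * mon (insert b m') p) = of_bool (b \<in> p) * comb A c1 y"
        unfolding sum_distrib_left by (rule sum.cong) (use bA in \<open>auto simp: mon_def y_def\<close>)
      have 3: "mon m p = of_bool (b \<in> p) * mon m0 y"
        using m0 by (auto simp: mon_def y_def)
      show "mon m p = comb A k p + (\<Sum>m'\<in>Pow A. c1 m' * mon (insert b m') p)"
      proof (cases "b \<in> p")
        case True
        then have "insert b y \<in> P" using p by (simp add: y_def insert_absorb)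
        then have "comb A k y = g y" using k[OF yA] by simp
        then show ?thesis unfolding 1 2 3 using True by (simp add: g_def)
      next
        case False
        then have yp: "y = p" by (simp add: y_def)
        have "(if insert b y \<in> P then g y else 0) = 0"
          using c1(2)[of y] yp p yA by (simp add: Y_def g_def)
        then show ?thesis unfolding 1 2 3 using False k[OF yA] by simp
      qed
    qed
  qed
qed

section \<open>Pulling monomials back along a section of the restriction map\<close>

abbreviation lowers :: "nat set set \<Rightarrow> nat set \<Rightarrow> (nat set \<Rightarrow> nat set) \<Rightarrow> nat \<Rightarrow> bool" where
  "lowers P N \<rho> e \<equiv> (\<exists>a. \<forall>p\<in>P. of_bool (e \<in> \<rho> p) = (a::int)) \<or>
     (\<exists>a b e'. e' \<in> N \<and> e' < e \<and> (\<forall>p\<in>P. of_bool (e \<in> \<rho> p) = (a::int) + b * of_bool (e' \<in> p)))"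

text \<open>In the product over \<open>m\<close>, each factor is kept, replaced by a constant, or
  replaced by an affine function of a variable \<open>e' < e\<close>; none of this raises the
  weight. The bound \<open>Suc (wt m)\<close> expresses weight at most \<open>wt m\<close>, as
  \<open>lowspan\<close> is strict.\<close>

lemma lowspan_subst:
  assumes N: "finite N" and m: "finite m"
    and keep: "\<And>p. p \<in> P \<Longrightarrow> \<rho> p \<inter> N = p \<inter> N"
    and sub: "\<And>e. e \<in> m - N \<Longrightarrow> lowers P N \<rho> e"
  shows "(\<lambda>p. mon m (\<rho> p)) \<in> lowspan P N (Suc (wt m))"
  using m sub
proof (induction m rule: finite_induct)
  case empty
  have "mon {} \<in> lowspan P N (Suc (wt {}))" using N by (intro lowspan_mon) auto
  then show ?case by (rule lowspan_cong) (simp add: mon_def)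
next
  case (insert e m)
  let ?f = "\<lambda>p. mon m (\<rho> p)" and ?w = "Suc (wt m)"
  have IH: "?f \<in> lowspan P N ?w" using insert by blast
  have w: "Suc (wt (insert e m)) = ?w + 2 ^ e" using insert by simp
  have eq: "mon (insert e m) (\<rho> p) = ?f p * of_bool (e \<in> \<rho> p)" for p
    by (auto simp: mon_def)
  have lift: "?f \<in> lowspan P N (?w + 2 ^ e)" using IH lowspan_mono[of ?w "?w + 2 ^ e"] by auto
  consider "e \<in> N" | a where "\<forall>p\<in>P. of_bool (e \<in> \<rho> p) = (a::int)"
    | a b e' where "e' \<in> N" "e' < e" "\<forall>p\<in>P. of_bool (e \<in> \<rho> p) = (a::int) + b * of_bool (e' \<in> p)"
    using insert.prems[of e] by blast
  then show ?case unfolding w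
  proof cases
    case 1
    have "(\<lambda>p. ?f p * of_bool (e \<in> p)) \<in> lowspan P N (?w + 2 ^ e)"
      by (rule lowspan_mult_var[OF N 1 IH])
    then show "(\<lambda>p. mon (insert e m) (\<rho> p)) \<in> lowspan P N (?w + 2 ^ e)"
    proof (rule lowspan_cong)
      fix p assume "p \<in> P"
      then have "e \<in> \<rho> p \<longleftrightarrow> e \<in> p" using keep[of p] 1 by blast
      then show "mon (insert e m) (\<rho> p) = ?f p * of_bool (e \<in> p)" by (simp add: eq)
    qed
  next
    case (2 a)
    show "(\<lambda>p. mon (insert e m) (\<rho> p)) \<in> lowspan P N (?w + 2 ^ e)"
      by (rule lowspan_cong[OF lowspan_scale[OF lift, of a]]) (use 2 in \<open>auto simp: eq\<close>)
  next
    case (3 a b e')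
    have "(\<lambda>p. ?f p * of_bool (e' \<in> p)) \<in> lowspan P N (?w + 2 ^ e')"
      by (rule lowspan_mult_var[OF N 3(1) IH])
    moreover have "?w + 2 ^ e' \<le> ?w + 2 ^ e" using 3(2) by simp
    ultimately have "(\<lambda>p. ?f p * of_bool (e' \<in> p)) \<in> lowspan P N (?w + 2 ^ e)"
      using lowspan_mono by blast
    then have "(\<lambda>p. a * ?f p + b * (?f p * of_bool (e' \<in> p))) \<in> lowspan P N (?w + 2 ^ e)"
      by (intro lowspan_add lowspan_scale lift)
    then show "(\<lambda>p. mon (insert e m) (\<rho> p)) \<in> lowspan P N (?w + 2 ^ e)"
    proof (rule lowspan_cong)
      fix p assume "p \<in> P"
      then show "mon (insert e m) (\<rho> p) = a * ?f p + b * (?f p * of_bool (e' \<in> p))"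
        using 3(3) unfolding eq by (simp add: algebra_simps)
    qed
  qed
qed

text \<open>\<open>R\<close> stores for the code of a reducible monomial one rewriting into smaller
  monomials. Reading off the constant term of the fully rewritten form means that an irreducible
  monomial counts 1 if it is empty (code 0) and 0 otherwise. Codes replace sets so that the
  recursion descends along the order of \<open>nat\<close>.\<close>

fun normal_form_eval :: "(nat \<Rightarrow> (nat set \<Rightarrow> int) option) \<Rightarrow> nat \<Rightarrow> int" where
  "normal_form_eval R n = (case R n of None \<Rightarrow> of_bool (n = 0)
     | Some c \<Rightarrow> (\<Sum>j<n. c (set_decode j) * normal_form_eval R j))"

declare normal_form_eval.simps [simp del]

lemma sum_decode:
  fixes c :: "nat set \<Rightarrow> int"
  assumes "finite N" "\<And>m. c m \<noteq> 0 \<Longrightarrow> m \<subseteq> N \<and> wt m < w"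
  shows "(\<Sum>j<w. c (set_decode j) * f j) = (\<Sum>m\<in>Pow N. c m * f (wt m))"
proof (rule sum.reindex_bij_witness_not_neutral
    [where S' = "{j\<in>{..<w}. c (set_decode j) = 0}" and T' = "{m\<in>Pow N. c m = 0}"
      and i = wt and j = set_decode])
  show "finite {j\<in>{..<w}. c (set_decode j) = 0}" by simp
  show "finite {m\<in>Pow N. c m = 0}" using assms by simp
  have fin: "finite m" if "m \<in> Pow N" for m using that assms(1) by (auto intro: finite_subset)
  show "set_decode (wt m) = m" if "m \<in> Pow N - {m \<in> Pow N. c m = 0}" for m
    using that fin by simp
  show "wt m \<in> {..<w} - {j \<in> {..<w}. c (set_decode j) = 0}"
    if "m \<in> Pow N - {m \<in> Pow N. c m = 0}" for m
    using that fin[of m] assms(2)[of m] by simp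
qed (use assms in auto)

text \<open>Reducibility of a monomial is judged in the least member of \<open>\<N>\<close>
  containing it, so that \<open>L\<close> does not depend on the member in which a relation lives. A
  relation is killed by induction on its leading weight: a section carries it down to the least
  member of the leading monomial, saturation makes the leading coefficient 1, and the reduction
  obtained there holds on the larger member by restriction.\<close>

theorem compatible_functional_exists:
  fixes \<N> :: "nat set set" and P :: "nat set \<Rightarrow> nat set set"
  assumes fin: "\<And>N. N \<in> \<N> \<Longrightarrow> finite N"
    and inter: "\<And>N N'. N \<in> \<N> \<Longrightarrow> N' \<in> \<N> \<Longrightarrow> N \<inter> N' \<in> \<N>"
    and pow: "\<And>N. N \<in> \<N> \<Longrightarrow> P N \<subseteq> Pow N"
    and ne: "\<And>N. N \<in> \<N> \<Longrightarrow> P N \<noteq> {}"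
    and restr: "\<And>N N' p. N \<in> \<N> \<Longrightarrow> N' \<in> \<N> \<Longrightarrow> N \<subseteq> N' \<Longrightarrow> p \<in> P N' \<Longrightarrow> p \<inter> N \<in> P N"
    and sect: "\<And>N N'. N \<in> \<N> \<Longrightarrow> N' \<in> \<N> \<Longrightarrow> N \<subseteq> N' \<Longrightarrow>
       \<exists>\<rho>. (\<forall>p\<in>P N. \<rho> p \<in> P N' \<and> \<rho> p \<inter> N = p) \<and>
         (\<forall>e\<in>N' - N. lowers (P N) N \<rho> e)"
  shows "\<exists>L::nat set \<Rightarrow> int. L {} = 1 \<and> (\<forall>N\<in>\<N>. \<forall>c.
     (\<forall>p\<in>P N. comb N c p = 0) \<longrightarrow> (\<Sum>m\<in>Pow N. c m * L m) = 0)"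
proof -
  \<comment> \<open>Closure under intersections makes a member of least cardinality the least one
    under inclusion.\<close>
  define least where "least = (\<lambda>m. arg_min card (\<lambda>N. N \<in> \<N> \<and> m \<subseteq> N))"
  have least: "least m \<in> \<N>" "m \<subseteq> least m" "\<And>N. N \<in> \<N> \<Longrightarrow> m \<subseteq> N \<Longrightarrow> least m \<subseteq> N"
    if ex: "N \<in> \<N>" "m \<subseteq> N" for m N
  proof -
    have l: "least m \<in> \<N> \<and> m \<subseteq> least m"
      unfolding least_def by (rule arg_min_natI[of "\<lambda>N. N \<in> \<N> \<and> m \<subseteq> N"]) (use ex in auto)
    then show "least m \<in> \<N>" "m \<subseteq> least m" by auto
    fix N' assume N': "N' \<in> \<N>" "m \<subseteq> N'"
    have "card (least m) \<le> card (least m \<inter> N')"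
      unfolding least_def by (rule arg_min_nat_le) (use l N' inter in \<open>auto simp: least_def\<close>)
    then have "least m \<inter> N' = least m" using l fin by (intro card_seteq) auto
    then show "least m \<subseteq> N'" by auto
  qed
  define red where "red = (\<lambda>m c. (\<forall>m'. c m' \<noteq> 0 \<longrightarrow> m' \<subseteq> least m \<and> wt m' < wt m) \<and>
     (\<forall>p\<in>P (least m). mon m p = comb (least m) c p))"
  define R where "R = (\<lambda>j. let m = set_decode j in
     if (\<exists>N\<in>\<N>. m \<subseteq> N) \<and> (\<exists>c. red m c) then Some (SOME c. red m c) else None)"
  define L where "L = (\<lambda>m. normal_form_eval R (wt m))"
  have L_red: "\<exists>c. red m c \<and> L m = (\<Sum>m'\<in>Pow (least m). c m' * L m')"
    if N: "N \<in> \<N>" "m \<subseteq> N" and ex: "\<exists>c. red m c" for m N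
  proof -
    have fm: "finite m" using N fin finite_subset by blast
    define c where "c = (SOME c. red m c)"
    have c: "red m c" unfolding c_def using someI_ex[OF ex] .
    have "R (wt m) = Some c"
      using N ex fm by (auto simp: R_def c_def Let_def)
    then have "L m = (\<Sum>j<wt m. c (set_decode j) * normal_form_eval R j)"
      unfolding L_def by (subst normal_form_eval.simps) simp
    also have "\<dots> = (\<Sum>m'\<in>Pow (least m). c m' * normal_form_eval R (wt m'))"
      by (rule sum_decode) (use c least(1)[OF N] fin in \<open>auto simp: red_def\<close>)
    finally show ?thesis using c unfolding L_def by blast
  qed
  \<comment> \<open>Nothing weighs less than the empty monomial, so a reduction of it would say 1 =
    0 at some point.\<close>
  have not_red: "\<not> red {} c" if nN: "N \<in> \<N>" for N c
  proof
    assume r: "red {} c"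
    obtain p where "p \<in> P (least {})" using ne least(1)[OF nN, of "{}"] by auto
    then have "1 = comb (least {}) c p" using r by (auto simp: red_def mon_def)
    moreover have "c m' = 0" for m' using r by (auto simp: red_def)
    ultimately show False by simp
  qed
  have L0: "L {} = 1"
  proof -
    have "R 0 = None" using not_red unfolding R_def Let_def by auto
    then show ?thesis unfolding L_def by (subst normal_form_eval.simps) simp
  qed
  have kill: "(\<Sum>m\<in>Pow N. c m * L m) = 0"
    if "N \<in> \<N>" "\<And>m. m \<subseteq> N \<Longrightarrow> c m \<noteq> 0 \<Longrightarrow> wt m < w"
      "\<And>p. p \<in> P N \<Longrightarrow> comb N c p = 0" for w N c
    using that
  proof (induction w arbitrary: c)
    case 0
    then have "c m = 0" if "m \<in> Pow N" for m using that by auto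
    then show ?case by simp
  next
    case (Suc w)
    have finN: "finite N" using fin Suc.prems(1) .
    define m0 where "m0 = set_decode w"
    have wm0: "wt m0 = w" "finite m0" by (simp_all add: m0_def)
    have lt: "wt m < w" if "m \<subseteq> N" "c m \<noteq> 0" "m \<noteq> m0" for m
    proof -
      have "finite m" using that finN finite_subset by blast
      then have "wt m \<noteq> w" using that(3) unfolding m0_def by (metis set_encode_inverse)
      then show ?thesis using Suc.prems(2)[OF that(1,2)] by simp
    qed
    show ?case
    proof (cases "m0 \<subseteq> N \<and> c m0 \<noteq> 0")
      case False
      show ?thesis
        by (rule Suc.IH) (use Suc.prems lt False in blast)+
    next
      case True
      then have m0N: "m0 \<subseteq> N" and cm0: "c m0 \<noteq> 0" by auto
      let ?N0 = "least m0"
      note N0 = least(1,2)[OF Suc.prems(1) m0N] least(3)[OF Suc.prems(1) m0N Suc.prems(1) m0N]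
      have fin0: "finite ?N0" using fin N0(1) .
      obtain \<rho> where \<rho>0: "\<forall>p\<in>P ?N0. \<rho> p \<in> P N \<and> \<rho> p \<inter> ?N0 = p"
        and \<rho>sub: "\<forall>e\<in>N - ?N0. lowers (P ?N0) ?N0 \<rho> e"
        using sect[OF N0(1) Suc.prems(1) N0(3)] by (elim exE conjE)
      have \<rho>: "\<rho> p \<in> P N" "\<rho> p \<inter> ?N0 = p" if "p \<in> P ?N0" for p
        using \<rho>0 that by auto
      \<comment> \<open>The relation is read at the points \<open>\<rho> p\<close> only: the leading
        monomial lies within \<open>?N0\<close> and is unchanged there, while all others pull back
        to weights below \<open>w\<close>.\<close>
      have "(\<lambda>p. \<Sum>m\<in>Pow N - {m0}. (- c m) * mon m (\<rho> p)) \<in> lowspan (P ?N0) ?N0 w"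
      proof (rule lowspan_sum)
        fix m assume m: "m \<in> Pow N - {m0}"
        show "(\<lambda>p. (- c m) * mon m (\<rho> p)) \<in> lowspan (P ?N0) ?N0 w"
        proof (cases "c m = 0")
          case False
          have "(\<lambda>p. mon m (\<rho> p)) \<in> lowspan (P ?N0) ?N0 (Suc (wt m))"
          proof (rule lowspan_subst[OF fin0])
            show "finite m" using m finN finite_subset by blast
            show "\<rho> p \<inter> ?N0 = p \<inter> ?N0" if "p \<in> P ?N0" for p
              using \<rho>(2)[OF that] by auto
          qed (rule bspec[OF \<rho>sub], use m in auto)
          moreover have "Suc (wt m) \<le> w" using lt[of m] m False by auto
          ultimately show ?thesis using lowspan_mono lowspan_scale by blast
        qed (simp add: lowspan_zero)
      qed
      then have "(\<lambda>p. c m0 * mon m0 p) \<in> lowspan (P ?N0) ?N0 w"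
      proof (rule lowspan_cong)
        fix p assume p: "p \<in> P ?N0"
        have "comb N c (\<rho> p) = c m0 * mon m0 (\<rho> p) + (\<Sum>m\<in>Pow N - {m0}. c m * mon m (\<rho> p))"
          using finN m0N by (intro sum.remove) auto
        moreover have "mon m0 (\<rho> p) = mon m0 p" using \<rho>(2)[OF p] N0(2) by (auto simp: mon_def)
        ultimately show "c m0 * mon m0 p = (\<Sum>m\<in>Pow N - {m0}. (- c m) * mon m (\<rho> p))"
          using Suc.prems(3)[OF \<rho>(1)[OF p]] by (simp add: sum_negf)
      qed
      then have "mon m0 \<in> lowspan (P ?N0) ?N0 (wt m0)"
        using wm0 by (intro lowspan_saturated[OF fin0 N0(2) pow[OF N0(1)] cm0]) simp
      then have "\<exists>c. red m0 c" unfolding lowspan_def red_def by blast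
      then obtain c' where c': "red m0 c'" "L m0 = (\<Sum>m'\<in>Pow ?N0. c' m' * L m')"
        using L_red[OF Suc.prems(1) m0N] by blast
      have c'sup: "\<And>m'. c' m' \<noteq> 0 \<Longrightarrow> m' \<subseteq> ?N0 \<and> wt m' < w"
        and c'eq: "\<And>p. p \<in> P ?N0 \<Longrightarrow> mon m0 p = comb ?N0 c' p"
        using c'(1) wm0 unfolding red_def by auto
      have c'm0: "c' m0 = 0" using c'sup[of m0] wm0 by auto
      \<comment> \<open>\<open>c2\<close> trades the leading monomial for its reduction. This lowers
        the leading weight and, by the choice of \<open>c'\<close>, leaves the value under
        \<open>L\<close> unchanged.\<close>
      define c2 where "c2 = (\<lambda>m. c m + c m0 * (c' m - of_bool (m = m0)))"
      have ext: "(\<Sum>m\<in>Pow N. c' m * h m) = (\<Sum>m\<in>Pow ?N0. c' m * h m)" for h :: "nat set \<Rightarrow> int"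
        by (rule sum.mono_neutral_right) (use finN N0(3) c'sup in auto)
      have c2sum: "(\<Sum>m\<in>Pow N. c2 m * h m) =
          (\<Sum>m\<in>Pow N. c m * h m) + c m0 * ((\<Sum>m\<in>Pow ?N0. c' m * h m) - h m0)" for h :: "nat set \<Rightarrow> int"
      proof -
        have "(\<Sum>m\<in>Pow N. of_bool (m = m0) * h m) = (\<Sum>m\<in>Pow N. if m = m0 then h m else 0)"
          by (rule sum.cong) auto
        also have "\<dots> = h m0" using finN m0N by simp
        finally have d: "(\<Sum>m\<in>Pow N. of_bool (m = m0) * h m) = h m0" .
        have "(\<Sum>m\<in>Pow N. c2 m * h m) = (\<Sum>m\<in>Pow N. c m * h m) +
            c m0 * ((\<Sum>m\<in>Pow N. c' m * h m) - (\<Sum>m\<in>Pow N. of_bool (m = m0) * h m))"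
          unfolding c2_def by (simp add: algebra_simps sum.distrib sum_distrib_left sum_subtractf)
        then show ?thesis unfolding ext d .
      qed
      have "(\<Sum>m\<in>Pow N. c2 m * L m) = 0"
      proof (rule Suc.IH[OF Suc.prems(1)])
        fix m assume m: "m \<subseteq> N" "c2 m \<noteq> 0"
        show "wt m < w"
        proof (cases "m = m0")
          case True
          then show ?thesis using m c'm0 by (simp add: c2_def)
        next
          case False
          then have "c m \<noteq> 0 \<or> c' m \<noteq> 0" using m by (auto simp: c2_def)
          then show ?thesis using lt[OF m(1) _ False] c'sup by blast
        qed
      next
        fix p assume p: "p \<in> P N"
        have q: "p \<inter> ?N0 \<in> P ?N0" using restr[OF N0(1) Suc.prems(1) N0(3) p] .
        have same: "mon m (p \<inter> ?N0) = mon m p" if "m \<subseteq> ?N0" for m using that by (auto simp: mon_def)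
        have "comb ?N0 c' (p \<inter> ?N0) = comb ?N0 c' p"
          by (rule sum.cong) (auto simp: same)
        then have "mon m0 p = comb ?N0 c' p"
          using c'eq[OF q] same[OF N0(2)] by simp
        then show "comb N c2 p = 0"
          using c2sum[of "\<lambda>m. mon m p"] Suc.prems(3)[OF p] by simp
      qed
      then show ?thesis using c2sum[of L] c'(2) by simp
    qed
  qed
  have "(\<Sum>m\<in>Pow N. c m * L m) = 0"
    if N: "N \<in> \<N>" and van: "\<forall>p\<in>P N. comb N c p = 0" for N c
  proof (rule kill[OF N])
    fix m assume "m \<subseteq> N" "c m \<noteq> 0"
    then have "wt m \<le> wt N"
      unfolding set_encode_def using fin[OF N] by (intro sum_mono2) auto
    then show "wt m < Suc (wt N)" by simp
  qed (use van in blast)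
  then show ?thesis using L0 by blast
qed

section \<open>Closed sets and extension of colourings\<close>

text \<open>Remove a vertex of small degree, colour the rest, put it back: at most two of the three
  colours are excluded, counting the colour 0 as excluded where \<open>B\<close> holds.\<close>

lemma two_degenerate_list_colouring:
  fixes E :: "('a \<times> 'a) set"
  assumes fin: "finite W" and sym: "sym E" and irr: "irrefl E"
    and deg: "\<And>W'. W' \<subseteq> W \<Longrightarrow> W' \<noteq> {} \<Longrightarrow> \<exists>w\<in>W'. card {w'\<in>W'. (w, w') \<in> E} + of_bool (B w) \<le> (2::nat)"
  shows "\<exists>\<chi>. (\<forall>w\<in>W. \<chi> w \<in> {0, 1, 2::nat} \<and> (B w \<longrightarrow> \<chi> w \<noteq> 0)) \<and>
           (\<forall>u\<in>W. \<forall>v\<in>W. (u, v) \<in> E \<longrightarrow> \<chi> u \<noteq> \<chi> v)"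
  using fin deg
proof (induction W rule: finite_psubset_induct)
  case (psubset W)
  show ?case
  proof (cases "W = {}")
    case False
    then obtain w where w: "w \<in> W" "card {w'\<in>W. (w, w') \<in> E} + of_bool (B w) \<le> (2::nat)"
      using psubset.prems[of W] by blast
    have "W - {w} \<subset> W" using w(1) by auto
    moreover have "\<exists>w\<in>W'. card {w'\<in>W'. (w, w') \<in> E} + of_bool (B w) \<le> (2::nat)"
      if "W' \<subseteq> W - {w}" "W' \<noteq> {}" for W'
      using that by (intro psubset.prems) auto
    ultimately obtain \<chi> where \<chi>': "\<forall>v\<in>W - {w}. \<chi> v \<in> {0, 1, 2::nat} \<and> (B v \<longrightarrow> \<chi> v \<noteq> 0)"
      "\<forall>u\<in>W - {w}. \<forall>v\<in>W - {w}. (u, v) \<in> E \<longrightarrow> \<chi> u \<noteq> \<chi> v"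
      using psubset.IH[of "W - {w}"] by blast
    then have \<chi>: "\<And>v. v \<in> W - {w} \<Longrightarrow> \<chi> v \<in> {0, 1, 2::nat} \<and> (B v \<longrightarrow> \<chi> v \<noteq> 0)"
      "\<And>u v. u \<in> W - {w} \<Longrightarrow> v \<in> W - {w} \<Longrightarrow> (u, v) \<in> E \<Longrightarrow> \<chi> u \<noteq> \<chi> v"
      by auto
    define Q where "Q = \<chi> ` {w'\<in>W. (w, w') \<in> E} \<union> (if B w then {0} else {})"
    have "card Q \<le> card (\<chi> ` {w'\<in>W. (w, w') \<in> E}) + card (if B w then {0::nat} else {})"
      unfolding Q_def by (rule card_Un_le)
    also have "card (\<chi> ` {w'\<in>W. (w, w') \<in> E}) \<le> card {w'\<in>W. (w, w') \<in> E}"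
      by (rule card_image_le) (use psubset.hyps in auto)
    finally have "card Q \<le> 2" using w(2) by (auto split: if_splits)
    then have "\<not> {0, 1, 2} \<subseteq> Q"
      using card_mono[of Q "{0, 1, 2::nat}"] psubset.hyps by (auto simp: Q_def)
    then obtain c where c: "c \<in> {0, 1, 2}" "c \<notin> Q" by blast
    have "(\<forall>v\<in>W. (\<chi>(w := c)) v \<in> {0, 1, 2::nat} \<and> (B v \<longrightarrow> (\<chi>(w := c)) v \<noteq> 0)) \<and>
       (\<forall>u\<in>W. \<forall>v\<in>W. (u, v) \<in> E \<longrightarrow> (\<chi>(w := c)) u \<noteq> (\<chi>(w := c)) v)"
    proof (intro conjI ballI impI)
      fix v assume v: "v \<in> W"
      show "(\<chi>(w := c)) v \<in> {0, 1, 2::nat}" using v c(1) \<chi>(1)[of v] by auto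
      assume "B v"
      then show "(\<chi>(w := c)) v \<noteq> 0" using v c(2) \<chi>(1)[of v] by (auto simp: Q_def)
    next
      fix u v assume uv: "u \<in> W" "v \<in> W" "(u, v) \<in> E"
      then have "(v, u) \<in> E" "u \<noteq> v" using sym irr by (auto simp: sym_def irrefl_def)
      then show "(\<chi>(w := c)) u \<noteq> (\<chi>(w := c)) v"
        using uv \<chi>(2)[of u v] c(2) by (auto simp: Q_def)
    qed
    then show ?thesis by blast
  qed auto
qed

section \<open>Sealed sets as a closure system\<close>

locale ranked_graph =
  fixes V :: "nat set" and E :: "(nat \<times> nat) set" and r :: "nat \<Rightarrow> nat"
  assumes finV: "finite V" and EV: "E \<subseteq> V \<times> V" and symE: "sym E" and irrE: "irrefl E"
    and inj_r: "inj_on r V"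
begin

lemma E_sym: "(u, v) \<in> E \<Longrightarrow> (v, u) \<in> E"
  using symE by (auto dest: symD)

lemma E_irrefl: "(u, u) \<notin> E"
  using irrE by (auto simp: irrefl_def)

lemma finite_E: "finite E"
  using finV EV by (meson finite_SigmaI finite_subset)

abbreviation edges :: "nat set \<Rightarrow> nat set \<Rightarrow> nat" where
  "edges A B \<equiv> card (E \<inter> A \<times> B)"

text \<open>\<open>edges\<close> counts ordered pairs, so the inequality says that the edges within
  \<open>U\<close> and from \<open>U\<close> to \<open>Z\<close> together number less than 5/4 per
  vertex of \<open>U\<close>. The extension argument has to exclude a path of four new vertices with
  both ends attached to \<open>Z\<close>, which has exactly this density.\<close>

definition sealed :: "nat \<Rightarrow> nat set \<Rightarrow> bool" where
  "sealed M Z \<longleftrightarrow> Z \<subseteq> V \<and> (\<forall>z w. z \<in> Z \<longrightarrow> (z, w) \<in> E \<longrightarrow> r w < r z \<longrightarrow> w \<in> Z) \<and>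
     (\<forall>U. U \<subseteq> V - Z \<longrightarrow> U \<noteq> {} \<longrightarrow> card U \<le> M \<longrightarrow>
        2 * edges U U + 4 * edges U Z < 5 * card U)"

definition col :: "nat set \<Rightarrow> (nat \<Rightarrow> nat) set" where
  "col Z = {\<phi> \<in> Z \<rightarrow>\<^sub>E {0, 1, 2}. \<forall>u\<in>Z. \<forall>v\<in>Z. (u, v) \<in> E \<longrightarrow> \<phi> u \<noteq> \<phi> v}"

lemma sealed_subset: "sealed M Z \<Longrightarrow> Z \<subseteq> V"
  by (simp add: sealed_def)

lemma sealed_down: "sealed M Z \<Longrightarrow> z \<in> Z \<Longrightarrow> (z, w) \<in> E \<Longrightarrow> r w < r z \<Longrightarrow> w \<in> Z"
  by (simp add: sealed_def)

lemma sealed_sparse: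
  "sealed M Z \<Longrightarrow> U \<subseteq> V - Z \<Longrightarrow> U \<noteq> {} \<Longrightarrow> card U \<le> M \<Longrightarrow>
    2 * edges U U + 4 * edges U Z < 5 * card U"
  by (simp add: sealed_def)

lemma sealed_V: "sealed M V"
  using EV by (auto simp: sealed_def)

text \<open>Split \<open>U\<close> into the part \<open>A\<close> outside \<open>Z\<close> and the
  part \<open>B\<close> inside \<open>Z\<close>, which lies outside \<open>Z'\<close>. Edges between
  the parts run from \<open>A\<close> into \<open>Z\<close> and are charged to \<open>A\<close>;
  then the bound for \<open>A\<close> over \<open>Z\<close> and the bound for \<open>B\<close> over
  \<open>Z'\<close> add up to the bound for \<open>U\<close>.\<close>

lemma sealed_Int:
  assumes Z: "sealed M Z" and Z': "sealed M Z'"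
  shows "sealed M (Z \<inter> Z')"
  unfolding sealed_def
proof (intro conjI allI impI)
  show "Z \<inter> Z' \<subseteq> V" using Z by (auto simp: sealed_def)
  show "w \<in> Z \<inter> Z'" if "z \<in> Z \<inter> Z'" "(z, w) \<in> E" "r w < r z" for z w
    using that Z Z' by (auto intro: sealed_down)
next
  fix U assume U: "U \<subseteq> V - Z \<inter> Z'" "U \<noteq> {}" "card U \<le> M"
  have finU: "finite U" using U finV by (meson Diff_subset finite_subset)
  define A where "A = U - Z"
  define B where "B = U \<inter> Z"
  have UAB: "U = A \<union> B" "A \<inter> B = {}" by (auto simp: A_def B_def)
  have cU: "card U = card A + card B"
    unfolding UAB(1) by (rule card_Un_disjoint) (use finU in \<open>auto simp: A_def B_def\<close>)
  have leA: "2 * edges A A + 4 * edges A Z \<le> 5 * card A"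
    and ltA: "A \<noteq> {} \<Longrightarrow> 2 * edges A A + 4 * edges A Z < 5 * card A"
  proof -
    show *: "2 * edges A A + 4 * edges A Z < 5 * card A" if "A \<noteq> {}"
      by (rule sealed_sparse[OF Z _ that]) (use U cU in \<open>auto simp: A_def\<close>)
    show "2 * edges A A + 4 * edges A Z \<le> 5 * card A"
      using * by (cases "A = {}") auto
  qed
  have leB: "2 * edges B B + 4 * edges B Z' \<le> 5 * card B"
    and ltB: "B \<noteq> {} \<Longrightarrow> 2 * edges B B + 4 * edges B Z' < 5 * card B"
  proof -
    show *: "2 * edges B B + 4 * edges B Z' < 5 * card B" if "B \<noteq> {}"
      by (rule sealed_sparse[OF Z' _ that]) (use U cU in \<open>auto simp: B_def\<close>)
    show "2 * edges B B + 4 * edges B Z' \<le> 5 * card B"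
      using * by (cases "B = {}") auto
  qed
  have conv: "edges B A = edges A B"
    by (rule bij_betw_same_card[of "\<lambda>(x, y). (y, x)"])
       (auto simp: bij_betw_def inj_on_def image_iff dest: E_sym)
  have "edges U U \<le> edges A A + edges A B + edges B A + edges B B"
  proof -
    have "E \<inter> U \<times> U = E \<inter> A \<times> A \<union> E \<inter> A \<times> B \<union> E \<inter> B \<times> A \<union> E \<inter> B \<times> B"
      using UAB by auto
    then show ?thesis using card_Un_le by (smt (verit) add_mono le_refl order_trans)
  qed
  then have 1: "edges U U \<le> edges A A + 2 * edges A B + edges B B"
    using conv by simp
  have 2: "edges A B + edges A (Z \<inter> Z') \<le> edges A Z"
  proof -
    have "edges A B + edges A (Z \<inter> Z') = card (E \<inter> A \<times> B \<union> E \<inter> A \<times> (Z \<inter> Z'))"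
      by (rule card_Un_disjoint[symmetric]) (use finite_E U in \<open>auto simp: B_def\<close>)
    also have "\<dots> \<le> edges A Z"
      by (rule card_mono) (use finite_E in \<open>auto simp: B_def\<close>)
    finally show ?thesis .
  qed
  have 3: "edges B (Z \<inter> Z') \<le> edges B Z'"
    by (rule card_mono) (use finite_E in auto)
  have 4: "edges U (Z \<inter> Z') \<le> edges A (Z \<inter> Z') + edges B (Z \<inter> Z')"
  proof -
    have "E \<inter> U \<times> (Z \<inter> Z') = E \<inter> A \<times> (Z \<inter> Z') \<union> E \<inter> B \<times> (Z \<inter> Z')" using UAB by auto
    then show ?thesis using card_Un_le by metis
  qed
  have "A \<noteq> {} \<or> B \<noteq> {}" using U(2) UAB by auto
  then show "2 * edges U U + 4 * edges U (Z \<inter> Z') < 5 * card U"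
    using leA ltA leB ltB 1 2 3 4 cU by linarith
qed

definition cl :: "nat \<Rightarrow> nat set \<Rightarrow> nat set" where
  "cl M X = \<Inter>{Z. sealed M Z \<and> X \<subseteq> Z}"

lemma sealed_Inter:
  assumes "finite F" "F \<noteq> {}" "\<And>Z. Z \<in> F \<Longrightarrow> sealed M Z"
  shows "sealed M (\<Inter>F)"
  using assms by (induction F rule: finite_ne_induct) (auto intro: sealed_Int)

lemma sealed_cl: "X \<subseteq> V \<Longrightarrow> sealed M (cl M X)"
  unfolding cl_def
proof (rule sealed_Inter)
  show "finite {Z. sealed M Z \<and> X \<subseteq> Z}"
    by (rule finite_subset[of _ "Pow V"]) (use finV in \<open>auto simp: sealed_def\<close>)
qed (use sealed_V in auto)

lemma cl_extensive: "X \<subseteq> cl M X"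
  by (auto simp: cl_def)

lemma cl_least: "sealed M Z \<Longrightarrow> X \<subseteq> Z \<Longrightarrow> cl M X \<subseteq> Z"
  by (auto simp: cl_def)

lemma cl_mono: "X \<subseteq> Y \<Longrightarrow> cl M X \<subseteq> cl M Y"
  by (auto simp: cl_def)

lemma col_restrict: "\<phi> \<in> col Z' \<Longrightarrow> Z \<subseteq> Z' \<Longrightarrow> restrict \<phi> Z \<in> col Z"
  unfolding col_def by (fastforce simp: PiE_iff)

lemma le_card_edges: "F \<subseteq> E \<inter> A \<times> B \<Longrightarrow> card F \<le> edges A B"
  by (rule card_mono) (use finite_E in auto)

text \<open>Neighbours of \<open>Z\<close> take colour 1 or 2 according to their unique parent in \<open>Z\<close>, vertices at
  distance two take colour 0, and what remains is coloured independently of \<open>\<phi>\<close>.\<close>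

abbreviation recolour ::
  "nat set \<Rightarrow> nat set \<Rightarrow> nat set \<Rightarrow> (nat \<Rightarrow> nat) \<Rightarrow> (nat \<Rightarrow> nat) \<Rightarrow> (nat \<Rightarrow> nat) \<Rightarrow> nat \<Rightarrow> nat" where
  "recolour Z Z' U par \<chi> \<phi> \<equiv> (\<lambda>v\<in>Z'. if v \<in> Z then \<phi> v
     else if v \<in> U then (if \<phi> (par v) = 1 then 2 else 1) else \<chi> v)"

text \<open>Sparsity above \<open>Z\<close> makes the layers rigid: a neighbour of \<open>Z\<close>
  has only one parent, no two such neighbours are adjacent, nor are two vertices of the second
  layer, and in what remains every subset has a vertex of small degree. Downward closedness gives
  the parent the smaller rank. That \<open>U\<close>, \<open>par\<close> and \<open>\<chi>\<close>
  are chosen before \<open>\<phi>\<close> turns the extension into a substitution of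
  variables.\<close>

lemma sealed_extension:
  assumes Z: "sealed M Z" and ZZ': "Z \<subseteq> Z'" and Z'V: "Z' \<subseteq> V" and M: "card Z' \<le> M"
  shows "\<exists>U par \<chi>. U \<subseteq> Z' - Z \<and> (\<forall>u\<in>U. par u \<in> Z \<and> r (par u) < r u) \<and>
    (\<forall>\<phi>\<in>col Z. recolour Z Z' U par \<chi> \<phi> \<in> col Z')"
proof -
  have finZ': "finite Z'" using Z'V finV by (rule finite_subset)
  have sparse: "2 * edges U U + 4 * edges U Z < 5 * card U"
    if "U \<subseteq> Z' - Z" "U \<noteq> {}" for U
  proof (rule sealed_sparse[OF Z _ that(2)])
    have "card U \<le> card Z'" using that finZ' by (intro card_mono) auto
    then show "card U \<le> M" using M by simp
  qed (use that Z'V in auto)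
  define U where "U = {u \<in> Z' - Z. \<exists>z\<in>Z. (u, z) \<in> E}"
  define par where "par = (\<lambda>u. SOME z. z \<in> Z \<and> (u, z) \<in> E)"
  have par: "par u \<in> Z" "(u, par u) \<in> E" if "u \<in> U" for u
    using that someI_ex[of "\<lambda>z. z \<in> Z \<and> (u, z) \<in> E"] by (auto simp: U_def par_def)
  have par_unique: "z = par u" if "u \<in> Z' - Z" "z \<in> Z" "(u, z) \<in> E" for u z
  proof (rule ccontr)
    assume ne: "z \<noteq> par u"
    have u: "u \<in> U" using that by (auto simp: U_def)
    have "card {(u, z), (u, par u)} \<le> card (E \<inter> {u} \<times> Z)"
      by (rule le_card_edges) (use that par[OF u] in auto)
    then show False using sparse[of "{u}"] ne that by auto
  qed
  have par_less: "r (par u) < r u" if "u \<in> U" for u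
  proof -
    have "u \<noteq> par u" "u \<in> V" "par u \<in> V"
      using that par[OF that] E_irrefl Z'V ZZ' by (auto simp: U_def)
    then have "r u \<noteq> r (par u)" using inj_r by (auto simp: inj_on_def)
    moreover have "\<not> r u < r (par u)"
      using sealed_down[OF Z par(1)[OF that] E_sym[OF par(2)[OF that]]] that by (auto simp: U_def)
    ultimately show ?thesis by simp
  qed
  have U_indep: "(u, v) \<notin> E" if "u \<in> U" "v \<in> U" for u v
  proof
    assume uv: "(u, v) \<in> E"
    then have ne: "u \<noteq> v" using E_irrefl by auto
    have "card {(u, v), (v, u)} \<le> card (E \<inter> {u, v} \<times> {u, v})"
      by (rule le_card_edges) (use uv E_sym in auto)
    moreover have "card {(u, par u), (v, par v)} \<le> card (E \<inter> {u, v} \<times> Z)"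
      by (rule le_card_edges) (use that par in auto)
    ultimately show False using sparse[of "{u, v}"] ne that by (auto simp: U_def)
  qed
  define U2 where "U2 = {w \<in> Z' - Z - U. \<exists>u\<in>U. (w, u) \<in> E}"
  define h where "h = (\<lambda>w. SOME u. u \<in> U \<and> (w, u) \<in> E)"
  have h: "h w \<in> U" "(w, h w) \<in> E" if "w \<in> U2" for w
    using that someI_ex[of "\<lambda>u. u \<in> U \<and> (w, u) \<in> E"] by (auto simp: U2_def h_def)
  have UU2: "u \<notin> U2" if "u \<in> U" for u using that by (auto simp: U2_def)
  have U2_indep: "(v, w) \<notin> E" if "v \<in> U2" "w \<in> U2" for v w
  proof
    assume vw: "(v, w) \<in> E"
    then have ne: "v \<noteq> w" using E_irrefl by auto
    have dist: "v \<noteq> h v" "v \<noteq> h w" "w \<noteq> h v" "w \<noteq> h w" using that h UU2 by metis+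
    \<comment> \<open>An edge within the second layer closes up to 5 edges on 4 new vertices, or, if
      \<open>h v = h w\<close>, to a triangle with an attachment, 4 edges on 3 vertices. Both reach
      density 5/4.\<close>
    define B where "B = {v, w, h v, h w}"
    have BZ: "B \<subseteq> Z' - Z" using that h(1) by (auto simp: B_def U2_def U_def)
    have "card {(v, w), (w, v), (v, h v), (h v, v), (w, h w), (h w, w)} \<le> edges B B"
      by (rule le_card_edges) (use vw E_sym h that in \<open>auto simp: B_def\<close>)
    moreover have "card {(v, w), (w, v), (v, h v), (h v, v), (w, h w), (h w, w)} = 6"
      using ne dist by auto
    moreover have "card {(h v, par (h v)), (h w, par (h w))} \<le> edges B Z"
      by (rule le_card_edges) (use that h par in \<open>auto simp: B_def\<close>)
    moreover have "card B = (if h v = h w then 3 else 4)"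
      using ne dist by (auto simp: B_def)
    ultimately show False using sparse[OF BZ] by (auto simp: B_def split: if_splits)
  qed
  define W where "W = Z' - Z - U - U2"
  define adj where "adj = (\<lambda>w. \<exists>u\<in>U2. (w, u) \<in> E)"
  have "\<exists>w\<in>W'. card {w'\<in>W'. (w, w') \<in> E} + of_bool (adj w) \<le> (2::nat)"
    if W': "W' \<subseteq> W" "W' \<noteq> {}" for W'
  proof (rule ccontr)
    assume neg: "\<not> ?thesis"
    have finW': "finite W'" by (rule finite_subset[OF _ finZ']) (use W'(1) in \<open>auto simp: W_def\<close>)
    define T where "T = {w\<in>W'. adj w}"
    define g where "g = (\<lambda>w. SOME u. u \<in> U2 \<and> (w, u) \<in> E)"
    have g: "g w \<in> U2" "(w, g w) \<in> E" if "w \<in> T" for w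
      using that someI_ex[of "\<lambda>u. u \<in> U2 \<and> (w, u) \<in> E"] by (auto simp: T_def adj_def g_def)
    define A where "A = g ` T"
    define B where "B = h ` A"
    have finT: "finite T" using finW' by (auto simp: T_def)
    have finAB: "finite A" "finite B" using finT by (auto simp: A_def B_def)
    have AU2: "A \<subseteq> U2" using g by (auto simp: A_def)
    have BU: "B \<subseteq> U" using h AU2 by (auto simp: B_def)
    have disj: "W' \<inter> A = {}" "W' \<inter> B = {}" "A \<inter> B = {}"
      using W' AU2 BU UU2 by (auto simp: W_def)
    \<comment> \<open>A subset without a vertex of small degree is joined to \<open>Z\<close>
      through both layers. Every vertex of \<open>T\<close>, \<open>A\<close> and \<open>B\<close>
      contributes one edge towards \<open>Z\<close>, and with
      \<open>card B \<le> card A \<le> card T\<close> the completed set reaches 5/4 edges per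
      vertex.\<close>
    define D where "D = W' \<union> A \<union> B"
    have cD: "card D = card W' + card A + card B"
      unfolding D_def using finW' finAB disj
      by (subst card_Un_disjoint, auto)+
    have cA: "card A \<le> card T" unfolding A_def by (rule card_image_le[OF finT])
    have cB: "card B \<le> card A" unfolding B_def by (rule card_image_le[OF finAB(1)])
    have degsum: "3 * card W' \<le> edges W' W' + card T"
    proof -
      have "E \<inter> W' \<times> W' = (SIGMA w:W'. {w'\<in>W'. (w, w') \<in> E})" by auto
      then have "edges W' W' = (\<Sum>w\<in>W'. card {w'\<in>W'. (w, w') \<in> E})"
        using finW' by simp
      moreover have "card T = (\<Sum>w\<in>W'. of_bool (adj w))"
        using finW' by (simp add: T_def Int_def)
      moreover have "(\<Sum>w\<in>W'. 3) \<le> (\<Sum>w\<in>W'. card {w'\<in>W'. (w, w') \<in> E} + of_bool (adj w))"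
        by (rule sum_mono) (use neg in force)
      ultimately show ?thesis by (simp add: sum.distrib)
    qed
    define F1 where "F1 = (\<lambda>w. (w, g w)) ` T"
    define F2 where "F2 = (\<lambda>w. (g w, w)) ` T"
    define F3 where "F3 = (\<lambda>w. (w, h w)) ` A"
    define F4 where "F4 = (\<lambda>w. (h w, w)) ` A"
    have cF: "card F1 = card T" "card F2 = card T" "card F3 = card A" "card F4 = card A"
      unfolding F1_def F2_def F3_def F4_def by (intro card_image; auto simp: inj_on_def)+
    have finF: "finite F1" "finite F2" "finite F3" "finite F4"
      unfolding F1_def F2_def F3_def F4_def using finT finAB by auto
    have sub: "E \<inter> W' \<times> W' \<subseteq> W' \<times> W'" "F1 \<subseteq> W' \<times> A" "F2 \<subseteq> A \<times> W'" "F3 \<subseteq> A \<times> B" "F4 \<subseteq> B \<times> A"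
      unfolding F1_def F2_def F3_def F4_def A_def B_def T_def by auto
    have "card (E \<inter> W' \<times> W' \<union> (F1 \<union> (F2 \<union> (F3 \<union> F4)))) =
        edges W' W' + (card F1 + (card F2 + (card F3 + card F4)))"
    proof -
      have "card (F3 \<union> F4) = card F3 + card F4"
        by (rule card_Un_disjoint) (use finF sub disj in auto)
      moreover have "card (F2 \<union> (F3 \<union> F4)) = card F2 + card (F3 \<union> F4)"
        by (rule card_Un_disjoint) (use finF sub disj in auto)
      moreover have "card (F1 \<union> (F2 \<union> (F3 \<union> F4))) = card F1 + card (F2 \<union> (F3 \<union> F4))"
        by (rule card_Un_disjoint) (use finF sub disj in auto)
      moreover have "card (E \<inter> W' \<times> W' \<union> (F1 \<union> (F2 \<union> (F3 \<union> F4)))) =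
        edges W' W' + card (F1 \<union> (F2 \<union> (F3 \<union> F4)))"
        by (rule card_Un_disjoint) (use finF finite_E sub disj in auto)
      ultimately show ?thesis by simp
    qed
    moreover have "card (E \<inter> W' \<times> W' \<union> (F1 \<union> (F2 \<union> (F3 \<union> F4)))) \<le> edges D D"
    proof (rule le_card_edges)
      have "F1 \<union> F2 \<subseteq> E" unfolding F1_def F2_def using g E_sym by auto
      moreover have "F3 \<union> F4 \<subseteq> E" unfolding F3_def F4_def using h AU2 E_sym by auto
      ultimately show "E \<inter> W' \<times> W' \<union> (F1 \<union> (F2 \<union> (F3 \<union> F4))) \<subseteq> E \<inter> D \<times> D"
        using sub unfolding D_def by blast
    qed
    moreover have "card B \<le> edges D Z"
    proof -
      have "card ((\<lambda>b. (b, par b)) ` B) = card B" by (rule card_image) (auto simp: inj_on_def)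
      moreover have "card ((\<lambda>b. (b, par b)) ` B) \<le> edges D Z"
        by (rule le_card_edges) (use par BU in \<open>auto simp: D_def\<close>)
      ultimately show ?thesis by simp
    qed
    moreover have "2 * edges D D + 4 * edges D Z < 5 * card D"
      by (rule sparse) (use W' AU2 BU in \<open>auto simp: D_def W_def U2_def U_def\<close>)
    ultimately show False using degsum cD cA cB cF by linarith
  qed
  moreover have "finite W" using finZ' by (auto simp: W_def)
  ultimately obtain \<chi> where \<chi>: "\<forall>w\<in>W. \<chi> w \<in> {0, 1, 2::nat} \<and> (adj w \<longrightarrow> \<chi> w \<noteq> 0)"
    "\<forall>u\<in>W. \<forall>v\<in>W. (u, v) \<in> E \<longrightarrow> \<chi> u \<noteq> \<chi> v"
    using two_degenerate_list_colouring[OF _ symE irrE, of W adj] by blast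
  define \<xi> where "\<xi> = (\<lambda>v. if v \<in> U2 then 0 else \<chi> v)"
  have "recolour Z Z' U par \<xi> \<phi> \<in> col Z'"
    (is "?e \<in> _") if \<phi>: "\<phi> \<in> col Z" for \<phi>
  proof -
    have \<phi>': "\<phi> v \<in> {0, 1, 2}" if "v \<in> Z" for v using \<phi> that unfolding col_def by (blast dest: PiE_mem)
    have range: "?e v \<in> {0, 1, 2}" if "v \<in> Z'" for v
      using that \<phi>'[of v] \<chi>(1)
      by (cases "v \<in> Z"; cases "v \<in> U"; cases "v \<in> U2") (simp_all add: \<xi>_def W_def)
    have one: "?e u \<noteq> ?e v"
      if uv: "(u, v) \<in> E" "u \<in> Z'" "v \<in> Z'"
        and order: "u \<in> Z \<or> (u \<in> U \<and> v \<notin> Z) \<or> (u \<in> U2 \<and> v \<notin> Z \<union> U) \<or> (u \<in> W \<and> v \<in> W)" for u v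
    proof -
      consider "u \<in> Z" "v \<in> Z" | "u \<in> Z" "v \<notin> Z" | "u \<in> U" "v \<notin> Z" | "u \<in> U2" "v \<notin> Z \<union> U" | "u \<in> W" "v \<in> W"
        using order by blast
      then show ?thesis
      proof cases
        case 1
        then show ?thesis using \<phi> uv by (auto simp: col_def)
      next
        case 2
        have "u = par v" using par_unique[of v u] 2 uv E_sym by auto
        moreover have "v \<in> U" using 2 uv E_sym by (auto simp: U_def)
        ultimately show ?thesis using 2 uv \<phi>'[of u] by auto
      next
        case 3
        have "v \<notin> U" using U_indep 3 uv by auto
        then have "v \<in> U2" using 3 uv E_sym by (auto simp: U2_def)
        then show ?thesis using 3 uv \<open>v \<notin> U\<close> by (auto simp: U_def \<xi>_def)
      next
        case 4
        have "v \<notin> U2" using U2_indep 4 uv by auto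
        moreover have "v \<in> W" using 4 uv \<open>v \<notin> U2\<close> by (auto simp: W_def)
        moreover have "adj v" using 4 uv E_sym by (auto simp: adj_def)
        ultimately show ?thesis using 4 uv \<chi>(1) UU2 by (auto simp: U2_def \<xi>_def)
      next
        case 5
        then show ?thesis using uv \<chi>(2) by (auto simp: W_def \<xi>_def)
      qed
    qed
    have "?e u \<noteq> ?e v" if uv: "(u, v) \<in> E" "u \<in> Z'" "v \<in> Z'" for u v
    proof -
      have "x \<in> Z \<or> x \<in> U \<or> x \<in> U2 \<or> x \<in> W" if "x \<in> Z'" for x using that by (auto simp: W_def)
      then consider "u \<in> Z \<or> (u \<in> U \<and> v \<notin> Z) \<or> (u \<in> U2 \<and> v \<notin> Z \<union> U) \<or> (u \<in> W \<and> v \<in> W)"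
        | "v \<in> Z \<or> (v \<in> U \<and> u \<notin> Z) \<or> (v \<in> U2 \<and> u \<notin> Z \<union> U) \<or> (v \<in> W \<and> u \<in> W)"
        using uv by blast
      then show ?thesis
        using one[OF uv] one[OF E_sym[OF uv(1)] uv(3) uv(2)] by cases auto
    qed
    then show ?thesis using range unfolding col_def
      by (intro CollectI conjI PiE_I ballI impI) (blast, simp, blast)
  qed
  then show ?thesis using par par_less by (intro exI[of _ U] exI[of _ par] exI[of _ \<xi>]) (auto simp: U_def)
qed

end

section \<open>Solutions of the linear system from the functional\<close>

context ranked_graph begin

text \<open>The variable \<open>3 * r v + i\<close> says that \<open>v\<close> has colour
  \<open>i\<close>. Numbering by rank makes the variables of a parent precede those of its children,
  as the weights require.\<close>

definition vars :: "nat set \<Rightarrow> nat set" where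
  "vars Z = {3 * r v + i | v i. v \<in> Z \<and> i < 3}"

definition point :: "(nat \<Rightarrow> nat) \<Rightarrow> nat set \<Rightarrow> nat set" where
  "point f X = (\<lambda>v. 3 * r v + f v) ` X"

lemma code_inj:
  assumes "3 * r u + i = 3 * r v + j" "i < 3" "j < 3" "u \<in> V" "v \<in> V"
  shows "u = v \<and> i = j"
proof -
  have "r u = r v" "i = j" using assms by presburger+
  then show ?thesis using assms inj_r by (auto dest: inj_onD)
qed

lemma code_in_vars: "v \<in> V \<Longrightarrow> Z \<subseteq> V \<Longrightarrow> i < 3 \<Longrightarrow> 3 * r v + i \<in> vars Z \<longleftrightarrow> v \<in> Z"
proof
  assume v: "v \<in> V" "Z \<subseteq> V" "i < 3" and "3 * r v + i \<in> vars Z"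
  then obtain u j where u: "3 * r v + i = 3 * r u + j" "u \<in> Z" "j < 3" by (auto simp: vars_def)
  then show "v \<in> Z" using code_inj[OF u(1)] v by auto
qed (auto simp: vars_def)

lemma code_in_point:
  "v \<in> V \<Longrightarrow> X \<subseteq> V \<Longrightarrow> i < 3 \<Longrightarrow> (\<And>u. u \<in> X \<Longrightarrow> f u < 3) \<Longrightarrow>
    3 * r v + i \<in> point f X \<longleftrightarrow> v \<in> X \<and> f v = i"
proof
  assume v: "v \<in> V" "X \<subseteq> V" "i < 3" "\<And>u. u \<in> X \<Longrightarrow> f u < 3" and "3 * r v + i \<in> point f X"
  then obtain u where u: "3 * r v + i = 3 * r u + f u" "u \<in> X" by (auto simp: point_def)
  then show "v \<in> X \<and> f v = i" using code_inj[OF u(1)] v by auto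
qed (auto simp: point_def)

lemma vars_Int: "Z \<subseteq> V \<Longrightarrow> Z' \<subseteq> V \<Longrightarrow> vars Z \<inter> vars Z' = vars (Z \<inter> Z')"
proof (intro equalityI subsetI)
  fix e assume Z: "Z \<subseteq> V" "Z' \<subseteq> V" and "e \<in> vars Z \<inter> vars Z'"
  then obtain v i where v: "e = 3 * r v + i" "v \<in> Z" "i < 3" and e: "e \<in> vars Z'"
    by (auto simp: vars_def)
  then have "v \<in> Z'" using code_in_vars[of v Z' i] Z by auto
  then show "e \<in> vars (Z \<inter> Z')" using v by (auto simp: vars_def)
qed (auto simp: vars_def)

lemma vars_mono: "Z \<subseteq> Z' \<Longrightarrow> vars Z \<subseteq> vars Z'"
  by (fastforce simp: vars_def)

lemma vars_subset_iff: "Z \<subseteq> V \<Longrightarrow> Z' \<subseteq> V \<Longrightarrow> vars Z \<subseteq> vars Z' \<longleftrightarrow> Z \<subseteq> Z'"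
proof
  assume Z: "Z \<subseteq> V" "Z' \<subseteq> V" and sub: "vars Z \<subseteq> vars Z'"
  show "Z \<subseteq> Z'"
  proof
    fix v assume "v \<in> Z"
    then have "3 * r v + 0 \<in> vars Z'" using sub code_in_vars[of v Z 0] Z by auto
    then show "v \<in> Z'" using code_in_vars[of v Z' 0] Z \<open>v \<in> Z\<close> by auto
  qed
qed (rule vars_mono)

lemma finite_vars: "finite Z \<Longrightarrow> finite (vars Z)"
proof -
  assume "finite Z"
  moreover have "vars Z = (\<lambda>(v, i). 3 * r v + i) ` (Z \<times> {..<3})" by (auto simp: vars_def)
  ultimately show ?thesis by simp
qed

lemma col_less: "f \<in> col Z \<Longrightarrow> v \<in> Z \<Longrightarrow> f v < 3"
  unfolding col_def using PiE_mem by fastforce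

lemma point_subset_vars: "(\<And>u. u \<in> X \<Longrightarrow> f u < 3) \<Longrightarrow> X \<subseteq> Z \<Longrightarrow> point f X \<subseteq> vars Z"
  by (fastforce simp: point_def vars_def)

lemma mon_point:
  assumes "f \<in> X \<rightarrow>\<^sub>E {0, 1, 2}" "h \<in> col Z" "X \<subseteq> Z" "Z \<subseteq> V"
  shows "mon (point f X) (point h Z) = of_bool (restrict h X = f)"
proof -
  have lt: "f v < 3" if "v \<in> X" for v using PiE_mem[OF assms(1) that] by auto
  have "point f X \<subseteq> point h Z \<longleftrightarrow> (\<forall>v\<in>X. 3 * r v + f v \<in> point h Z)"
    by (auto simp: point_def)
  also have "\<dots> \<longleftrightarrow> (\<forall>v\<in>X. h v = f v)"
  proof (rule ball_cong[OF refl])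
    fix v assume v: "v \<in> X"
    show "3 * r v + f v \<in> point h Z \<longleftrightarrow> h v = f v"
      using code_in_point[of v Z "f v" h] lt[OF v] v assms(3,4) col_less[OF assms(2)] by auto
  qed
  also have "\<dots> \<longleftrightarrow> restrict h X = f"
    using assms(1) by (auto simp: fun_eq_iff restrict_def PiE_iff extensional_def)
  finally show ?thesis by (simp add: mon_def)
qed

lemma inj_on_point: "X \<subseteq> V \<Longrightarrow> inj_on (\<lambda>f. point f X) (X \<rightarrow>\<^sub>E {0, 1, 2})"
proof (rule inj_onI)
  fix f g assume X: "X \<subseteq> V" and f: "f \<in> X \<rightarrow>\<^sub>E {0, 1, 2}" and g: "g \<in> X \<rightarrow>\<^sub>E {0, 1, 2}"
    and eq: "point f X = point g X"
  show "f = g"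
  proof (rule PiE_ext[OF f g])
    fix v assume v: "v \<in> X"
    have lt: "f u < 3" "g u < 3" if "u \<in> X" for u
      using PiE_mem[OF f that] PiE_mem[OF g that] by auto
    have "3 * r v + f v \<in> point g X" using eq v by (auto simp: point_def)
    then show "f v = g v" using code_in_point[of v X "f v" g] v X lt by auto
  qed
qed

text \<open>The functional is built over a family indexed by sets of variables; this recovers the
  closed set behind such an index.\<close>

definition unvars :: "nat set \<Rightarrow> nat set" where
  "unvars N = {v \<in> V. 3 * r v \<in> N}"

lemma unvars_vars: "Z \<subseteq> V \<Longrightarrow> unvars (vars Z) = Z"
  unfolding unvars_def using code_in_vars[of _ Z 0] by auto

lemma pinned_functional_exists:
  assumes Z0: "sealed M Z0" and g: "g \<in> col Z0"
  shows "\<exists>L::nat set \<Rightarrow> int. L {} = 1 \<and>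
    (\<forall>Z \<M> m0. sealed M Z \<longrightarrow> Z0 \<subseteq> Z \<longrightarrow> card Z \<le> M \<longrightarrow> \<M> \<subseteq> Pow (vars Z) \<longrightarrow> m0 \<subseteq> vars Z \<longrightarrow>
      (\<forall>h\<in>col Z. restrict h Z0 = g \<longrightarrow> (\<Sum>m\<in>\<M>. mon m (point h Z)) = mon m0 (point h Z)) \<longrightarrow>
      (\<Sum>m\<in>\<M>. L m) = L m0)"
proof -
  define pin where "pin = (\<lambda>Z. {h \<in> col Z. restrict h Z0 = g})"
  define \<Z> where "\<Z> = {Z. sealed M Z \<and> Z0 \<subseteq> Z \<and> card Z \<le> M}"
  define P where "P = (\<lambda>N. (\<lambda>h. point h (unvars N)) ` pin (unvars N))"
  have ZV: "Z \<subseteq> V" if "Z \<in> \<Z>" for Z using that by (auto simp: \<Z>_def sealed_def)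
  have finZ: "finite Z" if "Z \<in> \<Z>" for Z using ZV[OF that] finV by (rule finite_subset)
  have Pv: "P (vars Z) = (\<lambda>h. point h Z) ` pin Z" if "Z \<in> \<Z>" for Z
    using unvars_vars[OF ZV[OF that]] by (simp add: P_def)
  have ext: "\<exists>U par h. U \<subseteq> Z' - Z \<and> (\<forall>u\<in>U. par u \<in> Z \<and> r (par u) < r u) \<and>
    (\<forall>f\<in>col Z. recolour Z Z' U par h f \<in> col Z')" if "sealed M Z" "Z' \<in> \<Z>" "Z \<subseteq> Z'" for Z Z'
    using sealed_extension[OF that(1,3) ZV[OF that(2)]] that by (auto simp: \<Z>_def)
  have ne: "pin Z \<noteq> {}" if Z: "Z \<in> \<Z>" for Z
  proof -
    obtain U par h where e: "\<forall>f\<in>col Z0. recolour Z0 Z U par h f \<in> col Z"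
      using ext[OF Z0 Z] Z by (auto simp: \<Z>_def)
    define q where "q = recolour Z0 Z U par h g"
    have "q \<in> col Z" using e g unfolding q_def by blast
    moreover have "restrict q Z0 = g"
    proof
      fix v show "restrict q Z0 v = g v"
        using g Z by (cases "v \<in> Z0") (auto simp: q_def col_def \<Z>_def PiE_iff extensional_def)
    qed
    ultimately show ?thesis by (auto simp: pin_def)
  qed
  have "\<exists>L::nat set \<Rightarrow> int. L {} = 1 \<and> (\<forall>N\<in>vars ` \<Z>. \<forall>c.
     (\<forall>p\<in>P N. (\<Sum>m\<in>Pow N. c m * mon m p) = 0) \<longrightarrow> (\<Sum>m\<in>Pow N. c m * L m) = 0)"
  proof (rule compatible_functional_exists)
    show "finite N" if "N \<in> vars ` \<Z>" for N
      using that finZ finite_vars by auto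
    show "N \<inter> N' \<in> vars ` \<Z>" if N: "N \<in> vars ` \<Z>" "N' \<in> vars ` \<Z>" for N N'
    proof -
      obtain Z Z' where Z: "Z \<in> \<Z>" "N = vars Z" "Z' \<in> \<Z>" "N' = vars Z'" using N by auto
      have "card (Z \<inter> Z') \<le> card Z" by (rule card_mono) (use finZ Z in auto)
      then have "Z \<inter> Z' \<in> \<Z>" using Z by (auto simp: \<Z>_def intro: sealed_Int)
      then show ?thesis using Z vars_Int ZV by auto
    qed
    show "P N \<subseteq> Pow N" if N: "N \<in> vars ` \<Z>" for N
    proof
      fix p assume p: "p \<in> P N"
      obtain Z where Z: "Z \<in> \<Z>" "N = vars Z" using N by auto
      then obtain h where h: "h \<in> col Z" "p = point h Z" using p Pv by (auto simp: pin_def)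
      show "p \<in> Pow N"
        unfolding h(2) Z(2) using point_subset_vars[OF col_less[OF h(1)] subset_refl] by simp
    qed
    show "P N \<noteq> {}" if "N \<in> vars ` \<Z>" for N
      using that Pv ne by auto
    show "p \<inter> N \<in> P N" if N: "N \<in> vars ` \<Z>" "N' \<in> vars ` \<Z>" "N \<subseteq> N'" "p \<in> P N'" for N N' p
    proof -
      obtain Z Z' where Z: "Z \<in> \<Z>" "N = vars Z" "Z' \<in> \<Z>" "N' = vars Z'" using N by auto
      have ZZ': "Z \<subseteq> Z'" using N(3) Z vars_subset_iff ZV by auto
      obtain h where h: "h \<in> pin Z'" "p = point h Z'" using N(4) Z Pv by auto
      have "restrict h Z \<in> pin Z"
        using h(1) ZZ' Z(1) col_restrict[of h Z' Z]
        by (auto simp: pin_def \<Z>_def restrict_restrict Int_absorb1)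
      moreover have "p \<inter> N = point (restrict h Z) Z"
      proof -
        have lt: "h v < 3" if "v \<in> Z'" for v using h(1) that col_less by (auto simp: pin_def)
        have "3 * r v + h v \<in> vars Z \<longleftrightarrow> v \<in> Z" if "v \<in> Z'" for v
          using code_in_vars[of v Z "h v"] that ZV Z lt by auto
        then show ?thesis unfolding h(2) Z(2) point_def using ZZ' by auto
      qed
      ultimately show ?thesis using Pv Z by auto
    qed
    fix N N' assume N: "N \<in> vars ` \<Z>" "N' \<in> vars ` \<Z>" "N \<subseteq> N'"
    obtain Z Z' where Z: "Z \<in> \<Z>" "N = vars Z" "Z' \<in> \<Z>" "N' = vars Z'" using N by auto
    have ZZ': "Z \<subseteq> Z'" using N(3) Z vars_subset_iff ZV by auto
    have "sealed M Z" using Z by (simp add: \<Z>_def)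
    then obtain U par h where U: "U \<subseteq> Z' - Z" "\<forall>u\<in>U. par u \<in> Z \<and> r (par u) < r u"
      and e: "\<forall>f\<in>col Z. recolour Z Z' U par h f \<in> col Z'"
      using ext[OF _ Z(3) ZZ'] by meson
    define ex where "ex = (\<lambda>f. recolour Z Z' U par h f)"
    define \<rho> where "\<rho> = (\<lambda>p. point (ex (SOME f. f \<in> pin Z \<and> p = point f Z)) Z')"
    have \<rho>: "\<exists>f\<in>pin Z. p = point f Z \<and> \<rho> p = point (ex f) Z'" if "p \<in> P N" for p
    proof -
      have "\<exists>f. f \<in> pin Z \<and> p = point f Z" using that Pv Z by auto
      from someI_ex[OF this] show ?thesis unfolding \<rho>_def by blast
    qed
    have ex_col: "ex f \<in> col Z'" if "f \<in> pin Z" for f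
      using e that by (auto simp: pin_def ex_def)
    have ex_Z: "ex f v = f v" if "v \<in> Z" for f v using that ZZ' by (auto simp: ex_def)
    have ex_pin: "ex f \<in> pin Z'" if "f \<in> pin Z" for f
    proof -
      have "restrict (ex f) Z0 = restrict f Z0"
        using ex_Z Z(1) by (auto simp: \<Z>_def restrict_def fun_eq_iff)
      then show ?thesis using ex_col[OF that] that by (auto simp: pin_def)
    qed
    have in_\<rho>: "3 * r v + i \<in> point (ex f) Z' \<longleftrightarrow> ex f v = i" if "f \<in> pin Z" "v \<in> Z'" "i < 3" for f v i
      using code_in_point[of v Z' i "ex f"] that ZV[OF Z(3)] col_less[OF ex_col[OF that(1)]] by auto
    have in_p: "3 * r v + i \<in> point f Z \<longleftrightarrow> f v = i" if "f \<in> pin Z" "v \<in> Z" "i < 3" for f v i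
      using code_in_point[of v Z i f] that ZV[OF Z(1)] col_less[of f Z] by (auto simp: pin_def)
    show "\<exists>\<rho>. (\<forall>p\<in>P N. \<rho> p \<in> P N' \<and> \<rho> p \<inter> N = p) \<and>
         (\<forall>e\<in>N' - N. lowers (P N) N \<rho> e)"
    proof (intro exI[of _ \<rho>] conjI ballI)
      fix p assume "p \<in> P N"
      then obtain f where f: "f \<in> pin Z" "p = point f Z" "\<rho> p = point (ex f) Z'" using \<rho> by blast
      show "\<rho> p \<in> P N'" using f ex_pin Pv Z by auto
      show "\<rho> p \<inter> N = p"
      proof -
        have iff: "3 * r v + ex f v \<in> vars Z \<longleftrightarrow> v \<in> Z" if "v \<in> Z'" for v
          using code_in_vars[of v Z "ex f v"] that ZV Z col_less[OF ex_col[OF f(1)] that] by auto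
        have "point (ex f) Z' \<inter> vars Z = point (ex f) Z"
          unfolding point_def using iff ZZ' by blast
        also have "\<dots> = point f Z" unfolding point_def using ex_Z by (auto intro!: image_cong)
        finally show ?thesis using f(2,3) Z(2) by simp
      qed
    next
      fix e' assume e': "e' \<in> N' - N"
      then obtain v i where vi: "e' = 3 * r v + i" "v \<in> Z'" "i < 3" using Z by (auto simp: vars_def)
      then have vZ: "v \<notin> Z" using e' Z by (auto simp: vars_def)
      show "lowers (P N) N \<rho> e'"
      proof (cases "v \<in> U")
        case False
        have "of_bool (e' \<in> \<rho> p) = (of_bool (h v = i) :: int)" if pP: "p \<in> P N" for p
        proof -
          obtain f where f: "f \<in> pin Z" "\<rho> p = point (ex f) Z'" using \<rho>[OF pP] by blast
          show ?thesis unfolding f(2) vi(1) in_\<rho>[OF f(1) vi(2,3)]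
            using vZ False vi(2) by (simp add: ex_def)
        qed
        then show ?thesis by blast
      next
        case True
        let ?e = "3 * r (par v) + 1"
        have pv: "par v \<in> Z" "r (par v) < r v" using U True by auto
        have eN: "?e \<in> N" using code_in_vars[of "par v" Z 1] pv Z ZV by auto
        have "?e < e'" using pv vi by simp
        note eN = eN this
        \<comment> \<open>If \<open>x\<close> says that the parent has colour 1, then the indicators
          of the colours 0, 1, 2 at the child are 0, 1 - \<open>x\<close> and
          \<open>x\<close>.\<close>
        have "of_bool (e' \<in> \<rho> p) = (of_bool (i = 1) :: int) + (of_bool (i = 2) - of_bool (i = 1)) * of_bool (?e \<in> p)"
          if pP: "p \<in> P N" for p
        proof -
          obtain f where f: "f \<in> pin Z" "p = point f Z" "\<rho> p = point (ex f) Z'" using \<rho>[OF pP] by blast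
          have "ex f v = (if f (par v) = 1 then 2 else 1)" using vZ True vi(2) by (simp add: ex_def)
          then show ?thesis unfolding f(3) vi(1) in_\<rho>[OF f(1) vi(2,3)]
            using in_p[OF f(1) pv(1), of 1] f(2) by auto
        qed
        then show ?thesis using eN by blast
      qed
    qed
  qed
  then obtain L :: "nat set \<Rightarrow> int" where L1: "L {} = 1" and
    L2: "\<forall>N\<in>vars ` \<Z>. \<forall>c. (\<forall>p\<in>P N. (\<Sum>m\<in>Pow N. c m * mon m p) = 0) \<longrightarrow> (\<Sum>m\<in>Pow N. c m * L m) = 0"
    by (elim exE conjE)
  have "(\<Sum>m\<in>\<M>. L m) = L m0"
    if Z: "sealed M Z" "Z0 \<subseteq> Z" "card Z \<le> M" and \<M>: "\<M> \<subseteq> Pow (vars Z)" "m0 \<subseteq> vars Z"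
      and eq: "\<forall>h\<in>col Z. restrict h Z0 = g \<longrightarrow> (\<Sum>m\<in>\<M>. mon m (point h Z)) = mon m0 (point h Z)" for Z \<M> m0
  proof -
    have ZZ: "Z \<in> \<Z>" using Z by (simp add: \<Z>_def)
    define c where "c = (\<lambda>m. of_bool (m \<in> \<M>) - of_bool (m = m0) :: int)"
    have fin: "finite (Pow (vars Z))" using finite_vars finZ[OF ZZ] by simp
    have split: "(\<Sum>m\<in>Pow (vars Z). c m * f m) = (\<Sum>m\<in>\<M>. f m) - f m0" for f :: "nat set \<Rightarrow> int"
    proof -
      have "(\<Sum>m\<in>Pow (vars Z). of_bool (m \<in> \<M>) * f m) = (\<Sum>m\<in>\<M>. of_bool (m \<in> \<M>) * f m)"
        by (rule sum.mono_neutral_right) (use fin \<M> in auto)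
      moreover have "(\<Sum>m\<in>\<M>. of_bool (m \<in> \<M>) * f m) = (\<Sum>m\<in>\<M>. f m)" by (rule sum.cong) auto
      moreover have "(\<Sum>m\<in>Pow (vars Z). of_bool (m = m0) * f m) = (\<Sum>m\<in>{m0}. of_bool (m = m0) * f m)"
        by (rule sum.mono_neutral_right) (use fin \<M> in auto)
      ultimately show ?thesis by (simp add: c_def left_diff_distrib sum_subtractf)
    qed
    have "(\<Sum>m\<in>Pow (vars Z). c m * L m) = 0"
    proof (rule L2[rule_format, OF imageI[OF ZZ]])
      fix p assume "p \<in> P (vars Z)"
      then obtain h where "h \<in> col Z" "restrict h Z0 = g" "p = point h Z"
        using Pv[OF ZZ] by (auto simp: pin_def)
      then show "(\<Sum>m\<in>Pow (vars Z). c m * mon m p) = 0" unfolding split using eq by simp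
    qed
    then show ?thesis unfolding split by simp
  qed
  then show ?thesis using L1 by blast
qed

section \<open>From the functional to acceptance of the graph\<close>

lemma hom_sub_K3: "hom_sub (graph_struct n E) K3 X = col X"
proof -
  have "f \<in> hom_sub (graph_struct n E) K3 X \<longleftrightarrow> f \<in> col X" for f
  proof (cases "f \<in> X \<rightarrow>\<^sub>E {0, 1, 2}")
    case True
    then have m: "f v \<in> {0, 1, 2}" if "v \<in> X" for v using that by (rule PiE_mem)
    show ?thesis using True m unfolding hom_sub_def col_def graph_struct_def K3_def by fastforce
  qed (simp add: hom_sub_def col_def graph_struct_def K3_def)
  then show ?thesis by blast
qed

text \<open>The size \<open>2 * k\<close> arises because a test pins one set \<open>X0\<close> while
  an equation concerns another set \<open>X\<close>; both are handled inside
  \<open>cl M (X \<union> X0)\<close>. The condition on \<open>cl M {}\<close> makes the empty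
  colouring a colouring of a sealed set, and extending it shows that no \<open>H X\<close> is
  empty.\<close>

theorem coh_accepts_if_small_closures:
  assumes V: "V = {0..<n}"
    and small: "\<And>X. X \<subseteq> V \<Longrightarrow> card X \<le> 2 * k \<Longrightarrow> card (cl M X) \<le> M"
    and cl0: "cl M {} = {}"
  shows "coh_accepts (graph_struct n E) K3 k"
proof -
  let ?A = "graph_struct n E"
  have rel: "relevant ?A k X \<longleftrightarrow> X \<subseteq> V \<and> card X \<le> k" for X
    by (simp add: relevant_def graph_struct_def V)
  define H where "H = (\<lambda>X. if relevant ?A k X then (\<lambda>h. restrict h X) ` col (cl M X) else {})"
  have relsub: "relevant ?A k Y" if "relevant ?A k X" "Y \<subseteq> X" for X Y
    by (rule relevant_subset[OF that(1) _ that(2)]) (simp add: graph_struct_def)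
  have H: "H X = (\<lambda>h. restrict h X) ` col (cl M X)" if "relevant ?A k X" for X
    using that by (simp add: H_def)
  have sealedX: "sealed M (cl M X)" if "relevant ?A k X" for X
    using that rel by (auto intro: sealed_cl)
  have cardX: "card (cl M X) \<le> M" if "relevant ?A k X" for X
    using that rel by (intro small) auto
  have Hcol: "H X \<subseteq> col X" if "relevant ?A k X" for X
    using H[OF that] col_restrict[OF _ cl_extensive] by auto
  have extend: "\<exists>q\<in>col Z'. restrict q Z = f"
    if Z: "sealed M Z" "Z \<subseteq> Z'" "Z' \<subseteq> V" "card Z' \<le> M" and f: "f \<in> col Z" for Z Z' f
  proof -
    obtain U par h where "\<forall>f\<in>col Z. recolour Z Z' U par h f \<in> col Z'" using sealed_extension[OF Z] by (elim exE conjE)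
    then have mem: "recolour Z Z' U par h f \<in> col Z'" (is "?q \<in> _") using f by blast
    moreover have "restrict ?q Z = f"
    proof
      fix v show "restrict ?q Z v = f v"
        using f Z(2) by (cases "v \<in> Z") (auto simp: col_def PiE_iff extensional_def)
    qed
    ultimately show ?thesis by blast
  qed
  have cons: "k_consistent ?A K3 k H"
    unfolding k_consistent_def
  proof (intro conjI allI impI ballI)
    show "H X \<subseteq> hom_sub ?A K3 X" if "relevant ?A k X" for X
      using Hcol[OF that] by (simp add: hom_sub_K3)
  next
    fix X Y f assume X: "relevant ?A k X" and Y: "Y \<subseteq> X" and f: "f \<in> H Y"
    have rY: "relevant ?A k Y" using relsub[OF X Y] .
    obtain h where h: "h \<in> col (cl M Y)" "f = restrict h Y" using f H[OF rY] by auto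
    obtain q where q: "q \<in> col (cl M X)" "restrict q (cl M Y) = h"
      using extend[OF sealedX[OF rY] cl_mono[OF Y] sealed_subset[OF sealedX[OF X]] cardX[OF X] h(1)] by blast
    have "restrict (restrict q X) Y = restrict q Y" using Y by (simp add: restrict_restrict Int_absorb1)
    also have "\<dots> = restrict (restrict q (cl M Y)) Y"
      using cl_extensive[of Y M] by (simp add: restrict_restrict Int_absorb1)
    finally show "\<exists>g\<in>H X. restrict g Y = f" using q h H[OF X] by auto
  next
    fix X Y g assume X: "relevant ?A k X" and Y: "Y \<subseteq> X" and g: "g \<in> H X"
    have rY: "relevant ?A k Y" using relsub[OF X Y] .
    obtain h where h: "h \<in> col (cl M X)" "g = restrict h X" using g H[OF X] by auto
    have "restrict h (cl M Y) \<in> col (cl M Y)" using col_restrict[OF h(1) cl_mono[OF Y]] .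
    moreover have "restrict (restrict h (cl M Y)) Y = restrict g Y"
      using cl_extensive[of Y M] Y by (simp add: h(2) restrict_restrict Int_absorb1)
    ultimately show "restrict g Y \<in> H Y" unfolding H[OF rY] by (metis image_eqI)
  qed
  have nonempty: "H X \<noteq> {}" if X: "relevant ?A k X" for X
  proof -
    have "relevant ?A k {}" by (simp add: rel)
    from sealedX[OF this] have "sealed M {}" by (simp add: cl0)
    moreover have "(\<lambda>v. undefined) \<in> col {}" by (simp add: col_def)
    ultimately have "col (cl M X) \<noteq> {}"
      using extend[of "{}" "cl M X"] sealed_subset[OF sealedX[OF X]] cardX[OF X] by blast
    then show ?thesis by (simp add: H[OF X])
  qed
  have pass: "passes_test ?A K3 k H X0 f0" if X0: "relevant ?A k X0" and f0: "f0 \<in> H X0" for X0 f0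
  proof -
    obtain g where g: "g \<in> col (cl M X0)" "f0 = restrict g X0" using f0 H[OF X0] by auto
    obtain L :: "nat set \<Rightarrow> int" where L1: "L {} = 1" and
      L2': "\<forall>Z \<M> m0. sealed M Z \<longrightarrow> cl M X0 \<subseteq> Z \<longrightarrow> card Z \<le> M \<longrightarrow> \<M> \<subseteq> Pow (vars Z) \<longrightarrow> m0 \<subseteq> vars Z \<longrightarrow>
      (\<forall>h\<in>col Z. restrict h (cl M X0) = g \<longrightarrow>
        (\<Sum>m\<in>\<M>. mon m (point h Z)) = mon m0 (point h Z)) \<longrightarrow> (\<Sum>m\<in>\<M>. L m) = L m0"
      using pinned_functional_exists[OF sealedX[OF X0] g(1)] by (elim exE conjE)
    note L2 = L2'[rule_format]
    have colE: "f \<in> X \<rightarrow>\<^sub>E {0, 1, 2}" if "f \<in> col X" for f X using that by (simp add: col_def)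
    \<comment> \<open>All equations are checked through one pattern. The monomials
      \<open>point f X\<close> for distinct \<open>f\<close> are mutually exclusive at colourings,
      so their sum is the indicator of \<open>restrict h X \<in> Fs\<close>; where it agrees with
      the monomial \<open>m0\<close> on pinned colourings, \<open>L\<close> gives both the same
      value.\<close>
    have transfer: "(\<Sum>f\<in>Fs. L (point f X)) = L m0"
      if X: "relevant ?A k X" and Fs: "Fs \<subseteq> H X" and m0: "m0 \<subseteq> vars X"
        and eq: "\<And>h Z. Z \<subseteq> V \<Longrightarrow> X \<subseteq> Z \<Longrightarrow> X0 \<subseteq> Z \<Longrightarrow> h \<in> col Z \<Longrightarrow> restrict h X \<in> H X \<Longrightarrow> restrict h X0 = f0 \<Longrightarrow>
           of_bool (restrict h X \<in> Fs) = mon m0 (point h Z)" for X Fs m0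
    proof -
      define Z where "Z = cl M (X \<union> X0)"
      have XV: "X \<subseteq> V" "X0 \<subseteq> V" using X X0 rel by auto
      have Z: "sealed M Z" unfolding Z_def by (rule sealed_cl) (use XV in auto)
      have ZV: "Z \<subseteq> V" using sealed_subset[OF Z] .
      have sub: "X \<subseteq> Z" "X0 \<subseteq> Z" "cl M X \<subseteq> Z" "cl M X0 \<subseteq> Z"
        using cl_extensive[of "X \<union> X0" M] cl_mono[of X "X \<union> X0" M] cl_mono[of X0 "X \<union> X0" M]
        by (auto simp: Z_def)
      have "card (X \<union> X0) \<le> 2 * k" using X X0 rel card_Un_le[of X X0] by fastforce
      then have cZ: "card Z \<le> M" unfolding Z_def using XV by (intro small) auto
      have FsE: "Fs \<subseteq> X \<rightarrow>\<^sub>E {0, 1, 2}" using Fs Hcol[OF X] colE by blast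
      have finFs: "finite Fs"
        by (rule finite_subset[OF FsE]) (use XV finV in \<open>auto intro!: finite_PiE intro: finite_subset\<close>)
      have inj: "inj_on (\<lambda>f. point f X) Fs" using inj_on_point[OF XV(1)] FsE by (rule inj_on_subset)
      have "(\<Sum>m\<in>(\<lambda>f. point f X) ` Fs. L m) = L m0"
      proof (rule L2[OF Z sub(4) cZ])
        show "(\<lambda>f. point f X) ` Fs \<subseteq> Pow (vars Z)"
        proof
          fix m assume "m \<in> (\<lambda>f. point f X) ` Fs"
          then obtain f where "f \<in> Fs" "m = point f X" by auto
          then show "m \<in> Pow (vars Z)"
            using point_subset_vars[of X f Z] col_less[of f X] Fs Hcol[OF X] sub(1) by blast
        qed
        show "m0 \<subseteq> vars Z" using m0 vars_mono[OF sub(1)] by blast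
        fix h assume h: "h \<in> col Z" "restrict h (cl M X0) = g"
        have r0: "restrict h X0 = f0"
          using h(2) g(2) cl_extensive[of X0 M] by (auto simp: restrict_restrict Int_absorb1)
        have rX: "restrict h X \<in> H X"
        proof -
          have "restrict (restrict h (cl M X)) X = restrict h X"
            using cl_extensive[of X M] by (simp add: restrict_restrict Int_absorb1)
          then show ?thesis unfolding H[OF X] using col_restrict[OF h(1) sub(3)] by (metis image_eqI)
        qed
        have "(\<Sum>m\<in>(\<lambda>f. point f X) ` Fs. mon m (point h Z)) = (\<Sum>f\<in>Fs. mon (point f X) (point h Z))"
          by (simp add: sum.reindex[OF inj])
        also have "\<dots> = (\<Sum>f\<in>Fs. if restrict h X = f then 1 else 0)"
          by (rule sum.cong) (use mon_point[OF _ h(1) sub(1) ZV] FsE in auto)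
        also have "\<dots> = of_bool (restrict h X \<in> Fs)" using finFs by simp
        finally show "(\<Sum>m\<in>(\<lambda>f. point f X) ` Fs. mon m (point h Z)) = mon m0 (point h Z)"
          using eq[OF ZV sub(1,2) h(1) rX r0] by simp
      qed
      then show ?thesis by (simp add: sum.reindex[OF inj])
    qed
    define x where "x = (\<lambda>X f. L (point f X))"
    have "Lk_solution ?A K3 k H x"
      unfolding Lk_solution_def
    proof (intro conjI allI impI)
      fix X assume X: "relevant ?A k X"
      show "(\<Sum>f\<in>H X. x X f) = 1"
        unfolding x_def using transfer[OF X subset_refl, of "{}"] L1 by (simp add: mon_def)
    next
      fix X Y f' assume X: "relevant ?A k X" and Y: "Y \<subseteq> X" and f': "f' \<in> H Y"
      have rY: "relevant ?A k Y" using relsub[OF X Y] .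
      have f'col: "f' \<in> col Y" using Hcol[OF rY] f' by blast
      show "(\<Sum>f\<in>{f\<in>H X. restrict f Y = f'}. x X f) = x Y f'"
        unfolding x_def
      proof (rule transfer[OF X])
        show "point f' Y \<subseteq> vars X" using point_subset_vars[OF _ Y] col_less[OF f'col] by blast
        fix h Z assume h: "Z \<subseteq> V" "X \<subseteq> Z" "h \<in> col Z" "restrict h X \<in> H X"
        have "mon (point f' Y) (point h Z) = of_bool (restrict h Y = f')"
          by (rule mon_point[OF colE[OF f'col] h(3) _ h(1)]) (use Y h in auto)
        moreover have "restrict (restrict h X) Y = restrict h Y"
          using Y by (simp add: restrict_restrict Int_absorb1)
        ultimately show "of_bool (restrict h X \<in> {f \<in> H X. restrict f Y = f'}) = mon (point f' Y) (point h Z)"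
          using h(4) by simp
      qed auto
    qed
    moreover have "x X0 f0 = 1"
    proof -
      have "(\<Sum>f\<in>{f0}. L (point f X0)) = L {}"
        by (rule transfer[OF X0]) (use f0 in \<open>auto simp: mon_def\<close>)
      then show ?thesis using L1 by (simp add: x_def)
    qed
    moreover have "x X0 f = 0" if f: "f \<in> H X0 - {f0}" for f
    proof -
      have fcol: "f \<in> col X0" using f Hcol[OF X0] by blast
      have "(\<Sum>f\<in>{}. L (point f X0)) = L (point f X0)"
      proof (rule transfer[OF X0])
        show "point f X0 \<subseteq> vars X0" using point_subset_vars[OF _ subset_refl] col_less[OF fcol] by blast
        fix h Z assume h: "Z \<subseteq> V" "X0 \<subseteq> Z" "h \<in> col Z" "restrict h X0 = f0"
        show "of_bool (restrict h X0 \<in> {}) = mon (point f X0) (point h Z)"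
          using mon_point[OF colE[OF fcol] h(3,2,1)] h(4) f by auto
      qed auto
      then show ?thesis by (simp add: x_def)
    qed
    ultimately show ?thesis unfolding passes_test_def by blast
  qed
  show ?thesis
    by (rule coh_acceptsI[OF _ _ cons nonempty _ pass]) (auto simp: graph_struct_def K3_def H_def)
qed

end

section \<open>Size of closures\<close>

lemma greedy_colouring:
  assumes "finite V" "sym E" "irrefl E" "\<And>v. v \<in> V \<Longrightarrow> finite {w. (v, w) \<in> E} \<and> card {w. (v, w) \<in> E} \<le> d"
  shows "\<exists>g. (\<forall>v\<in>V. g v \<le> (d::nat)) \<and> (\<forall>u\<in>V. \<forall>v\<in>V. (u, v) \<in> E \<longrightarrow> g u \<noteq> g v)"
  using assms(1,4)
proof (induction V rule: finite_induct)
  case (insert v V)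
  then obtain g where g: "\<forall>v\<in>V. g v \<le> (d::nat)" "\<forall>u\<in>V. \<forall>v\<in>V. (u, v) \<in> E \<longrightarrow> g u \<noteq> g v"
    by (metis insertCI)
  have fin: "finite {w. (v, w) \<in> E}" and le: "card {w. (v, w) \<in> E} \<le> d"
    using insert.prems[of v] by auto
  have "card (g ` {w. (v, w) \<in> E}) \<le> d" using card_image_le[OF fin, of g] le by simp
  then have "\<not> {..d} \<subseteq> g ` {w. (v, w) \<in> E}"
    using card_mono[of "g ` {w. (v, w) \<in> E}" "{..d}"] fin by auto
  then obtain c where c: "c \<le> d" "c \<notin> g ` {w. (v, w) \<in> E}" by auto
  have "(g(v := c)) x \<noteq> (g(v := c)) y" if xy: "x \<in> insert v V" "y \<in> insert v V" "(x, y) \<in> E" for x y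
  proof -
    have "(y, x) \<in> E" "x \<noteq> y" using xy assms(2,3) by (auto simp: sym_def irrefl_def)
    then show ?thesis using xy g(2) c(2) by auto
  qed
  then show ?case using g(1) c(1) by (intro exI[of _ "g(v := c)"]) auto
qed auto

section \<open>Descendants along rank-decreasing edges and the size of closures\<close>

locale graded_graph = ranked_graph +
  fixes g :: "nat \<Rightarrow> nat" and d :: nat
  assumes g_le: "v \<in> V \<Longrightarrow> g v \<le> d"
    and g_less: "(z, w) \<in> E \<Longrightarrow> r w < r z \<Longrightarrow> g w < g z"
    and deg: "v \<in> V \<Longrightarrow> card {w. (v, w) \<in> E} \<le> d"
    and d_pos: "d \<ge> 1"
begin

definition down :: "(nat \<times> nat) set" where
  "down = {(z, w). (z, w) \<in> E \<and> r w < r z}"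

definition desc :: "nat set \<Rightarrow> nat set" where
  "desc W = down\<^sup>* `` W"

lemma desc_extensive: "W \<subseteq> desc W"
  by (auto simp: desc_def)

lemma desc_closed: "z \<in> desc W \<Longrightarrow> (z, w) \<in> E \<Longrightarrow> r w < r z \<Longrightarrow> w \<in> desc W"
  unfolding desc_def by (auto simp: down_def intro: rtrancl_into_rtrancl)

lemma desc_subset: "W \<subseteq> V \<Longrightarrow> desc W \<subseteq> V"
proof
  fix v assume W: "W \<subseteq> V" and "v \<in> desc W"
  then obtain w where "w \<in> W" "(w, v) \<in> down\<^sup>*" by (auto simp: desc_def)
  from this(2,1) show "v \<in> V"
    by (induction rule: rtrancl_induct) (use W EV in \<open>auto simp: down_def\<close>)
qed

lemma finite_nbrs: "finite {w. (v, w) \<in> E}"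
  by (rule finite_subset[OF _ finV]) (use EV in auto)

lemma card_down_image: "A \<subseteq> V \<Longrightarrow> card (down `` A) \<le> d * card A"
proof -
  assume A: "A \<subseteq> V"
  have finA: "finite A" using A finV by (rule finite_subset)
  have "down `` A \<subseteq> (\<Union>v\<in>A. {w. (v, w) \<in> E})" by (auto simp: down_def)
  then have "card (down `` A) \<le> card (\<Union>v\<in>A. {w. (v, w) \<in> E})"
    using finA finite_nbrs by (intro card_mono) auto
  also have "\<dots> \<le> (\<Sum>v\<in>A. card {w. (v, w) \<in> E})" by (rule card_UN_le[OF finA])
  also have "\<dots> \<le> (\<Sum>v\<in>A. d)" by (rule sum_mono) (use A deg in auto)
  finally show ?thesis by (simp add: mult.commute)
qed

lemma down_pow: "(z, v) \<in> down ^^ j \<Longrightarrow> g v + j \<le> g z"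
  by (induction j arbitrary: v) (fastforce simp: down_def dest: g_less)+

lemma card_down_pow:
  assumes "W \<subseteq> V"
  shows "(down ^^ j) `` W \<subseteq> V \<and> card ((down ^^ j) `` W) \<le> d ^ j * card W"
proof (induction j)
  case (Suc j)
  have eq: "(down ^^ Suc j) `` W = down `` ((down ^^ j) `` W)" by auto
  have "card (down `` ((down ^^ j) `` W)) \<le> d * card ((down ^^ j) `` W)"
    by (rule card_down_image) (use Suc in auto)
  also have "\<dots> \<le> d * (d ^ j * card W)" using Suc by simp
  finally have "card ((down ^^ Suc j) `` W) \<le> d ^ Suc j * card W" unfolding eq by simp
  moreover have "(down ^^ Suc j) `` W \<subseteq> V" unfolding eq using EV by (auto simp: down_def)
  ultimately show ?case by blast
qed (use assms in auto)

lemma card_desc: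
  assumes W: "W \<subseteq> V"
  shows "card (desc W) \<le> (d + 1) * d ^ d * card W"
proof -
  have "desc W \<subseteq> (\<Union>j\<le>d. (down ^^ j) `` W)"
  proof
    fix v assume "v \<in> desc W"
    then obtain w j where w: "w \<in> W" "(w, v) \<in> down ^^ j" by (auto simp: desc_def rtrancl_power)
    then have "j \<le> d" using down_pow[OF w(2)] g_le[of w] W by auto
    then show "v \<in> (\<Union>j\<le>d. (down ^^ j) `` W)" using w by auto
  qed
  then have "card (desc W) \<le> card (\<Union>j\<le>d. (down ^^ j) `` W)"
    by (rule card_mono[rotated]) (use card_down_pow[OF W] finV in \<open>auto intro: finite_subset\<close>)
  also have "\<dots> \<le> (\<Sum>j\<le>d. card ((down ^^ j) `` W))" by (rule card_UN_le) simp
  also have "\<dots> \<le> (\<Sum>j\<le>d. d ^ d * card W)"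
  proof (rule sum_mono)
    fix j assume "j \<in> {..d}"
    then have "d ^ j \<le> d ^ d" using d_pos by (intro power_increasing) auto
    then show "card ((down ^^ j) `` W) \<le> d ^ d * card W"
      using card_down_pow[OF W, of j] by (meson le_trans mult_le_mono1)
  qed
  finally show ?thesis by (simp add: algebra_simps)
qed

text \<open>\<open>Anc\<close> is the path that climbs from \<open>z\<close> along the predecessors
  \<open>pa\<close>, without its end in \<open>W\<close>. Since \<open>g\<close> increases at every
  step and is at most \<open>d\<close>, the climb is short; the induction is on the room
  \<open>d - g z\<close>.\<close>

lemma ancestors_exist:
  assumes par: "\<And>z. z \<in> desc W - W \<Longrightarrow> pa z \<in> desc W \<and> (pa z, z) \<in> down"
    and W: "W \<subseteq> V" and z: "z \<in> desc W"
  shows "\<exists>Anc. Anc \<subseteq> desc W - W \<and> z \<in> W \<union> Anc \<and> pa ` Anc \<subseteq> W \<union> Anc \<and> card Anc \<le> d + 1 - g z"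
  using z
proof (induction "d - g z" arbitrary: z rule: less_induct)
  case less
  show ?case
  proof (cases "z \<in> W")
    case True
    then show ?thesis by (intro exI[of _ "{}"]) auto
  next
    case False
    then have p: "pa z \<in> desc W" "(pa z, z) \<in> down" using par less.prems by auto
    have g1: "g z < g (pa z)" using p(2) g_less by (auto simp: down_def)
    have g2: "g (pa z) \<le> d" using g_le p(1) desc_subset[OF W] by auto
    obtain Anc where Anc: "Anc \<subseteq> desc W - W" "pa z \<in> W \<union> Anc" "pa ` Anc \<subseteq> W \<union> Anc" "card Anc \<le> d + 1 - g (pa z)"
      using less.hyps[of "pa z"] p(1) g1 g2 by (meson diff_less_mono2 less_le_trans)
    have "card (insert z Anc) \<le> Suc (card Anc)" by (rule card_insert_le_m1) auto
    then have "card (insert z Anc) \<le> d + 1 - g z" using Anc(4) g1 g2 by linarith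
    then show ?thesis using Anc less.prems False by (intro exI[of _ "insert z Anc"]) auto
  qed
qed

text \<open>A dense set \<open>U\<close> over \<open>desc W\<close> need not be completed by all of its descendants: attaching it to
  \<open>W\<close> along at most \<open>2|U|\<close> descending paths, each with at most \<open>d + 1\<close> vertices, keeps the gain in
  density proportional to \<open>1 / d\<close>.\<close>

lemma enlarge:
  assumes W: "W \<subseteq> V" and U: "U \<subseteq> V - desc W" "U \<noteq> {}"
    and dense: "5 * card U \<le> 2 * edges U U + 4 * edges U (desc W)"
  shows "\<exists>W'. W \<subseteq> W' \<and> W' \<subseteq> V \<and> card W < card W' \<and> card W' \<le> card W + (2 * d + 3) * card U \<and>
    (4 * d + 6) * edges W W + (8 * d + 13) * (card W' - card W) \<le> (4 * d + 6) * edges W' W'"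
proof -
  have finW: "finite W" using W finV by (rule finite_subset)
  have finU: "finite U" by (rule finite_subset[OF _ finV]) (use U in auto)
  have finD: "finite (desc W)" using desc_subset[OF W] finV by (rule finite_subset)
  obtain F where F: "F \<subseteq> E \<inter> U \<times> desc W" "card F \<le> 2 * card U" "5 * card U \<le> 2 * edges U U + 4 * card F"
  proof (cases "edges U (desc W) \<le> 2 * card U")
    case True
    then show ?thesis using that[of "E \<inter> U \<times> desc W"] dense by auto
  next
    case False
    then obtain F where "F \<subseteq> E \<inter> U \<times> desc W" "card F = 2 * card U"
      by (meson nat_le_linear obtain_subset_with_card_n)
    then show ?thesis using that[of F] by auto
  qed
  have finF: "finite F" using F(1) finite_E by (auto intro: finite_subset)
  define Q where "Q = snd ` F"
  have Q: "Q \<subseteq> desc W" "card Q \<le> 2 * card U" "finite Q"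
    using F card_image_le[OF finF, of snd] finF by (auto simp: Q_def)
  define pa where "pa = (\<lambda>z. SOME p. p \<in> desc W \<and> (p, z) \<in> down)"
  have pa: "pa z \<in> desc W \<and> (pa z, z) \<in> down" if "z \<in> desc W - W" for z
  proof -
    obtain w where w: "w \<in> W" "(w, z) \<in> down\<^sup>*" "z \<noteq> w" using \<open>z \<in> desc W - W\<close> by (auto simp: desc_def)
    then obtain p where "(w, p) \<in> down\<^sup>*" "(p, z) \<in> down" by (metis rtranclE)
    then have "\<exists>p. p \<in> desc W \<and> (p, z) \<in> down" using w by (auto simp: desc_def)
    from someI_ex[OF this] show ?thesis by (simp add: pa_def)
  qed
  have "\<forall>z\<in>Q. \<exists>Anc. Anc \<subseteq> desc W - W \<and> z \<in> W \<union> Anc \<and> pa ` Anc \<subseteq> W \<union> Anc \<and> card Anc \<le> d + 1"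
  proof
    fix z assume "z \<in> Q"
    then have "z \<in> desc W" using Q by auto
    from ancestors_exist[OF pa W this] obtain Anc where "Anc \<subseteq> desc W - W" "z \<in> W \<union> Anc"
      "pa ` Anc \<subseteq> W \<union> Anc" "card Anc \<le> d + 1 - g z" by blast
    then show "\<exists>Anc. Anc \<subseteq> desc W - W \<and> z \<in> W \<union> Anc \<and> pa ` Anc \<subseteq> W \<union> Anc \<and> card Anc \<le> d + 1"
      by (intro exI[of _ Anc]) auto
  qed
  then obtain Ancf where Ancf: "\<forall>z\<in>Q. Ancf z \<subseteq> desc W - W \<and> z \<in> W \<union> Ancf z \<and> pa ` Ancf z \<subseteq> W \<union> Ancf z \<and> card (Ancf z) \<le> d + 1"
    by (rule bchoice[THEN exE])
  define Anc where "Anc = (\<Union>z\<in>Q. Ancf z)"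
  have Anc: "Anc \<subseteq> desc W - W" "Q \<subseteq> W \<union> Anc" "pa ` Anc \<subseteq> W \<union> Anc"
    using Ancf unfolding Anc_def by blast+
  have finAnc: "finite Anc" using Anc(1) finD by (auto intro: finite_subset)
  have cAnc: "card Anc \<le> (2 * d + 2) * card U"
  proof -
    have "card Anc \<le> (\<Sum>z\<in>Q. card (Ancf z))" unfolding Anc_def by (rule card_UN_le[OF Q(3)])
    also have "\<dots> \<le> (\<Sum>z\<in>Q. d + 1)" by (rule sum_mono) (use Ancf in auto)
    also have "\<dots> = card Q * (d + 1)" by simp
    also have "\<dots> \<le> (2 * card U) * (d + 1)" using Q(2) by (rule mult_le_mono1)
    finally show ?thesis by (simp add: algebra_simps)
  qed
  define W' where "W' = W \<union> Anc \<union> U"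
  have disj: "W \<inter> Anc = {}" "(W \<union> Anc) \<inter> U = {}"
    using Anc(1) U(1) desc_extensive[of W] by auto
  have cW': "card W' = card W + card Anc + card U"
    unfolding W'_def using finW finAnc finU disj by (simp add: card_Un_disjoint)
  define F1 where "F1 = (\<lambda>z. (z, pa z)) ` Anc"
  define F2 where "F2 = (\<lambda>z. (pa z, z)) ` Anc"
  define F3 where "F3 = (\<lambda>(u, z). (z, u)) ` F"
  have c12: "card F1 = card Anc" "card F2 = card Anc" "card F3 = card F"
    unfolding F1_def F2_def F3_def by (intro card_image; auto simp: inj_on_def)+
  have fin12: "finite F1" "finite F2" "finite F3" unfolding F1_def F2_def F3_def using finAnc finF by auto
  have downAnc: "(pa z, z) \<in> E" "g z < g (pa z)" if "z \<in> Anc" for z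
    using pa[of z] Anc(1) that g_less by (auto simp: down_def)
  have d12: "F1 \<inter> F2 = {}"
  proof (rule ccontr)
    assume "F1 \<inter> F2 \<noteq> {}"
    then obtain p where "p \<in> F1" "p \<in> F2" by blast
    then obtain x y where xy: "x \<in> Anc" "p = (x, pa x)" "y \<in> Anc" "p = (pa y, y)"
      unfolding F1_def F2_def by blast
    have "x = pa y" using xy(2,4) by (metis fst_conv)
    moreover have "y = pa x" using xy(2,4) by (metis snd_conv)
    ultimately show False using downAnc(2)[OF xy(1)] downAnc(2)[OF xy(3)] by (metis less_asym)
  qed
  have dW: "E \<inter> W \<times> W \<inter> (F1 \<union> F2) = {}" using disj by (auto simp: F1_def F2_def)
  let ?A = "E \<inter> W \<times> W \<union> (F1 \<union> F2)" and ?B = "E \<inter> U \<times> U \<union> (F \<union> F3)"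
  have subA: "?A \<subseteq> E \<inter> (W \<union> Anc) \<times> (W \<union> Anc)"
    using Anc(3) downAnc(1) E_sym by (auto simp: F1_def F2_def)
  have F_in: "F \<subseteq> U \<times> (W \<union> Anc)" using F(1) Anc(2) unfolding Q_def by force
  have F3_in: "F3 \<subseteq> (W \<union> Anc) \<times> U" using F_in by (auto simp: F3_def)
  have cA: "card ?A = edges W W + 2 * card Anc"
  proof -
    have "card (F1 \<union> F2) = 2 * card Anc" using card_Un_disjoint[OF fin12(1,2) d12] c12 by simp
    moreover have "card ?A = edges W W + card (F1 \<union> F2)"
      by (rule card_Un_disjoint) (use fin12 finite_E dW in auto)
    ultimately show ?thesis by simp
  qed
  have cB: "card ?B = edges U U + 2 * card F"
  proof -
    have "F \<inter> F3 = {}" using F_in F3_in disj by auto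
    then have "card (F \<union> F3) = 2 * card F" using card_Un_disjoint[OF finF fin12(3)] c12 by simp
    moreover have "card ?B = edges U U + card (F \<union> F3)"
      by (rule card_Un_disjoint) (use fin12 finF finite_E F_in F3_in disj in auto)
    ultimately show ?thesis by simp
  qed
  have "card (?A \<union> ?B) = card ?A + card ?B"
  proof (rule card_Un_disjoint)
    show "?A \<inter> ?B = {}" using subA F_in F3_in disj by blast
  qed (use fin12 finF finite_E in auto)
  moreover have "card (?A \<union> ?B) \<le> edges W' W'"
  proof (rule le_card_edges)
    have "F \<subseteq> E" "F3 \<subseteq> E" using F(1) E_sym by (auto simp: F3_def)
    then show "?A \<union> ?B \<subseteq> E \<inter> W' \<times> W'"
      using subA F_in F3_in unfolding W'_def by blast
  qed
  \<comment> \<open>In this doubled count of ordered pairs an edge has value 4. Each vertex of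
    \<open>Anc\<close> brings the edge to its predecessor, and the vertices of \<open>U\<close>
    bring at least 5 on average.\<close>
  ultimately have main: "2 * edges W W + 4 * card Anc + 5 * card U \<le> 2 * edges W' W'"
    using cA cB F(3) by linarith
  have pos: "card U > 0" using U(2) finU by (simp add: card_gt_0_iff)
  define \<Delta> where "\<Delta> = card W' - card W"
  have \<Delta>: "\<Delta> = card Anc + card U" using cW' by (simp add: \<Delta>_def)
  have \<Delta>le: "\<Delta> \<le> (2 * d + 3) * card U" using cAnc unfolding \<Delta> by (simp add: algebra_simps)
  \<comment> \<open>The surplus \<open>card U\<close> over 4 per new vertex is at least
    \<open>\<Delta> / (2 * d + 3)\<close>; clearing the denominator yields \<open>4 * d + 6\<close>
    and \<open>8 * d + 13\<close>.\<close>
  have "(2 * d + 3) * (2 * edges W W + 4 * \<Delta> + card U) \<le> (2 * d + 3) * (2 * edges W' W')"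
    by (rule mult_le_mono2) (use main \<Delta> in linarith)
  then have "(4 * d + 6) * edges W W + (8 * d + 13) * \<Delta> \<le> (4 * d + 6) * edges W' W'"
    using \<Delta>le by (simp add: algebra_simps)
  moreover have "W' \<subseteq> V" unfolding W'_def using W Anc(1) U(1) desc_subset[OF W] by blast
  ultimately show ?thesis using cW' pos \<Delta>le \<Delta>_def
    by (intro exI[of _ W']) (auto simp: W'_def)
qed

text \<open>Among the supersets of \<open>X\<close> that gain at least
  \<open>1 + 1 / (8 * d + 12)\<close> edges per vertex beyond \<open>X\<close>, take a largest
  \<open>W\<close>. A violation of sealedness over \<open>desc W\<close> would let it be enlarged,
  for which the slack \<open>(2 * d + 3) * M\<close> in \<open>K\<close> leaves room; so
  \<open>desc W\<close> is sealed and contains the closure. Sparsity allows only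
  \<open>1 + 1 / (20 * d)\<close> edges per vertex, and the gap between the two rates bounds
  \<open>W\<close> by \<open>20 * d * card X\<close>.\<close>

lemma card_cl_le:
  assumes sparse: "\<And>S. S \<subseteq> V \<Longrightarrow> card S \<le> K \<Longrightarrow> 20 * d * edges S S \<le> 2 * (20 * d + 1) * card S"
    and d7: "d \<ge> 7" and X: "X \<subseteq> V" and K: "20 * d * card X + (2 * d + 3) * M \<le> K"
  shows "card (cl M X) \<le> (d + 1) * d ^ d * (20 * d * card X)"
proof -
  define fam where "fam = {W. X \<subseteq> W \<and> W \<subseteq> V \<and> card W \<le> K \<and>
     (8 * d + 13) * card W \<le> (4 * d + 6) * edges W W + (8 * d + 13) * card X}"
  have finfam: "finite fam" by (rule finite_subset[of _ "Pow V"]) (use finV in \<open>auto simp: fam_def\<close>)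
  have "card X \<le> 20 * d * card X" using d7 by simp
  then have "card X \<le> K" using K by linarith
  then have "X \<in> fam" using X by (auto simp: fam_def)
  then have ne: "fam \<noteq> {}" by auto
  obtain W where W: "W \<in> fam" "\<And>W'. W' \<in> fam \<Longrightarrow> card W' \<le> card W"
  proof -
    have "Max (card ` fam) \<in> card ` fam" by (rule Max_in) (use finfam ne in auto)
    then obtain W where "W \<in> fam" "card W = Max (card ` fam)" by auto
    then show ?thesis using that[of W] finfam by auto
  qed
  have WV: "W \<subseteq> V" "X \<subseteq> W" and WK: "card W \<le> K"
    and Wd: "(8 * d + 13) * card W \<le> (4 * d + 6) * edges W W + (8 * d + 13) * card X"
    using W(1) by (auto simp: fam_def)
  have cW: "card W \<le> 20 * d * card X"
  proof -
    define w e x where "w = int (card W)" and "e = int (edges W W)" and "x = int (card X)"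
    define D where "D = int d"
    have D: "D \<ge> 7" using d7 by (simp add: D_def)
    have 1: "20 * D * e \<le> 2 * (20 * D + 1) * w"
    proof -
      have "int (20 * d * edges W W) \<le> int (2 * (20 * d + 1) * card W)"
        using sparse[OF WV(1) WK] by (rule zle_int[THEN iffD2])
      then show ?thesis by (simp add: w_def e_def D_def algebra_simps)
    qed
    have 2: "(8 * D + 13) * w \<le> (4 * D + 6) * e + (8 * D + 13) * x"
    proof -
      have "int ((8 * d + 13) * card W) \<le> int ((4 * d + 6) * edges W W + (8 * d + 13) * card X)"
        using Wd by (rule zle_int[THEN iffD2])
      then show ?thesis by (simp add: w_def e_def x_def D_def algebra_simps)
    qed
    have "20 * D * ((8 * D + 13) * w) \<le> 20 * D * ((4 * D + 6) * e + (8 * D + 13) * x)"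
      using 2 D by (intro mult_left_mono) auto
    also have "\<dots> = (4 * D + 6) * (20 * D * e) + 20 * D * (8 * D + 13) * x" by (simp add: algebra_simps)
    also have "\<dots> \<le> (4 * D + 6) * (2 * (20 * D + 1) * w) + 20 * D * (8 * D + 13) * x"
      using 1 D by (intro add_right_mono mult_left_mono) auto
    finally have "(12 * D - 12) * w \<le> (8 * D + 13) * (20 * D * x)" by (simp add: algebra_simps)
    \<comment> \<open>\<open>8 * D + 13 \<le> 12 * D - 12\<close> holds for integers from 7 on,
      whence the hypothesis on \<open>d\<close>.\<close>
    also have "\<dots> \<le> (12 * D - 12) * (20 * D * x)"
      using D by (intro mult_right_mono) (auto simp: x_def)
    finally have "w \<le> 20 * D * x" using D by (subst (asm) mult_le_cancel_left_pos) auto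
    then have "int (card W) \<le> int (20 * d * card X)" by (simp add: w_def D_def x_def)
    then show ?thesis by (rule zle_int[THEN iffD1])
  qed
  have "sealed M (desc W)"
    unfolding sealed_def
  proof (intro conjI allI impI)
    show "desc W \<subseteq> V" by (rule desc_subset[OF WV(1)])
    show "w \<in> desc W" if "z \<in> desc W" "(z, w) \<in> E" "r w < r z" for z w
      using desc_closed that by blast
    fix U assume U: "U \<subseteq> V - desc W" "U \<noteq> {}" "card U \<le> M"
    show "2 * edges U U + 4 * edges U (desc W) < 5 * card U"
    proof (rule ccontr)
      assume "\<not> ?thesis"
      then have "5 * card U \<le> 2 * edges U U + 4 * edges U (desc W)" by simp
      from enlarge[OF WV(1) U(1,2) this] obtain W' where
        W': "W \<subseteq> W'" "W' \<subseteq> V" "card W < card W'" "card W' \<le> card W + (2 * d + 3) * card U"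
         "(4 * d + 6) * edges W W + (8 * d + 13) * (card W' - card W) \<le> (4 * d + 6) * edges W' W'"
        by blast
      have "(2 * d + 3) * card U \<le> (2 * d + 3) * M" using U(3) by (rule mult_le_mono2)
      then have "card W' \<le> K" using W'(4) cW K by linarith
      moreover have "(8 * d + 13) * card W' \<le> (4 * d + 6) * edges W' W' + (8 * d + 13) * card X"
      proof -
        have "(8 * d + 13) * card W' = (8 * d + 13) * card W + (8 * d + 13) * (card W' - card W)"
          using W'(3) by (metis add_mult_distrib2 le_add_diff_inverse less_imp_le)
        then show ?thesis using Wd W'(5) by linarith
      qed
      ultimately have "W' \<in> fam" using W'(1,2) WV(2) by (auto simp: fam_def)
      then show False using W(2) W'(3) by fastforce
    qed
  qed
  then have "cl M X \<subseteq> desc W" using WV(2) desc_extensive[of W] by (intro cl_least) auto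
  then have "card (cl M X) \<le> card (desc W)"
    using desc_subset[OF WV(1)] finV by (intro card_mono) (auto intro: finite_subset)
  also have "\<dots> \<le> (d + 1) * d ^ d * card W" by (rule card_desc[OF WV(1)])
  also have "\<dots> \<le> (d + 1) * d ^ d * (20 * d * card X)" using cW by (rule mult_le_mono2)
  finally show ?thesis .
qed

text \<open>With nothing to attach to, sealing asks for fewer than 5/4 edges per vertex, and
  \<open>1 + 1 / (20 * d)\<close> stays below that.\<close>

lemma cl_empty:
  assumes sparse: "\<And>S. S \<subseteq> V \<Longrightarrow> card S \<le> M \<Longrightarrow> 20 * d * edges S S \<le> 2 * (20 * d + 1) * card S"
  shows "cl M {} = {}"
proof -
  have "sealed M {}"
    unfolding sealed_def
  proof (intro conjI allI impI)
    fix U assume U: "U \<subseteq> V - {}" "U \<noteq> {}" "card U \<le> M"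
    have "finite U" using U finV by (auto intro: finite_subset)
    then have pos: "card U > 0" using U by (simp add: card_gt_0_iff)
    have "20 * d * edges U U \<le> 2 * (20 * d + 1) * card U" using sparse U by auto
    then have 1: "20 * (d * edges U U) \<le> 40 * (d * card U) + 2 * card U"
      by (simp add: algebra_simps)
    have 2: "card U \<le> d * card U" using d_pos by simp
    have "d * (2 * edges U U) < d * (5 * card U)" using 1 2 pos by linarith
    then have "2 * edges U U < 5 * card U" by (simp only: mult_less_cancel1)
    then show "2 * edges U U + 4 * edges U {} < 5 * card U" by simp
  qed auto
  then show ?thesis using cl_least[of M "{}" "{}"] by auto
qed

end

text \<open>In terms of unordered edges: at most \<open>(1 + 1 / c) * card S\<close> of them inside
  each small \<open>S\<close>.\<close>

definition locally_sparse :: "nat \<Rightarrow> (nat \<times> nat) set \<Rightarrow> nat \<Rightarrow> nat \<Rightarrow> bool" where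
  "locally_sparse n E c K \<longleftrightarrow> (\<forall>S. S \<subseteq> {0..<n} \<longrightarrow> card S \<le> K \<longrightarrow>
     c * card (E \<inter> S \<times> S) \<le> 2 * (c + 1) * card S)"

theorem coh_accepts_if_locally_sparse:
  assumes G: "simple_graph n E" and deg: "\<And>u. u < n \<Longrightarrow> card {v. (u, v) \<in> E} \<le> d"
    and d7: "d \<ge> 7" and sparse: "locally_sparse n E (20 * d) K" and K: "k * d ^ (d + 6) \<le> K"
  shows "coh_accepts (graph_struct n E) K3 k"
proof -
  have EV: "E \<subseteq> {0..<n} \<times> {0..<n}" and symE: "sym E" and irrE: "irrefl E"
    using G by (auto simp: simple_graph_def)
  have fin: "finite {w. (v, w) \<in> E}" for v
    by (rule finite_subset[of _ "{0..<n}"]) (use EV in auto)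
  obtain g where g: "\<forall>v\<in>{0..<n}. g v \<le> d" "\<forall>u\<in>{0..<n}. \<forall>v\<in>{0..<n}. (u, v) \<in> E \<longrightarrow> g u \<noteq> g v"
    using greedy_colouring[of "{0..<n}" E d] symE irrE deg fin by auto
  \<comment> \<open>A number with the colour as leading digit and the vertex as last digit: it is
    injective, and along an edge a smaller rank means a smaller colour.\<close>
  define r where "r = (\<lambda>v. g v * n + v)"
  have inj: "inj_on r {0..<n}"
  proof (rule inj_onI)
    fix x y assume "x \<in> {0..<n}" "y \<in> {0..<n}" "r x = r y"
    then have "(g x * n + x) mod n = (g y * n + y) mod n" by (simp add: r_def)
    then show "x = y" using \<open>x \<in> _\<close> \<open>y \<in> _\<close> by simp
  qed
  interpret graded_graph "{0..<n}" E r g d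
  proof
    show "g v \<le> d" if "v \<in> {0..<n}" for v using g(1) that by auto
    show "g w < g z" if zw: "(z, w) \<in> E" "r w < r z" for z w
    proof -
      have V: "z \<in> {0..<n}" "w \<in> {0..<n}" using zw EV by auto
      have "\<not> g z < g w"
      proof
        assume "g z < g w"
        then have "(g z + 1) * n \<le> g w * n" by (intro mult_le_mono1) simp
        then show False using zw(2) V by (simp add: r_def)
      qed
      moreover have "g z \<noteq> g w" using g(2) V zw by auto
      ultimately show ?thesis by simp
    qed
  qed (use EV symE irrE inj deg d7 in auto)
  have sp: "20 * d * card (E \<inter> S \<times> S) \<le> 2 * (20 * d + 1) * card S" if "S \<subseteq> {0..<n}" "card S \<le> K" for S
    using sparse that by (simp add: locally_sparse_def)
  define M where "M = (d + 1) * d ^ d * (20 * d * (2 * k))"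
  have bound: "20 * d * (2 * k) + (2 * d + 3) * M \<le> k * d ^ (d + 6)"
  proof -
    have "M \<le> (2 * d) * d ^ d * (20 * d * (2 * k))" unfolding M_def
      by (intro mult_le_mono) (use d7 in auto)
    then have "(2 * d + 3) * M \<le> (3 * d) * ((2 * d) * d ^ d * (20 * d * (2 * k)))"
      by (intro mult_le_mono) (use d7 in auto)
    \<comment> \<open>The factors are \<open>3 * 2 * 20 * 2\<close>. Together with the 40 below they
      make 280, which is less than \<open>7 ^ 3\<close>; so three further powers of \<open>d\<close>
      pay for all constants.\<close>
    also have "\<dots> = 240 * (k * d ^ (d + 3))" by (simp add: power_add numeral_eq_Suc algebra_simps)
    finally have 1: "(2 * d + 3) * M \<le> 240 * (k * d ^ (d + 3))" .
    have "d ^ 1 \<le> d ^ (d + 3)" by (rule power_increasing) (use d7 in auto)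
    then have "k * d ^ 1 \<le> k * d ^ (d + 3)" by (rule mult_le_mono2)
    then have 2: "20 * d * (2 * k) \<le> 40 * (k * d ^ (d + 3))" by (simp add: algebra_simps)
    have "(7::nat) ^ 3 \<le> d ^ 3" using d7 by (rule power_mono) simp
    then have "280 * (k * d ^ (d + 3)) \<le> d ^ 3 * (k * d ^ (d + 3))" by (intro mult_le_mono1) simp
    also have "\<dots> = k * d ^ (d + 6)" by (simp add: power_add numeral_eq_Suc algebra_simps)
    finally show ?thesis using 1 2 by linarith
  qed
  have M3: "M \<le> (2 * d + 3) * M" by simp
  have MK: "M \<le> K" using M3 bound K by linarith
  show ?thesis
  proof (rule coh_accepts_if_small_closures[of n k M])
    fix X assume X: "X \<subseteq> {0..<n}" "card X \<le> 2 * k"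
    have "20 * d * card X \<le> 20 * d * (2 * k)" using X(2) by (rule mult_le_mono2)
    then have "20 * d * card X + (2 * d + 3) * M \<le> K" using bound K by linarith
    then have "card (cl M X) \<le> (d + 1) * d ^ d * (20 * d * card X)"
      using card_cl_le[OF sp d7 X(1)] by blast
    also have "\<dots> \<le> M" unfolding M_def using X(2) by (intro mult_le_mono2)
    finally show "card (cl M X) \<le> M" .
  next
    show "cl M {} = {}" by (rule cl_empty) (use sp MK in auto)
  qed simp
qed

section \<open>Switchings in regular graphs\<close>

lemma finite_regular_graphs: "finite (regular_graphs n d)"
  by (rule finite_subset[of _ "Pow ({0..<n} \<times> {0..<n})"])
     (auto simp: regular_graphs_def simple_graph_def)

lemma regular_graphsD:
  assumes "E \<in> regular_graphs n d"
  shows "E \<subseteq> {0..<n} \<times> {0..<n}" "sym E" "irrefl E" "\<And>u. u < n \<Longrightarrow> card {v. (u, v) \<in> E} = d"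
    "finite E" "\<And>u. finite {v. (u, v) \<in> E}"
proof -
  show E: "E \<subseteq> {0..<n} \<times> {0..<n}" and "sym E" "irrefl E" "\<And>u. u < n \<Longrightarrow> card {v. (u, v) \<in> E} = d"
    using assms by (auto simp: regular_graphs_def simple_graph_def)
  show "finite E" using E by (rule finite_subset) simp
  show "finite {v. (u, v) \<in> E}" for u
    by (rule finite_subset[of _ "{0..<n}"]) (use E in auto)
qed

lemma card_edges_from:
  assumes "E \<in> regular_graphs n d" "A \<subseteq> {0..<n}"
  shows "card (E \<inter> A \<times> UNIV) = d * card A"
proof -
  have "E \<inter> A \<times> UNIV = (SIGMA u:A. {v. (u, v) \<in> E})" by auto
  moreover have "finite A" using assms(2) by (rule finite_subset) simp
  moreover have "\<forall>u\<in>A. card {v. (u, v) \<in> E} = d" using regular_graphsD(4)[OF assms(1)] assms(2) by auto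
  ultimately show ?thesis using regular_graphsD(6)[OF assms(1)] by (simp add: mult.commute)
qed

lemma card_edges:
  assumes "E \<in> regular_graphs n d"
  shows "card E = d * n"
proof -
  have "E \<inter> {0..<n} \<times> UNIV = E" using regular_graphsD(1)[OF assms] by auto
  then show ?thesis using card_edges_from[OF assms subset_refl] by simp
qed

lemma card_edges_swap:
  assumes "sym E"
  shows "card (E \<inter> A \<times> B) = card (E \<inter> B \<times> A)"
  by (rule bij_betw_same_card[of "\<lambda>(x, y). (y, x)"])
     (use assms in \<open>auto simp: bij_betw_def inj_on_def image_iff dest: symD\<close>)

definition switch :: "('a \<times> 'a) set \<Rightarrow> 'a \<Rightarrow> 'a \<Rightarrow> 'a \<Rightarrow> 'a \<Rightarrow> ('a \<times> 'a) set" where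
  "switch E a b c e = E - {(a, b), (b, a), (c, e), (e, c)} \<union> {(a, c), (c, a), (b, e), (e, b)}"

text \<open>Every vertex involved loses one neighbour and gains another, so degrees persist.
  Exchanging the roles of \<open>b\<close> and \<open>c\<close> undoes the move, which is what
  allows counting it from both sides.\<close>

lemma switch_regular:
  assumes E: "E \<in> regular_graphs n d" and ab: "(a, b) \<in> E" and ce: "(c, e) \<in> E"
    and ac: "(a, c) \<notin> E" "a \<noteq> c" and be: "(b, e) \<notin> E" "b \<noteq> e"
  shows "switch E a b c e \<in> regular_graphs n d" "switch (switch E a b c e) a c b e = E"
proof -
  note D = regular_graphsD[OF E]
  have sE: "(y, x) \<in> E" if "(x, y) \<in> E" for x y using that D(2) by (auto dest: symD)
  have iE: "(x, x) \<notin> E" for x using D(3) by (auto simp: irrefl_def)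
  have V: "a < n" "b < n" "c < n" "e < n" using ab ce D(1) by auto
  have ne: "a \<noteq> b" "c \<noteq> e" "a \<noteq> e" "b \<noteq> c"
    using ab ce iE sE[OF ab] sE[OF ce] ac be by auto
  let ?S = "switch E a b c e"
  have mem: "(x, y) \<in> ?S \<longleftrightarrow> ((x, y) \<in> E \<and> (x, y) \<notin> {(a, b), (b, a), (c, e), (e, c)}) \<or>
      (x, y) \<in> {(a, c), (c, a), (b, e), (e, b)}" for x y
    by (auto simp: switch_def)
  have deg: "card {v. (u, v) \<in> ?S} = d" if u: "u < n" for u
  proof -
    have swap: "card (insert y (N - {x})) = card N" if "finite N" "x \<in> N" "y \<notin> N" for N :: "nat set" and x y
      using that by (simp add: card_insert_if card_Suc_Diff1 del: card_Diff_insert)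
    consider "u = a" | "u = b" | "u = c" | "u = e" | "u \<notin> {a, b, c, e}" by blast
    then show ?thesis
    proof cases
      case 1
      have "{v. (u, v) \<in> ?S} = insert c ({v. (u, v) \<in> E} - {b})" using 1 ne ac(2) be(2) by (auto simp: mem)
      then show ?thesis using swap[of "{v. (u, v) \<in> E}" b c] D(4,6) u 1 ab ac by simp
    next
      case 2
      have "{v. (u, v) \<in> ?S} = insert e ({v. (u, v) \<in> E} - {a})" using 2 ne ac(2) be(2) by (auto simp: mem)
      then show ?thesis using swap[of "{v. (u, v) \<in> E}" a e] D(4,6) u 2 sE[OF ab] be by simp
    next
      case 3
      have "{v. (u, v) \<in> ?S} = insert a ({v. (u, v) \<in> E} - {e})" using 3 ne ac(2) be(2) by (auto simp: mem)
      moreover have "(c, a) \<notin> E" using ac sE by auto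
      ultimately show ?thesis using swap[of "{v. (u, v) \<in> E}" e a] D(4,6) u 3 ce by simp
    next
      case 4
      have "{v. (u, v) \<in> ?S} = insert b ({v. (u, v) \<in> E} - {c})" using 4 ne ac(2) be(2) by (auto simp: mem)
      moreover have "(e, b) \<notin> E" using be sE by auto
      ultimately show ?thesis using swap[of "{v. (u, v) \<in> E}" c b] D(4,6) u 4 sE[OF ce] by simp
    next
      case 5
      then have "{v. (u, v) \<in> ?S} = {v. (u, v) \<in> E}" by (auto simp: mem)
      then show ?thesis using D(4) u by simp
    qed
  qed
  have "?S \<subseteq> {0..<n} \<times> {0..<n}" using D(1) V by (auto simp: switch_def)
  moreover have "sym ?S" by (rule symI) (auto simp: mem dest: sE)
  moreover have "irrefl ?S" using ne ac be iE by (auto simp: irrefl_def mem)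
  ultimately show "?S \<in> regular_graphs n d" using deg by (simp add: regular_graphs_def simple_graph_def)
  have ac': "(c, a) \<notin> E" and be': "(e, b) \<notin> E" using ac be sE by auto
  show "switch ?S a c b e = E"
  proof (rule set_eqI, clarify)
    fix x y
    show "(x, y) \<in> switch ?S a c b e \<longleftrightarrow> (x, y) \<in> E"
      unfolding switch_def[of ?S] using mem[of x y] ab ce sE[OF ab] sE[OF ce] ac be ac' be' ne
      by (simp) blast
  qed
qed

text \<open>A circulant graph: two vertices are joined if their cyclic difference lies in a
  symmetric set \<open>T\<close> of size \<open>d\<close>, made of the \<open>h\<close> shortest
  steps in either direction and, for odd \<open>d\<close>, the half turn, which exists because
  \<open>n\<close> is then even. Without such a graph \<open>prob_reg\<close> would be a division by
  zero.\<close>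

lemma regular_graphs_nonempty:
  assumes dn: "d < n" and ev: "even (d * n)"
  shows "regular_graphs n d \<noteq> {}"
proof -
  define h where "h = d div 2"
  define T where "T = {1..h} \<union> ({n - h..n - 1} \<union> (if odd d then {n div 2} else {}))"
  define dist where "dist = (\<lambda>u v. if u \<le> v then v - u else v + n - u)"
  define E where "E = {(u, v). u < n \<and> v < n \<and> dist u v \<in> T}"
  have h2: "2 * h \<le> d" by (simp add: h_def)
  have hn: "h < n - h" "h < n" using h2 dn by linarith+
  have odd: "h < n div 2" "n div 2 < n - h" "d = 2 * h + 1" "n = 2 * (n div 2)" if "odd d"
  proof -
    show d: "d = 2 * h + 1" using that by (simp add: h_def)
    have "even n" using ev that by simp
    then show n: "n = 2 * (n div 2)" by simp
    show "h < n div 2" "n div 2 < n - h" using d n dn by linarith+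
  qed
  have Tn: "T \<subseteq> {1..<n}" using hn odd by (auto simp: T_def)
  have cT: "card T = d"
  proof -
    have c: "card ({n - h..n - 1} \<union> (if odd d then {n div 2} else {})) = h + (if odd d then 1 else 0)"
      using hn odd by (subst card_Un_disjoint) auto
    have "card T = h + card ({n - h..n - 1} \<union> (if odd d then {n div 2} else {}))"
      unfolding T_def using hn odd by (subst card_Un_disjoint) auto
    then have "card T = 2 * h + (if odd d then 1 else 0)" unfolding c by simp
    moreover have "d = 2 * h" if "even d" using that by (simp add: h_def)
    ultimately show ?thesis using odd(3) by presburger
  qed
  have Tsym: "n - t \<in> T" if tT: "t \<in> T" for t
  proof -
    consider "t \<in> {1..h}" | "t \<in> {n - h..n - 1}" | "odd d" "t = n div 2"
      using tT unfolding T_def by (cases "odd d") auto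
    then show ?thesis
    proof cases
      case 1 then have "n - t \<in> {n - h..n - 1}" using hn by auto
      then show ?thesis by (simp add: T_def)
    next
      case 2 then have "n - t \<in> {1..h}" using hn by auto
      then show ?thesis by (simp add: T_def)
    next
      case 3 then have "n - t = n div 2" using odd(4) by linarith
      then show ?thesis using 3 by (simp add: T_def)
    qed
  qed
  have "dist v u = n - dist u v" if "u < n" "v < n" "u \<noteq> v" for u v
    using that by (auto simp: dist_def)
  moreover have d0: "dist u u \<notin> T" for u using Tn by (auto simp: dist_def)
  ultimately have "sym E" using Tsym by (intro symI) (auto simp: E_def, metis)
  moreover have "irrefl E" using d0 by (auto simp: irrefl_def E_def)
  moreover have "card {v. (u, v) \<in> E} = d" if u: "u < n" for u
  proof -
    have "bij_betw (dist u) {v. (u, v) \<in> E} T"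
    proof (rule bij_betw_byWitness[where f' = "\<lambda>t. if u + t < n then u + t else u + t - n"])
      show "\<forall>v\<in>{v. (u, v) \<in> E}. (if u + dist u v < n then u + dist u v else u + dist u v - n) = v"
        using u by (auto simp: E_def dist_def)
      show "\<forall>t\<in>T. dist u (if u + t < n then u + t else u + t - n) = t"
        using u Tn by (auto simp: dist_def)
      show "dist u ` {v. (u, v) \<in> E} \<subseteq> T" by (auto simp: E_def)
      show "(\<lambda>t. if u + t < n then u + t else u + t - n) ` T \<subseteq> {v. (u, v) \<in> E}"
      proof (rule image_subsetI)
        fix t assume t: "t \<in> T"
        then have "t < n" "t \<ge> 1" using Tn by auto
        then have "dist u (if u + t < n then u + t else u + t - n) = t" "(if u + t < n then u + t else u + t - n) < n"
          using u by (auto simp: dist_def)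
        then show "(if u + t < n then u + t else u + t - n) \<in> {v. (u, v) \<in> E}" using u t by (simp add: E_def)
      qed
    qed
    then show ?thesis using cT by (metis bij_betw_same_card)
  qed
  moreover have "E \<subseteq> {0..<n} \<times> {0..<n}" by (auto simp: E_def)
  ultimately have "E \<in> regular_graphs n d" by (simp add: regular_graphs_def simple_graph_def)
  then show ?thesis by blast
qed

text \<open>Double counting: an object of \<open>A\<close> is recovered from the result of a move
  and the label of the move, so forward moves inject into reverse moves.\<close>

lemma switching_count:
  fixes \<phi> :: "'g \<Rightarrow> 't \<Rightarrow> 'g"
  assumes "finite A" "finite B" "\<And>x. x \<in> A \<Longrightarrow> finite (T x)" "\<And>y. y \<in> B \<Longrightarrow> finite (R y)"
    and p: "\<And>x. x \<in> A \<Longrightarrow> p \<le> card (T x)" and q: "\<And>y. y \<in> B \<Longrightarrow> card (R y) \<le> q"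
    and \<phi>: "\<And>x t. x \<in> A \<Longrightarrow> t \<in> T x \<Longrightarrow> \<phi> x t \<in> B \<and> t \<in> R (\<phi> x t) \<and> \<psi> (\<phi> x t) t = x"
  shows "card A * p \<le> card B * q"
proof -
  have "card A * p = (\<Sum>x\<in>A. p)" by simp
  also have "\<dots> \<le> (\<Sum>x\<in>A. card (T x))" by (rule sum_mono) (rule p)
  also have "\<dots> = card (SIGMA x:A. T x)" using assms by simp
  also have "\<dots> \<le> card (SIGMA y:B. R y)"
  proof (rule card_inj_on_le)
    show "inj_on (\<lambda>(x, t). (\<phi> x t, t)) (SIGMA x:A. T x)"
      by (rule inj_onI) (clarsimp, metis \<phi>)
    show "(\<lambda>(x, t). (\<phi> x t, t)) ` (SIGMA x:A. T x) \<subseteq> (SIGMA y:B. R y)" using \<phi> by auto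
    show "finite (SIGMA y:B. R y)" using assms by auto
  qed
  also have "\<dots> = (\<Sum>y\<in>B. card (R y))" using assms by simp
  also have "\<dots> \<le> (\<Sum>y\<in>B. q)" by (rule sum_mono) (rule q)
  finally show ?thesis by simp
qed

section \<open>Probability that a fixed set of edges is present\<close>

definition containing :: "nat \<Rightarrow> nat \<Rightarrow> (nat \<times> nat) set \<Rightarrow> (nat \<times> nat) set set" where
  "containing n d F = {E \<in> regular_graphs n d. F \<subseteq> E}"

text \<open>The edge \<open>uv\<close> is switched away against a second edge \<open>xy\<close>,
  creating \<open>ux\<close> and \<open>vy\<close>. Forbidden are the at most
  \<open>2 * card F\<close> orientations of edges of \<open>F\<close>, and the pairs with
  \<open>x\<close> equal or adjacent to \<open>u\<close>, or \<open>y\<close> equal or adjacent to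
  \<open>v\<close>, at most \<open>d * (d + 1)\<close> of each kind. Conversely, \<open>x\<close> is
  a neighbour of \<open>u\<close> and \<open>y\<close> one of \<open>v\<close> after the move, which
  leaves \<open>d * d\<close> choices.\<close>

lemma containing_insert_count:
  assumes F: "finite F" "\<And>x y. (x, y) \<in> F \<Longrightarrow> x < y" and uv: "(u, v) \<notin> F" "u < v" "v < n"
  shows "card (containing n d (insert (u, v) F)) * (d * n - (2 * card F + 2 * (d * (d + 1)))) \<le>
    card (containing n d F) * (d * d)"
proof -
  define T where "T = (\<lambda>E. {(x, y) \<in> E. (x, y) \<notin> F \<and> (y, x) \<notin> F \<and> x \<noteq> u \<and> (u, x) \<notin> E \<and> y \<noteq> v \<and> (v, y) \<notin> E})"
  define R where "R = (\<lambda>E::(nat \<times> nat) set. {x. (u, x) \<in> E} \<times> {y. (v, y) \<in> E})"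
  show ?thesis
  proof (rule switching_count[where T = T and R = R and \<phi> = "\<lambda>E (x, y). switch E u v x y"
        and \<psi> = "\<lambda>E (x, y). switch E u x v y"])
    show "finite (containing n d (insert (u, v) F))" "finite (containing n d F)"
      using finite_regular_graphs by (auto simp: containing_def)
  next
    fix E assume "E \<in> containing n d (insert (u, v) F)"
    then have E: "E \<in> regular_graphs n d" "(u, v) \<in> E" by (auto simp: containing_def)
    note D = regular_graphsD[OF E(1)]
    show "finite (T E)" by (rule finite_subset[OF _ D(5)]) (auto simp: T_def)
    define Nu where "Nu = insert u {x. (u, x) \<in> E}"
    define Nv where "Nv = insert v {x. (v, x) \<in> E}"
    have N: "Nu \<subseteq> {0..<n}" "Nv \<subseteq> {0..<n}" using D(1) uv by (auto simp: Nu_def Nv_def)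
    have cN: "card Nu \<le> d + 1" "card Nv \<le> d + 1"
      using D(4)[of u] D(4)[of v] uv D(6) by (auto simp: Nu_def Nv_def card_insert_if)
    have sub: "E \<subseteq> T E \<union> (F \<union> (F\<inverse> \<union> (E \<inter> Nu \<times> UNIV \<union> E \<inter> UNIV \<times> Nv)))"
      by (auto simp: T_def Nu_def Nv_def)
    have "card (E \<inter> Nu \<times> UNIV) \<le> d * (d + 1)" 
      unfolding card_edges_from[OF E(1) N(1)] using cN(1) by (rule mult_le_mono2)
    moreover have "card (E \<inter> UNIV \<times> Nv) \<le> d * (d + 1)"
      unfolding card_edges_swap[OF D(2), of UNIV Nv] card_edges_from[OF E(1) N(2)]
      using cN(2) by (rule mult_le_mono2)
    moreover have "card (F\<inverse>) = card F" by (rule card_inverse)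
    moreover have "card E \<le> card (T E) + (card F + (card (F\<inverse>) + (card (E \<inter> Nu \<times> UNIV) + card (E \<inter> UNIV \<times> Nv))))"
    proof -
      have "card E \<le> card (T E \<union> (F \<union> (F\<inverse> \<union> (E \<inter> Nu \<times> UNIV \<union> E \<inter> UNIV \<times> Nv))))"
        by (rule card_mono[OF _ sub]) (use \<open>finite (T E)\<close> F D(5) in auto)
      also have "\<dots> \<le> card (T E) + (card F + (card (F\<inverse>) + (card (E \<inter> Nu \<times> UNIV) + card (E \<inter> UNIV \<times> Nv))))"
        by (intro order_trans[OF card_Un_le] add_mono order_refl)
      finally show ?thesis .
    qed
    ultimately show "d * n - (2 * card F + 2 * (d * (d + 1))) \<le> card (T E)"
      using card_edges[OF E(1)] by linarith
  next
    fix E assume "E \<in> containing n d F"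
    then have E: "E \<in> regular_graphs n d" by (auto simp: containing_def)
    note D = regular_graphsD[OF E]
    show "finite (R E)" using D(6) by (auto simp: R_def)
    show "card (R E) \<le> d * d" using D(4)[of u] D(4)[of v] uv by (simp add: R_def card_cartesian_product)
  next
    fix E t assume EE: "E \<in> containing n d (insert (u, v) F)" and t: "t \<in> T E"
    obtain x y where xy: "t = (x, y)" by (cases t)
    have E: "E \<in> regular_graphs n d" "(u, v) \<in> E" "F \<subseteq> E" using EE by (auto simp: containing_def)
    have h: "(x, y) \<in> E" "(x, y) \<notin> F" "(y, x) \<notin> F" "x \<noteq> u" "(u, x) \<notin> E" "y \<noteq> v" "(v, y) \<notin> E"
      using t by (auto simp: T_def xy)
    note S = switch_regular[OF E(1,2) h(1,5) h(4)[symmetric] h(7) h(6)[symmetric]]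
    have "(v, u) \<notin> F" using F(2)[of v u] uv(2) by auto
    then have "F \<subseteq> switch E u v x y" using E(3) uv(1) h(2,3) by (auto simp: switch_def)
    moreover have "(u, x) \<in> switch E u v x y" "(v, y) \<in> switch E u v x y" by (auto simp: switch_def)
    ultimately show "(case t of (x, y) \<Rightarrow> switch E u v x y) \<in> containing n d F \<and>
       t \<in> R (case t of (x, y) \<Rightarrow> switch E u v x y) \<and>
       (case t of (x, y) \<Rightarrow> switch (case t of (x, y) \<Rightarrow> switch E u v x y) u x v y) = E"
      using S by (simp add: xy containing_def R_def)
  qed
qed

text \<open>The bound on \<open>card F\<close> keeps at least half of the \<open>d * n\<close> moves
  available, so each further edge costs a factor of at most
  \<open>d * d / (d * n / 2)\<close>.\<close>

lemma containing_bound: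
  assumes "finite F" "\<And>x y. (x, y) \<in> F \<Longrightarrow> x < y \<and> y < n" "4 * card F + 4 * (d * (d + 1)) \<le> d * n" "d > 0" "n > 0"
  shows "real (card (containing n d F)) \<le> (2 * real d / real n) ^ card F * real (card (regular_graphs n d))"
  using assms(1-3)
proof (induction F rule: finite_induct)
  case empty
  then show ?case by (simp add: containing_def)
next
  case (insert p F)
  obtain u v where p: "p = (u, v)" by (cases p)
  have uv: "u < v" "v < n" using insert.prems(1)[of u v] p by auto
  define a where "a = d * n - (2 * card F + 2 * (d * (d + 1)))"
  have cF: "card (insert p F) = Suc (card F)" using insert by simp
  have a: "d * n \<le> 2 * a" using insert.prems(2) cF unfolding a_def by linarith
  have cnt: "card (containing n d (insert p F)) * a \<le> card (containing n d F) * (d * d)"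
    unfolding a_def p
    by (rule containing_insert_count) (use insert p uv in auto)
  define x y where "x = real (card (containing n d (insert p F)))" and "y = real (card (containing n d F))"
  have "x * real (d * n) \<le> x * (2 * real a)" 
  proof (rule mult_left_mono)
    show "real (d * n) \<le> 2 * real a" using of_nat_mono[OF a, where 'a = real] by simp
  qed (simp add: x_def)
  also have "\<dots> = 2 * real (card (containing n d (insert p F)) * a)" by (simp add: x_def)
  also have "\<dots> \<le> 2 * real (card (containing n d F) * (d * d))" using cnt by (intro mult_left_mono) (auto simp only: of_nat_le_iff)
  finally have "x * (real d * real n) \<le> (2 * y * real d) * real d" by (simp add: y_def algebra_simps)
  then have "x * real n \<le> 2 * y * real d"
    using assms(4) by (simp add: algebra_simps)
  then have "x \<le> 2 * real d / real n * y" using assms(5) by (simp add: field_simps)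
  also have "\<dots> \<le> 2 * real d / real n * ((2 * real d / real n) ^ card F * real (card (regular_graphs n d)))"
    unfolding y_def by (intro mult_left_mono insert.IH) (use insert.prems cF in auto)
  finally show ?case unfolding x_def cF by (simp add: mult.assoc)
qed

text \<open>\<open>k ^ k / fact k\<close> is a single term of the series of
  \<open>exp k\<close>.\<close>

lemma power_self_le_fact: "real k ^ k \<le> 3 ^ k * fact k"
proof -
  have "(\<lambda>n. real k ^ n /\<^sub>R fact n) sums exp (real k)" by (rule exp_converges)
  then have s: "summable (\<lambda>n. real k ^ n /\<^sub>R fact n)" "suminf (\<lambda>n. real k ^ n /\<^sub>R fact n) = exp (real k)"
    by (auto simp: sums_iff)
  have "(\<Sum>n\<in>{k}. real k ^ n /\<^sub>R fact n) \<le> suminf (\<lambda>n. real k ^ n /\<^sub>R fact n)"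
    by (rule sum_le_suminf[OF s(1)]) auto
  then have "real k ^ k / fact k \<le> exp (real k)" using s(2) by (simp add: divide_inverse mult.commute)
  also have "exp (real k) = exp 1 ^ k" by (simp flip: exp_of_nat_mult)
  also have "\<dots> \<le> 3 ^ k" using exp_le by (intro power_mono) auto
  finally show ?thesis by (simp add: field_simps)
qed

lemma binomial_le_power:
  assumes "k > 0"
  shows "real (n choose k) \<le> (3 * real n / real k) ^ k"
proof -
  have "real (n choose k) * fact k \<le> real n ^ k"
    using binomial_fact_pow[of n k] by (metis of_nat_fact of_nat_le_iff of_nat_mult of_nat_power)
  then have "real (n choose k) * fact k * real k ^ k \<le> real n ^ k * (3 ^ k * fact k)"
    by (intro mult_mono power_self_le_fact) auto
  then have "real (n choose k) * real k ^ k \<le> real n ^ k * 3 ^ k"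
    by (simp add: mult.assoc mult.left_commute)
  then show ?thesis using assms by (simp add: field_simps power_mult_distrib power_divide)
qed

section \<open>Local sparsity of random regular graphs\<close>

text \<open>For \<open>y = s / n\<close> the size hypothesis says that
  \<open>d ^ (120 * d) * sqrt y \<le> 1\<close>. Because \<open>s \<le> 20 * d * (j + 1)\<close>,
  one half of the power \<open>y ^ (j + 1)\<close> absorbs \<open>d ^ (6 * s)\<close>, which
  explains \<open>240 = 2 * 6 * 20\<close>; the other half leaves \<open>sqrt y\<close> and with it
  \<open>1 / sqrt n\<close>. The spare factor \<open>d ^ s \<ge> 10 ^ s\<close> provides the decay
  \<open>(1 / 2) ^ s\<close> and pays for \<open>s \<le> 5 ^ s\<close>.\<close>

lemma dense_term_bound:
  assumes d: "d \<ge> 10" and s: "s \<ge> 1" and sj: "s \<le> 20 * d * (j + 1)" and n: "real s * real d ^ (240 * d) \<le> real n" "n > 0"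
  shows "real d ^ (5 * s) * (real s / real n) ^ (j + 1) \<le> (1 / 2) ^ s / sqrt (real n)"
proof -
  define a where "a = real d ^ (120 * d)"
  define y where "y = real s / real n"
  have d1: "real d \<ge> 1" using d by simp
  have a: "a \<ge> 1" unfolding a_def using d1 by (rule one_le_power)
  have y0: "y \<ge> 0" by (simp add: y_def)
  have "a\<^sup>2 = real d ^ (240 * d)" by (simp add: a_def flip: power_mult)
  then have "y * a\<^sup>2 \<le> 1" using n by (simp add: y_def field_simps)
  then have "sqrt (y * a\<^sup>2) \<le> 1" by simp
  then have ya: "sqrt y * a \<le> 1" using a by (simp add: real_sqrt_mult)
  have sy0: "sqrt y \<ge> 0" using y0 by simp
  have "sqrt y * 1 \<le> sqrt y * a" by (rule mult_left_mono[OF a sy0])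
  then have "sqrt y \<le> 1" using ya by linarith
  note sy = sy0 this
  have "real d ^ (6 * s) \<le> real d ^ (120 * d * (j + 1))"
    by (rule power_increasing[OF _ d1]) (use sj in simp)
  also have "\<dots> = a ^ (j + 1)" by (simp only: a_def power_mult)
  finally have "real d ^ (6 * s) * y ^ (j + 1) \<le> a ^ (j + 1) * y ^ (j + 1)"
    using y0 by (intro mult_right_mono) auto
  also have "\<dots> = (a * y) ^ (j + 1)" by (simp add: power_mult_distrib)
  also have "\<dots> \<le> sqrt y ^ (j + 1)"
  proof (rule power_mono)
    have "a * y = (sqrt y * a) * sqrt y" using y0 by (simp add: algebra_simps)
    also have "\<dots> \<le> 1 * sqrt y" by (rule mult_right_mono[OF ya sy(1)])
    finally show "a * y \<le> sqrt y" by simp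
  qed (use a y0 in auto)
  also have "\<dots> \<le> sqrt y" using sy power_decreasing[of 1 "j + 1" "sqrt y"] by simp
  finally have 1: "real d ^ (6 * s) * y ^ (j + 1) \<le> sqrt y" .
  have "sqrt y = sqrt (real s) / sqrt (real n)" by (simp add: y_def real_sqrt_divide)
  also have "\<dots> \<le> real s / sqrt (real n)"
  proof (rule divide_right_mono)
    have "real s \<le> (real s)\<^sup>2" using s by (simp add: power2_eq_square)
    then show "sqrt (real s) \<le> real s" by (simp add: real_le_lsqrt)
  qed simp
  also have "\<dots> \<le> 5 ^ s / sqrt (real n)"
  proof (rule divide_right_mono)
    have "real s \<le> 2 ^ s" using of_nat_less_two_power[of s, where 'a = real] by simp
    also have "\<dots> \<le> (5::real) ^ s" by (rule power_mono) auto
    finally show "real s \<le> 5 ^ s" .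
  qed simp
  finally have 2: "sqrt y \<le> 5 ^ s / sqrt (real n)" .
  have "2 ^ s * real d ^ (5 * s) * y ^ (j + 1) * 5 ^ s = 10 ^ s * real d ^ (5 * s) * y ^ (j + 1)"
    by (simp flip: power_mult_distrib add: mult.commute mult.left_commute)
  also have "\<dots> \<le> real d ^ s * real d ^ (5 * s) * y ^ (j + 1)"
    using d y0 by (intro mult_right_mono power_mono) auto
  also have "\<dots> = real d ^ (6 * s) * y ^ (j + 1)" by (simp flip: power_add)
  also have "\<dots> \<le> 5 ^ s / sqrt (real n)" using 1 2 by simp
  finally have "2 ^ s * real d ^ (5 * s) * y ^ (j + 1) * 5 ^ s \<le> 1 / sqrt (real n) * 5 ^ s" by simp
  then have "2 ^ s * real d ^ (5 * s) * y ^ (j + 1) \<le> 1 / sqrt (real n)"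
    by (rule mult_right_le_imp_le) simp
  then have "(1 / 2) ^ s * (2 ^ s * real d ^ (5 * s) * y ^ (j + 1)) \<le> (1 / 2) ^ s * (1 / sqrt (real n))"
    by (rule mult_left_mono) simp
  moreover have "(1 / 2) ^ s * (2 ^ s * real d ^ (5 * s) * y ^ (j + 1)) = real d ^ (5 * s) * y ^ (j + 1)"
    by (simp add: power_one_over)
  ultimately show ?thesis
    unfolding y_def[symmetric] by (simp only: mult_1_right times_divide_eq_right)
qed

definition increasing_pairs :: "nat set \<Rightarrow> (nat \<times> nat) set" where
  "increasing_pairs S = {(u, v) \<in> S \<times> S. u < v}"

lemma card_increasing_pairs:
  assumes "finite S"
  shows "2 * card (increasing_pairs S) \<le> card S * card S"
proof -
  let ?P = "increasing_pairs S"
  have fin: "finite ?P" by (rule finite_subset[of _ "S \<times> S"]) (use assms in \<open>auto simp: increasing_pairs_def\<close>)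
  have "card (?P \<union> ?P\<inverse>) = card ?P + card (?P\<inverse>)"
    by (rule card_Un_disjoint) (use fin in \<open>auto simp: increasing_pairs_def\<close>)
  moreover have "card (?P \<union> ?P\<inverse>) \<le> card (S \<times> S)"
    by (rule card_mono) (use assms in \<open>auto simp: increasing_pairs_def\<close>)
  ultimately show ?thesis by (simp add: card_inverse card_cartesian_product)
qed

lemma card_edges_within:
  assumes "sym E" "irrefl E" "finite S"
  shows "card (E \<inter> S \<times> S) = 2 * card (E \<inter> increasing_pairs S)"
proof -
  let ?P = "E \<inter> increasing_pairs S"
  have fin: "finite ?P" by (rule finite_subset[of _ "S \<times> S"]) (use assms in \<open>auto simp: increasing_pairs_def\<close>)
  have "E \<inter> S \<times> S = ?P \<union> ?P\<inverse>"
  proof -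
    have "u < v \<or> v < u" if "(u, v) \<in> E" for u v :: nat
      using that assms(2) by (metis irrefl_def linorder_neqE_nat)
    then show ?thesis using assms(1) by (auto simp: increasing_pairs_def dest: symD)
  qed
  then have "card (E \<inter> S \<times> S) = card (?P \<union> ?P\<inverse>)" by simp
  also have "\<dots> = card ?P + card (?P\<inverse>)"
    by (rule card_Un_disjoint) (use fin in \<open>auto simp: increasing_pairs_def\<close>)
  finally show ?thesis by (simp add: card_inverse)
qed

lemma card_UN_le_bound:
  assumes "finite I" "\<And>i. i \<in> I \<Longrightarrow> real (card (A i)) \<le> b"
  shows "real (card (\<Union>i\<in>I. A i)) \<le> real (card I) * b"
proof -
  have "real (card (\<Union>i\<in>I. A i)) \<le> real (\<Sum>i\<in>I. card (A i))"
    using card_UN_le[OF assms(1)] by (simp only: of_nat_le_iff)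
  also have "\<dots> \<le> (\<Sum>i\<in>I. b)" unfolding of_nat_sum by (rule sum_mono) (rule assms(2))
  finally show ?thesis by simp
qed

text \<open>A union bound over vertex sets \<open>S\<close> and over sets of edges inside
  \<open>S\<close> that already witness too high a density. The terms decay like
  \<open>(1 / 2) ^ s\<close>, so summing over all sizes up to \<open>K\<close> costs no more than a
  factor 1.\<close>

lemma not_locally_sparse_bound:
  assumes d: "d \<ge> 10" and n: "n \<ge> 8 * d" and K: "real K * real d ^ (240 * d) \<le> real n"
  shows "real (card {E \<in> regular_graphs n d. \<not> locally_sparse n E (20 * d) K})
     \<le> real (card (regular_graphs n d)) / sqrt (real n)"
proof -
  let ?reg = "regular_graphs n d"
  let ?R = "real (card ?reg)"
  \<comment> \<open>The least integer above \<open>(1 + 1 / (20 * d)) * s\<close>, that is, the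
    fewest edges a violating set of size \<open>s\<close> can have.\<close>
  define t where "t = (\<lambda>s. s + s div (20 * d) + 1)"
  define Ss where "Ss = (\<lambda>s. {S. S \<subseteq> {0..<n} \<and> card S = s})"
  define Fs where "Fs = (\<lambda>s S. {F. F \<subseteq> increasing_pairs S \<and> card F = t s})"
  let ?C = "\<lambda>s. \<Union>S\<in>Ss s. \<Union>F\<in>Fs s S. containing n d F"
  define bad where "bad = {E \<in> ?reg. \<not> locally_sparse n E (20 * d) K}"
  have n0: "n > 0" using d n by simp
  have sub: "bad \<subseteq> (\<Union>s\<in>{1..K}. ?C s)"
  proof
    fix E assume "E \<in> bad"
    then obtain S where E: "E \<in> ?reg" and S: "S \<subseteq> {0..<n}" "card S \<le> K"
      "\<not> 20 * d * card (E \<inter> S \<times> S) \<le> 2 * (20 * d + 1) * card S"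
      by (auto simp: bad_def locally_sparse_def)
    note D = regular_graphsD[OF E]
    have finS: "finite S" using S(1) by (rule finite_subset) simp
    define e where "e = card (E \<inter> increasing_pairs S)"
    have "20 * d * card (E \<inter> S \<times> S) = 2 * (20 * d * e)"
      using card_edges_within[OF D(2,3) finS] by (simp add: e_def)
    then have dens: "(20 * d + 1) * card S < 20 * d * e" using S(3) by linarith
    have "card S \<noteq> 0"
    proof
      assume "card S = 0"
      then have "S = {}" using finS by simp
      then show False using dens by (simp add: e_def increasing_pairs_def)
    qed
    then have s: "card S \<in> {1..K}" using S(2) by auto
    have "t (card S) \<le> e"
    proof (rule ccontr)
      assume "\<not> ?thesis"
      then have "e \<le> card S + card S div (20 * d)" by (simp add: t_def)
      then have "20 * d * e \<le> 20 * d * (card S + card S div (20 * d))" by (rule mult_le_mono2)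
      also have "\<dots> = 20 * d * card S + 20 * d * (card S div (20 * d))" by (rule distrib_left)
      also have "\<dots> \<le> 20 * d * card S + card S" by (simp add: mult.commute)
      finally show False using dens by (simp add: algebra_simps)
    qed
    then obtain F where F: "F \<subseteq> E \<inter> increasing_pairs S" "card F = t (card S)"
      using obtain_subset_with_card_n[of "t (card S)" "E \<inter> increasing_pairs S"] unfolding e_def by blast
    have "E \<in> containing n d F" using E F by (auto simp: containing_def)
    moreover have "F \<in> Fs (card S) S" using F by (auto simp: Fs_def)
    moreover have "S \<in> Ss (card S)" using S by (auto simp: Ss_def)
    ultimately show "E \<in> (\<Union>s\<in>{1..K}. ?C s)" using s by blast
  qed
  have finSs: "finite (Ss s)" for s
    by (rule finite_subset[of _ "Pow {0..<n}"]) (auto simp: Ss_def)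
  have per_s: "real (card (?C s)) \<le> (1 / 2) ^ s * (?R / sqrt (real n))"
    if s: "s \<in> {1..K}" for s
  proof -
    define j where "j = s div (20 * d)"
    have s1: "s \<ge> 1" "s \<le> K" using s by auto
    have ts: "t s = s + (j + 1)" by (simp add: t_def j_def)
    have jle: "j \<le> s" by (simp add: j_def)
    have sj: "s \<le> 20 * d * (j + 1)"
    proof -
      have "s mod (20 * d) < 20 * d" using d by simp
      moreover have "s = 20 * d * j + s mod (20 * d)" by (simp add: j_def)
      ultimately have "s < 20 * d * j + 20 * d" by linarith
      then show ?thesis by simp
    qed
    have sK: "real s * real d ^ (240 * d) \<le> real n"
    proof -
      have "real s * real d ^ (240 * d) \<le> real K * real d ^ (240 * d)" using s1 by (intro mult_right_mono) auto
      then show ?thesis using K by simp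
    qed
    have "100 * real s \<le> real n"
    proof -
      have "(100::real) = 10 ^ 2" by simp
      also have "\<dots> \<le> real d ^ 2" using d by (intro power_mono) auto
      also have "\<dots> \<le> real d ^ (240 * d)" using d by (intro power_increasing) auto
      finally have "real s * 100 \<le> real s * real d ^ (240 * d)" by (intro mult_left_mono) auto
      then show ?thesis using sK by simp
    qed
    then have ns: "100 * s \<le> n" by linarith
    have tsmall: "4 * t s + 4 * (d * (d + 1)) \<le> d * n"
    proof -
      have 1: "d * (8 * d) \<le> d * n" using n by (rule mult_le_mono2)
      then have 1: "8 * (d * d) \<le> d * n" by simp
      have 2: "10 * n \<le> d * n" using d by (rule mult_le_mono1)
      have 3: "10 * d \<le> d * d" using d by (rule mult_le_mono1)
      have "4 * t s \<le> 12 * s" using jle s1 by (simp add: ts)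
      moreover have "4 * (d * (d + 1)) = 4 * (d * d) + 4 * d" by simp
      ultimately show ?thesis using 1 2 3 ns by linarith
    qed
    have cF: "real (card (containing n d F)) \<le> (2 * real d / real n) ^ t s * ?R"
      if "S \<in> Ss s" "F \<in> Fs s S" for S F
    proof -
      have "finite S" using that by (auto simp: Ss_def intro: finite_subset)
      then have "finite (increasing_pairs S)"
        by (intro finite_subset[of "increasing_pairs S" "S \<times> S"]) (auto simp: increasing_pairs_def)
      then have "finite F" using that by (auto simp: Fs_def intro: finite_subset)
      moreover have "x < y \<and> y < n" if "(x, y) \<in> F" for x y
        using that \<open>S \<in> Ss s\<close> \<open>F \<in> Fs s S\<close> by (auto simp: Ss_def Fs_def increasing_pairs_def)
      moreover have "card F = t s" using that by (simp add: Fs_def)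
      ultimately show ?thesis using containing_bound[of F n d] tsmall d n0 by simp
    qed
    define y where "y = real s / real n"
    have y0: "y > 0" using s1 n0 by (simp add: y_def)
    have cFs: "real (card (Fs s S)) \<le> (3 * real s / 2) ^ t s" if "S \<in> Ss s" for S
    proof -
      have S: "finite S" "card S = s" using that by (auto simp: Ss_def intro: finite_subset)
      have finP: "finite (increasing_pairs S)"
        by (rule finite_subset[of _ "S \<times> S"]) (use S in \<open>auto simp: increasing_pairs_def\<close>)
      have tpos: "t s > 0" by (simp add: t_def)
      have "card (Fs s S) = card (increasing_pairs S) choose t s"
        unfolding Fs_def by (rule n_subsets[OF finP])
      then have "real (card (Fs s S)) \<le> (3 * real (card (increasing_pairs S)) / real (t s)) ^ t s"
        using binomial_le_power[OF tpos] by simp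
      also have "\<dots> \<le> (3 * real s / 2) ^ t s"
      proof (rule power_mono)
        have "real (2 * card (increasing_pairs S)) \<le> real (s * s)"
          using card_increasing_pairs[OF S(1)] S(2) by (simp only: of_nat_le_iff)
        then have "2 * (3 * real (card (increasing_pairs S))) \<le> 3 * real s * real s" by simp
        also have "\<dots> \<le> 3 * real s * real (t s)" by (intro mult_left_mono) (auto simp: t_def)
        finally show "3 * real (card (increasing_pairs S)) / real (t s) \<le> 3 * real s / 2"
          using tpos by (simp add: field_simps)
      qed simp
      finally show ?thesis .
    qed
    have finFs: "finite (Fs s S)" if "S \<in> Ss s" for S
    proof -
      have "finite S" using that by (auto simp: Ss_def intro: finite_subset)
      then show ?thesis
        by (intro finite_subset[of "Fs s S" "Pow (S \<times> S)"]) (auto simp: Fs_def increasing_pairs_def)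
    qed
    have "card (Ss s) = n choose s" unfolding Ss_def using n_subsets[of "{0..<n}" s] by simp
    then have cSs: "real (card (Ss s)) \<le> (3 * real n / real s) ^ s" using binomial_le_power[of s n] s1 by simp
    have inner: "real (card (\<Union>F\<in>Fs s S. containing n d F)) \<le>
        (3 * real s / 2) ^ t s * ((2 * real d / real n) ^ t s * ?R)" if "S \<in> Ss s" for S
    proof -
      have "real (card (\<Union>F\<in>Fs s S. containing n d F)) \<le>
          real (card (Fs s S)) * ((2 * real d / real n) ^ t s * ?R)"
        by (rule card_UN_le_bound[OF finFs[OF that] cF[OF that]])
      also have "\<dots> \<le> (3 * real s / 2) ^ t s * ((2 * real d / real n) ^ t s * ?R)"
        by (rule mult_right_mono[OF cFs[OF that]]) simp
      finally show ?thesis .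
    qed
    have "real (card (?C s)) \<le>
        real (card (Ss s)) * ((3 * real s / 2) ^ t s * ((2 * real d / real n) ^ t s * ?R))"
      by (rule card_UN_le_bound[OF finSs inner])
    also have "\<dots> \<le> (3 * real n / real s) ^ s * ((3 * real s / 2) ^ t s * ((2 * real d / real n) ^ t s * ?R))"
      by (rule mult_right_mono[OF cSs]) simp
    \<comment> \<open>The choice of vertices contributes \<open>y ^ (- s)\<close> and the edges
      contribute \<open>y ^ t s\<close>; what survives is \<open>y\<close> to the surplus
      \<open>j + 1\<close> of edges over vertices.\<close>
    also have "\<dots> = ((3 / y) ^ s * (3 * real d * y) ^ t s) * ?R"
    proof -
      have "(3 * real s / 2) ^ t s * (2 * real d / real n) ^ t s = (3 * real d * y) ^ t s"
        unfolding power_mult_distrib[symmetric] by (rule arg_cong[where f = "\<lambda>x. x ^ t s"]) (simp add: y_def)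
      moreover have "3 * real n / real s = 3 / y" by (simp add: y_def)
      ultimately show ?thesis by (simp add: mult.assoc)
    qed
    also have "\<dots> \<le> (real d ^ (5 * s) * y ^ (j + 1)) * ?R"
    proof (rule mult_right_mono)
      have "(3 / y) ^ s * (3 * real d * y) ^ t s = 3 ^ s * (3 * real d) ^ t s * y ^ (j + 1)"
        using y0 by (simp add: ts power_add power_mult_distrib power_divide)
      also have "\<dots> \<le> 3 ^ s * (3 * real d) ^ (3 * s) * y ^ (j + 1)"
        using y0 d jle s1 by (intro mult_right_mono mult_left_mono power_increasing) (auto simp: ts)
      also have "3 ^ s * (3 * real d) ^ (3 * s) = (81 * real d ^ 3) ^ s"
      proof -
        have "3 * (3 * real d) ^ 3 = 81 * real d ^ 3" by (simp add: power_mult_distrib)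
        moreover have "3 ^ s * (3 * real d) ^ (3 * s) = (3 * (3 * real d) ^ 3) ^ s"
          by (simp only: power_mult power_mult_distrib)
        ultimately show ?thesis by simp
      qed
      also have "(81 * real d ^ 3) ^ s \<le> (real d ^ 5) ^ s"
      proof (rule power_mono)
        have "81 \<le> (10::real) ^ 2" by simp
        also have "\<dots> \<le> real d ^ 2" using d by (intro power_mono) auto
        finally have "81 * real d ^ 3 \<le> real d ^ 2 * real d ^ 3" by (intro mult_right_mono) auto
        then show "81 * real d ^ 3 \<le> real d ^ 5" by (simp flip: power_add)
      qed simp
      finally show "(3 / y) ^ s * (3 * real d * y) ^ t s \<le> real d ^ (5 * s) * y ^ (j + 1)"
        using y0 by (simp add: power_mult mult_right_mono)
    qed simp
    also have "\<dots> \<le> ((1 / 2) ^ s / sqrt (real n)) * ?R"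
      unfolding y_def by (rule mult_right_mono[OF dense_term_bound[OF d s1(1) sj sK n0]]) simp
    finally show ?thesis by simp
  qed
  have "real (card bad) \<le> real (card (\<Union>s\<in>{1..K}. ?C s))"
  proof -
    have "(\<Union>s\<in>{1..K}. ?C s) \<subseteq> ?reg" by (auto simp: containing_def)
    then have "finite (\<Union>s\<in>{1..K}. ?C s)"
      using finite_regular_graphs by (rule finite_subset)
    then show ?thesis using card_mono[OF _ sub] by simp
  qed
  also have "\<dots> \<le> real (\<Sum>s\<in>{1..K}. card (?C s))"
    unfolding of_nat_le_iff by (rule card_UN_le) simp
  also have "\<dots> \<le> (\<Sum>s\<in>{1..K}. (1 / 2) ^ s * (?R / sqrt (real n)))"
    unfolding of_nat_sum by (rule sum_mono) (rule per_s)
  also have "\<dots> = (\<Sum>s\<in>{1..K}. (1 / 2) ^ s) * (?R / sqrt (real n))"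
    by (simp only: sum_distrib_right)
  also have "\<dots> \<le> 1 * (?R / sqrt (real n))"
  proof (rule mult_right_mono)
    have "(\<Sum>s\<in>{1..K}. (1 / 2::real) ^ s) = 1 - (1 / 2) ^ K" by (induction K) auto
    then show "(\<Sum>s\<in>{1..K}. (1 / 2::real) ^ s) \<le> 1" by simp
  qed simp
  finally show ?thesis by (simp add: bad_def)
qed

section \<open>Independent sets in random regular graphs\<close>

text \<open>The count is of ordered pairs, so one more edge inside \<open>S\<close> raises
  \<open>i\<close> by 2.\<close>

definition with_inner :: "nat \<Rightarrow> nat \<Rightarrow> nat set \<Rightarrow> nat \<Rightarrow> (nat \<times> nat) set set" where
  "with_inner n d S i = {E \<in> regular_graphs n d. card (E \<inter> S \<times> S) = i}"

lemma card_edges_across: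
  assumes E: "E \<in> regular_graphs n d" and S: "S \<subseteq> {0..<n}"
  shows "card (E \<inter> S \<times> ({0..<n} - S)) + card (E \<inter> S \<times> S) = d * card S"
proof -
  note D = regular_graphsD[OF E]
  have "E \<inter> S \<times> UNIV = E \<inter> S \<times> ({0..<n} - S) \<union> E \<inter> S \<times> S" using D(1) by auto
  moreover have "card (E \<inter> S \<times> ({0..<n} - S) \<union> E \<inter> S \<times> S) =
      card (E \<inter> S \<times> ({0..<n} - S)) + card (E \<inter> S \<times> S)"
    by (rule card_Un_disjoint) (use D(5) in auto)
  ultimately show ?thesis using card_edges_from[OF E S] by simp
qed

text \<open>Two edges \<open>ux\<close> and \<open>vy\<close> leaving \<open>S\<close> are replaced
  by \<open>uv\<close> inside and \<open>xy\<close> outside. \<open>B E p\<close> collects the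
  second edges that would create a loop or a double edge. A reverse move chooses an oriented edge
  inside \<open>S\<close> and one inside the complement; the last factor counts the latter.\<close>

lemma inner_switching_count:
  assumes S: "S \<subseteq> {0..<n}"
  shows "card (with_inner n d S i) * ((d * card S - i) * (d * card S - i - 2 * (d * (d + 1)))) \<le>
    card (with_inner n d S (i + 2)) * ((i + 2) * (d * (n - card S) - (d * card S - (i + 2))))"
proof -
  define C where "C = {0..<n} - S"
  define O' where "O' = (\<lambda>E::(nat \<times> nat) set. E \<inter> S \<times> C)"
  define B where "B = (\<lambda>E (p :: nat \<times> nat). E \<inter> insert (fst p) {w. (fst p, w) \<in> E} \<times> UNIV \<union>
      E \<inter> UNIV \<times> insert (snd p) {w. (snd p, w) \<in> E})"
  define T where "T = (\<lambda>E. SIGMA p:O' E. O' E - B E p)"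
  define R where "R = (\<lambda>E::(nat \<times> nat) set. (\<lambda>((u, v), (x, y)). ((u, x), (v, y))) ` ((E \<inter> S \<times> S) \<times> (E \<inter> C \<times> C)))"
  define \<phi> where "\<phi> = (\<lambda>E (t :: (nat \<times> nat) \<times> nat \<times> nat).
      switch E (fst (fst t)) (snd (fst t)) (fst (snd t)) (snd (snd t)))"
  define \<psi> where "\<psi> = (\<lambda>E (t :: (nat \<times> nat) \<times> nat \<times> nat).
      switch E (fst (fst t)) (fst (snd t)) (snd (fst t)) (snd (snd t)))"
  have CV: "C \<subseteq> {0..<n}" by (auto simp: C_def)
  have finS: "finite S" using S by (rule finite_subset) simp
  show ?thesis
  proof (rule switching_count[where T = T and R = R
        and \<phi> = \<phi> and \<psi> = \<psi>])
    show "finite (with_inner n d S i)" "finite (with_inner n d S (i + 2))"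
      using finite_regular_graphs by (auto simp: with_inner_def)
  next
    fix E assume "E \<in> with_inner n d S i"
    then have E: "E \<in> regular_graphs n d" "card (E \<inter> S \<times> S) = i" by (auto simp: with_inner_def)
    note D = regular_graphsD[OF E(1)]
    have finO: "finite (O' E)" using D(5) by (auto simp: O'_def)
    then show "finite (T E)" by (auto simp: T_def)
    have cO: "card (O' E) = d * card S - i" using card_edges_across[OF E(1) S] E(2) by (simp add: O'_def C_def)
    have cB: "card (B E p) \<le> 2 * (d * (d + 1))" if p: "p \<in> O' E" for p
    proof -
      have lt: "fst p < n" "snd p < n" using p D(1) by (auto simp: O'_def)
      have sub: "insert w {x. (w, x) \<in> E} \<subseteq> {0..<n}" if "w < n" for w using D(1) that by auto
      have "card (insert w {x. (w, x) \<in> E}) \<le> d + 1" if "w < n" for w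
        using D(4)[OF that] D(6) by (auto simp: card_insert_if)
      then have le: "card (E \<inter> insert w {x. (w, x) \<in> E} \<times> UNIV) \<le> d * (d + 1)" if "w < n" for w
        unfolding card_edges_from[OF E(1) sub[OF that]] using that by (intro mult_le_mono2) auto
      have "card (B E p) \<le> card (E \<inter> insert (fst p) {w. (fst p, w) \<in> E} \<times> UNIV) +
          card (E \<inter> UNIV \<times> insert (snd p) {w. (snd p, w) \<in> E})"
        unfolding B_def by (rule card_Un_le)
      also have "card (E \<inter> UNIV \<times> insert (snd p) {w. (snd p, w) \<in> E}) =
          card (E \<inter> insert (snd p) {w. (snd p, w) \<in> E} \<times> UNIV)"
        by (rule card_edges_swap[OF D(2)])
      finally show ?thesis using le[OF lt(1)] le[OF lt(2)] by linarith
    qed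
    have "card (T E) = (\<Sum>p\<in>O' E. card (O' E - B E p))" using finO by (simp add: T_def)
    moreover have "(\<Sum>p\<in>O' E. d * card S - i - 2 * (d * (d + 1))) \<le> (\<Sum>p\<in>O' E. card (O' E - B E p))"
    proof (rule sum_mono)
      fix p assume p: "p \<in> O' E"
      have "finite (B E p)" using D(5) by (auto simp: B_def)
      then have "card (O' E) - card (B E p) \<le> card (O' E - B E p)" by (rule diff_card_le_card_Diff)
      then show "d * card S - i - 2 * (d * (d + 1)) \<le> card (O' E - B E p)" using cB[OF p] cO by linarith
    qed
    ultimately show "(d * card S - i) * (d * card S - i - 2 * (d * (d + 1))) \<le> card (T E)"
      by (simp add: cO)
  next
    fix E assume "E \<in> with_inner n d S (i + 2)"
    then have E: "E \<in> regular_graphs n d" "card (E \<inter> S \<times> S) = i + 2" by (auto simp: with_inner_def)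
    note D = regular_graphsD[OF E(1)]
    show "finite (R E)" using D(5) by (auto simp: R_def)
    have "card (E \<inter> C \<times> C) = d * (n - card S) - (d * card S - (i + 2))"
    proof -
      have "{0..<n} - C = S" using S by (auto simp: C_def)
      then have "card (E \<inter> C \<times> S) + card (E \<inter> C \<times> C) = d * card C"
        using card_edges_across[OF E(1) CV] by simp
      moreover have "card (E \<inter> C \<times> S) = d * card S - (i + 2)"
        using card_edges_across[OF E(1) S] E(2) card_edges_swap[OF D(2), of C S] by (simp add: C_def)
      moreover have "card C = n - card S" unfolding C_def using card_Diff_subset[OF finS S] by simp
      ultimately show ?thesis by simp
    qed
    moreover have "card (R E) \<le> card ((E \<inter> S \<times> S) \<times> (E \<inter> C \<times> C))"
      unfolding R_def by (rule card_image_le) (use D(5) in auto)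
    ultimately show "card (R E) \<le> (i + 2) * (d * (n - card S) - (d * card S - (i + 2)))"
      by (simp add: card_cartesian_product E(2))
  next
    fix E t assume EE: "E \<in> with_inner n d S i" and t: "t \<in> T E"
    have E: "E \<in> regular_graphs n d" "card (E \<inter> S \<times> S) = i" using EE by (auto simp: with_inner_def)
    note D = regular_graphsD[OF E(1)]
    obtain u x v y where tt: "t = ((u, x), (v, y))" by (metis surj_pair)
    have h: "(u, x) \<in> E" "u \<in> S" "x \<in> C" "(v, y) \<in> E" "v \<in> S" "y \<in> C" "(u, v) \<notin> E" "u \<noteq> v" "(x, y) \<notin> E" "x \<noteq> y"
      using t by (auto simp: T_def tt O'_def B_def)
    note Sw = switch_regular[OF E(1) h(1,4,7,8,9,10)]
    let ?E = "switch E u x v y"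
    have nS: "x \<notin> S" "y \<notin> S" using h by (auto simp: C_def)
    have vu: "(v, u) \<notin> E" using h(7) D(2) by (auto dest: symD)
    have "?E \<inter> S \<times> S = insert (u, v) (insert (v, u) (E \<inter> S \<times> S))"
      using nS h(2,5) by (auto simp: switch_def)
    then have "card (?E \<inter> S \<times> S) = i + 2" using E(2) vu h(7,8) D(5) by simp
    then have 1: "?E \<in> with_inner n d S (i + 2)" using Sw by (simp add: with_inner_def)
    have "((u, v), (x, y)) \<in> (?E \<inter> S \<times> S) \<times> (?E \<inter> C \<times> C)" using h by (auto simp: switch_def)
    then have 2: "t \<in> R ?E" unfolding R_def tt by (rule rev_image_eqI) simp
    show "\<phi> E t \<in> with_inner n d S (i + 2) \<and> t \<in> R (\<phi> E t) \<and> \<psi> (\<phi> E t) t = E"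
      using 1 2 Sw(2) by (simp add: tt \<phi>_def \<psi>_def)
  qed
qed

text \<open>The factor 1/2 matters: it leads to a decay of \<open>4 ^ (- J)\<close>, and 4 exceeds
  the base of the natural logarithm, whereas the plain bound \<open>J ^ J\<close> would only lead to
  \<open>2 ^ (- J)\<close>. The step of the induction is Bernoulli's inequality.\<close>

lemma fact_le_half_power: "fact J \<le> ((real J + 1) / 2) ^ J"
proof (induction J)
  case (Suc J)
  have b: "2 \<le> (1 + 1 / (real J + 1)) ^ (J + 1)"
    using Bernoulli_inequality[of "1 / (real J + 1)" "J + 1"] by (simp add: field_simps)
  have "fact (Suc J) = (real J + 1) * fact J" by (simp add: algebra_simps)
  also have "\<dots> \<le> (real J + 1) * ((real J + 1) / 2) ^ J" by (rule mult_left_mono[OF Suc]) simp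
  also have "\<dots> = 2 * ((real J + 1) / 2) ^ (J + 1)" by simp
  also have "\<dots> \<le> (1 + 1 / (real J + 1)) ^ (J + 1) * ((real J + 1) / 2) ^ (J + 1)"
    by (intro mult_right_mono b) simp
  also have "\<dots> = ((1 + 1 / (real J + 1)) * ((real J + 1) / 2)) ^ (J + 1)" by (simp only: power_mult_distrib)
  also have "(1 + 1 / (real J + 1)) * ((real J + 1) / 2) = (real (Suc J) + 1) / 2" by (simp add: field_simps)
  finally show ?case by simp
qed simp

text \<open>Here \<open>a = d * s\<close>, \<open>N = d * n\<close>, \<open>z\<close> is the current
  value of \<open>i\<close>, and \<open>B\<close> bounds the excluded moves. The complement spans
  only about \<open>N - 2 * a\<close> oriented edges, which yields a gain of
  \<open>2 * a ^ 3\<close>. It is spent in full: \<open>a ^ 3\<close> on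
  \<open>2 * N * a * z\<close>, a quarter of that on \<open>a ^ 2 * z\<close>, and three quarters on
  the terms with \<open>B\<close> and 2.\<close>

lemma inner_ratio_arith:
  fixes a N z B :: real
  assumes a: "a > 0" and N: "N > 0" and z: "0 \<le> z" "2 * N * z \<le> a\<^sup>2" and aN: "2 * a \<le> N"
    and B: "0 \<le> B" "4 * (N * B + 2 * a) \<le> 3 * a\<^sup>2"
  shows "a\<^sup>2 * (N - 2 * a + z + 2) \<le> N * ((a - z) * (a - z - B))"
proof -
  have "4 * a * z \<le> 2 * N * z" using aN z(1) by (intro mult_right_mono) auto
  then have "a * (4 * z) \<le> a * a" using z(2) by (simp add: power2_eq_square)
  then have za: "4 * z \<le> a" using a by simp
  have 1: "a * (2 * N * z) \<le> a * a\<^sup>2" using z(2) a by (intro mult_left_mono) auto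
  have 2: "a\<^sup>2 * (4 * z) \<le> a\<^sup>2 * a" using za by (intro mult_left_mono) auto
  have 3: "a * (4 * (N * B + 2 * a)) \<le> a * (3 * a\<^sup>2)" using B(2) a by (intro mult_left_mono) auto
  have 4: "0 \<le> N * z\<^sup>2" "0 \<le> N * (B * z)" using N z B by auto
  have "N * ((a - z) * (a - z - B)) - a\<^sup>2 * (N - 2 * a + z + 2) =
     (2 * (a * a\<^sup>2) - a * (2 * N * z) - a\<^sup>2 * z - a * (N * B + 2 * a)) + N * z\<^sup>2 + N * (B * z)"
    by (simp add: algebra_simps power2_eq_square)
  moreover have "a * a\<^sup>2 = a\<^sup>2 * a" by simp
  ultimately show ?thesis using 1 2 3 4 by (simp only: mult.assoc)
qed

lemma ln_ge_2:
  assumes "d \<ge> 10"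
  shows "ln (real d) \<ge> 2"
proof -
  have "exp (2::real) = exp 1 * exp 1" by (simp flip: exp_add)
  also have "\<dots> \<le> 3 * 3" using exp_le by (intro mult_mono) auto
  also have "\<dots> \<le> real d" using assms by simp
  finally show ?thesis using assms by (subst ln_ge_iff) auto
qed

text \<open>\<open>\<mu>\<close> is about the mean number of edges inside \<open>S\<close>. The
  switchings show that the classes with \<open>j\<close> inner edges grow at least like the Poisson
  weights \<open>\<mu> ^ j / fact j\<close> while \<open>j \<le> \<mu> / 2\<close>. Comparing the
  class without inner edges with the class at \<open>J\<close>, close to \<open>\<mu> / 2\<close>,
  bounds its share by \<open>4 ^ (- J)\<close>.\<close>

lemma independent_set_bound:
  assumes d: "d \<ge> 10" and S: "S \<subseteq> {0..<n}" "card S = s" and sn: "2 * s \<le> n"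
    and s: "4 * real n * ln (real d) \<le> real d * real s" and n: "d ^ 3 \<le> n"
  shows "real (card (with_inner n d S 0)) * real d ^ s \<le> 16 * real (card (regular_graphs n d))"
    (is "_ \<le> 16 * ?R")
proof -
  define a N \<mu> B where "a = real d * real s" and "N = real d * real n"
    and "\<mu> = a\<^sup>2 / (2 * N)" and "B = 2 * (real d * (real d + 1))"
  define G where "G = (\<lambda>i. real (card (with_inner n d S i)))"
  note ln2 = ln_ge_2[OF d]
  have d1: "real d \<ge> 10" using d by simp
  have d3: "10 * real d ^ 2 \<le> real d ^ 3"
    using mult_right_mono[OF d1, of "real d ^ 2"] by (simp add: power3_eq_cube power2_eq_square)
  have d2: "10 * real d \<le> real d ^ 2"
    using mult_right_mono[OF d1, of "real d"] by (simp add: power2_eq_square)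
  have n3: "real d ^ 3 \<le> real n" using n by (metis of_nat_le_iff of_nat_power)
  have "10 ^ 3 \<le> d ^ 3" using d by (rule power_mono) simp
  then have n0: "n > 0" using n by simp
  have N0: "N > 0" using n0 d by (simp add: N_def)
  have an: "8 * real n \<le> a"
  proof -
    have "4 * real n * 2 \<le> 4 * real n * ln (real d)" using ln2 by (intro mult_left_mono) auto
    then show ?thesis using s by (simp add: a_def)
  qed
  have a0: "a > 0" using an n0 by simp
  have aN: "2 * a \<le> N"
  proof -
    have "real d * real (2 * s) \<le> real d * real n" using sn by (intro mult_left_mono) (auto simp only: of_nat_le_iff)
    then show ?thesis by (simp add: a_def N_def)
  qed
  have B0: "B \<ge> 0" by (simp add: B_def)
  have aB: "4 * (N * B + 2 * a) \<le> 3 * a\<^sup>2"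
  proof -
    have "2 * real d ^ 3 + 2 * real d ^ 2 + real d \<le> 3 * real d ^ 3" using d2 d3 by linarith
    then have "2 * real d ^ 3 + 2 * real d ^ 2 + real d \<le> 3 * real n" using n3 by linarith
    then have "real n * (2 * real d ^ 3 + 2 * real d ^ 2 + real d) \<le> real n * (3 * real n)"
      by (intro mult_left_mono) auto
    moreover have "N * B + N = real n * (2 * real d ^ 3 + 2 * real d ^ 2 + real d)"
      by (simp add: N_def B_def algebra_simps power3_eq_cube power2_eq_square)
    ultimately have "N * B + 2 * a \<le> 3 * (real n)\<^sup>2" using aN by (simp add: power2_eq_square)
    then have "4 * (N * B + 2 * a) \<le> 4 * (3 * (real n)\<^sup>2)" by (rule mult_left_mono) simp
    also have "\<dots> \<le> 3 * (8 * real n)\<^sup>2" by (simp add: power_mult_distrib)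
    also have "\<dots> \<le> 3 * a\<^sup>2" using an by (intro mult_left_mono power_mono) auto
    finally show ?thesis .
  qed
  have \<mu>0: "\<mu> > 0" using a0 N0 by (simp add: \<mu>_def)
  have step: "G (2 * j) * \<mu> \<le> real (j + 1) * G (2 * (j + 1))" if j: "real j \<le> \<mu> / 2" for j
  proof -
    define z where "z = 2 * real j"
    have z: "0 \<le> z" "2 * N * z \<le> a\<^sup>2" using j N0 by (auto simp: z_def \<mu>_def field_simps)
    have "a\<^sup>2 * 4 * z \<le> a\<^sup>2 * a"
    proof -
      have "4 * a * z \<le> 2 * N * z" using aN z(1) by (intro mult_right_mono) auto
      then have "a * (4 * z) \<le> a * a" using z(2) by (simp add: power2_eq_square)
      then show ?thesis using a0 by simp
    qed
    then have za: "4 * z \<le> a" using a0 by simp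
    have Ba: "4 * B \<le> a"
    proof -
      have "B = 2 * real d ^ 2 + 2 * real d" by (simp add: B_def algebra_simps power2_eq_square)
      then show ?thesis using d2 d3 n3 an by linarith
    qed
    have cnt: "G (2 * j) * ((a - z) * (a - z - B)) \<le> G (2 * (j + 1)) * ((z + 2) * (N - 2 * a + z + 2))"
    proof -
      have r1: "real (d * card S - 2 * j) = a - z"
      proof -
        have "real (2 * j) \<le> real (d * s)" using za z by (simp add: z_def a_def)
        then have "2 * j \<le> d * s" by (simp only: of_nat_le_iff)
        then have "real (d * s - 2 * j) = real (d * s) - real (2 * j)" by (rule of_nat_diff)
        then show ?thesis using S(2) by (simp add: a_def z_def)
      qed
      have r2: "real (d * card S - 2 * j - 2 * (d * (d + 1))) = a - z - B"
      proof -
        have rB: "real (2 * (d * (d + 1))) = B" by (simp add: B_def algebra_simps)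
        have "real (2 * (d * (d + 1))) \<le> real (d * card S - 2 * j)"
          unfolding r1 rB using Ba za a0 B0 by linarith
        then have "2 * (d * (d + 1)) \<le> d * card S - 2 * j" by (simp only: of_nat_le_iff)
        then show ?thesis by (simp only: of_nat_diff r1 rB)
      qed
      have r3: "real (d * (n - card S) - (d * card S - (2 * j + 2))) = N - 2 * a + z + 2 \<or>
          2 * j + 2 > d * card S"
      proof (cases "2 * j + 2 \<le> d * card S")
        case True
        have "d * card S - (2 * j + 2) \<le> d * (n - card S)"
        proof -
          have "d * card S \<le> d * (n - card S)" using sn S(2) by (intro mult_le_mono2) simp
          then show ?thesis by linarith
        qed
        then have "real (d * (n - card S) - (d * card S - (2 * j + 2))) =
            real (d * (n - card S)) - (real (d * card S) - real (2 * j + 2))"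
          using True by (simp only: of_nat_diff)
        moreover have "real (n - card S) = real n - real s" using sn S(2) by (simp add: of_nat_diff)
        ultimately show ?thesis using S(2) by (simp add: a_def N_def z_def algebra_simps)
      qed simp
      have "\<not> 2 * j + 2 > d * card S"
      proof
        assume "2 * j + 2 > d * card S"
        then have "real (d * card S) < real (2 * j + 2)" by (simp only: of_nat_less_iff)
        then have "a < z + 2" using S(2) by (simp add: a_def z_def)
        moreover have "a \<ge> 8" using an n0 by (simp add: Suc_le_eq flip: of_nat_le_iff)
        ultimately show False using za by linarith
      qed
      then have r3: "real (d * (n - card S) - (d * card S - (2 * j + 2))) = N - 2 * a + z + 2" using r3 by blast
      have "real (card (with_inner n d S (2 * j)) * ((d * card S - 2 * j) * (d * card S - 2 * j - 2 * (d * (d + 1))))) \<le>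
        real (card (with_inner n d S (2 * j + 2)) * ((2 * j + 2) * (d * (n - card S) - (d * card S - (2 * j + 2)))))"
        using inner_switching_count[OF S(1)] by (simp only: of_nat_le_iff)
      then have "G (2 * j) * ((a - z) * (a - z - B)) \<le> G (2 * j + 2) * (real (2 * j + 2) * (N - 2 * a + z + 2))"
        unfolding of_nat_mult r1 r2 r3 G_def by simp
      moreover have "real (2 * j + 2) = z + 2" "2 * (j + 1) = 2 * j + 2" by (simp_all add: z_def)
      ultimately show ?thesis by metis
    qed
    have pos: "N - 2 * a + z + 2 > 0" using aN z by simp
    have ar: "a\<^sup>2 * (N - 2 * a + z + 2) \<le> N * ((a - z) * (a - z - B))"
      by (rule inner_ratio_arith[OF a0 N0 z aN B0 aB])
    have "G (2 * j) * (a\<^sup>2 * (N - 2 * a + z + 2)) \<le> G (2 * j) * (N * ((a - z) * (a - z - B)))"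
      by (rule mult_left_mono[OF ar]) (simp add: G_def)
    also have "\<dots> = N * (G (2 * j) * ((a - z) * (a - z - B)))" by simp
    also have "\<dots> \<le> N * (G (2 * (j + 1)) * ((z + 2) * (N - 2 * a + z + 2)))"
      by (rule mult_left_mono[OF cnt]) (use N0 in simp)
    finally have "(G (2 * j) * a\<^sup>2) * (N - 2 * a + z + 2) \<le>
        (N * (G (2 * (j + 1)) * (z + 2))) * (N - 2 * a + z + 2)" by (simp only: mult.assoc)
    then have "G (2 * j) * a\<^sup>2 \<le> N * (G (2 * (j + 1)) * (z + 2))"
      using pos by (rule mult_right_le_imp_le)
    then show ?thesis using N0 by (simp add: \<mu>_def z_def field_simps)
  qed
  have chain: "G 0 * \<mu> ^ j \<le> fact j * G (2 * j)" if "real j \<le> \<mu> / 2" for j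
    using that
  proof (induction j)
    case (Suc j)
    have "G 0 * \<mu> ^ Suc j = (G 0 * \<mu> ^ j) * \<mu>" by simp
    also have "\<dots> \<le> (fact j * G (2 * j)) * \<mu>" using Suc \<mu>0 by (intro mult_right_mono) auto
    also have "\<dots> = fact j * (G (2 * j) * \<mu>)" by simp
    also have "\<dots> \<le> fact j * (real (j + 1) * G (2 * (j + 1)))" by (intro mult_left_mono step) (use Suc in auto)
    finally show ?case by (simp add: algebra_simps)
  qed simp
  \<comment> \<open>One less than the floor, so that \<open>J + 1 \<le> \<mu> / 2\<close> and hence
    \<open>fact J \<le> (\<mu> / 4) ^ J\<close>.\<close>
  define J where "J = nat \<lfloor>\<mu> / 2\<rfloor> - 1"
  \<comment> \<open>\<open>\<mu> / 2\<close> equals \<open>d * s ^ 2 / (4 * n)\<close>. This is the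
    origin of the 4 in \<open>d / (4 * ln d)\<close>: sets of that size have
    \<open>exp (\<mu> / 2) \<ge> d ^ s\<close>.\<close>
  have mu_s: "real s * ln (real d) \<le> \<mu> / 2"
  proof -
    have "real d * real s * (4 * real n * ln (real d)) \<le> real d * real s * (real d * real s)"
      using s by (intro mult_left_mono) auto
    then show ?thesis using N0 n0 d by (simp add: \<mu>_def a_def N_def field_simps power2_eq_square)
  qed
  have ms: "\<mu> / 2 \<ge> 2"
  proof -
    have "real d * real s \<ge> 1" using an n0 by (simp add: a_def)
    then have "real s > 0" by (cases "s = 0") auto
    then have "real s \<ge> 1" by simp
    then have "1 * 2 \<le> real s * ln (real d)" using ln2 by (intro mult_mono) auto
    then show ?thesis using mu_s by simp
  qed
  have J1: "real J + 1 \<le> \<mu> / 2" "\<mu> / 2 \<le> real J + 2"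
  proof -
    have f: "of_int \<lfloor>\<mu> / 2\<rfloor> \<le> \<mu> / 2" "\<mu> / 2 < of_int \<lfloor>\<mu> / 2\<rfloor> + 1" by linarith+
    have "\<lfloor>\<mu> / 2\<rfloor> \<ge> 2" using ms by (simp add: le_floor_iff)
    then have "int J = \<lfloor>\<mu> / 2\<rfloor> - 1" unfolding J_def by linarith
    then have "real J = of_int \<lfloor>\<mu> / 2\<rfloor> - 1" by (metis of_int_of_nat_eq of_int_diff of_int_1)
    then show "real J + 1 \<le> \<mu> / 2" "\<mu> / 2 \<le> real J + 2" using f by linarith+
  qed
  have reg: "G i \<le> ?R" for i
    unfolding G_def of_nat_le_iff by (rule card_mono[OF finite_regular_graphs]) (auto simp: with_inner_def)
  have "G 0 * \<mu> ^ J \<le> fact J * G (2 * J)" by (rule chain) (use J1 in simp)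
  also have "\<dots> \<le> ((real J + 1) / 2) ^ J * ?R"
    by (rule mult_mono[OF fact_le_half_power reg]) (auto simp: G_def)
  also have "\<dots> \<le> (\<mu> / 4) ^ J * ?R"
    by (intro mult_right_mono power_mono) (use J1 in auto)
  finally have "(G 0 * 4 ^ J) * (\<mu> ^ J / 4 ^ J) \<le> ?R * (\<mu> ^ J / 4 ^ J)"
    by (simp add: power_divide mult.commute)
  then have G4: "G 0 * 4 ^ J \<le> ?R"
    by (rule mult_right_le_imp_le) (use \<mu>0 in simp)
  \<comment> \<open>\<open>J\<close> falls short of \<open>\<mu> / 2\<close> by at most 2, which
    costs the factor \<open>4 ^ 2 = 16\<close>.\<close>
  have "real d ^ s = exp (real s * ln (real d))" using d by (simp add: exp_of_nat_mult)
  also have "\<dots> \<le> exp (real (J + 2))" using mu_s J1 by simp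
  also have "\<dots> = exp 1 ^ (J + 2)" by (metis exp_of_nat_mult mult.right_neutral)
  also have "\<dots> \<le> 4 ^ (J + 2)" using exp_le by (intro power_mono) auto
  finally have "real d ^ s \<le> 16 * 4 ^ J" by simp
  then have "G 0 * real d ^ s \<le> G 0 * (16 * 4 ^ J)" by (intro mult_left_mono) (auto simp: G_def)
  then show ?thesis using G4 unfolding G_def by simp
qed

section \<open>Chromatic number\<close>

lemma colorable_chromatic_number:
  assumes "simple_graph n E"
  shows "colorable n E (chromatic_number n E)"
  unfolding chromatic_number_def
proof (rule LeastI)
  show "colorable n E n"
    unfolding colorable_def by (rule exI[of _ id]) (use assms in \<open>auto simp: simple_graph_def irrefl_def\<close>)
qed

text \<open>Some colour class has at least the average size, and with at most
  \<open>d / (4 * ln d)\<close> colours the average is at least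
  \<open>4 * n * ln d / d\<close>.\<close>

lemma large_independent_set:
  assumes G: "simple_graph n E" and n: "n > 0" and d: "d \<ge> 2"
    and \<chi>: "real (chromatic_number n E) \<le> real d / (4 * ln (real d))"
  shows "\<exists>S \<subseteq> {0..<n}. E \<inter> S \<times> S = {} \<and> 4 * real n * ln (real d) \<le> real d * real (card S)"
proof -
  define c where "c = chromatic_number n E"
  obtain f :: "nat \<Rightarrow> nat" where f: "\<And>v. v < n \<Longrightarrow> f v < c" "\<And>u v. (u, v) \<in> E \<Longrightarrow> f u \<noteq> f v"
    using colorable_chromatic_number[OF G] unfolding colorable_def c_def by blast
  define S where "S = (\<lambda>i. {v \<in> {0..<n}. f v = i})"
  have c0: "c > 0" using f(1)[of 0] n by simp
  have ln0: "ln (real d) > 0" using d by simp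
  have "\<exists>i<c. 4 * real n * ln (real d) \<le> real d * real (card (S i))"
  proof (rule ccontr)
    assume "\<not> ?thesis"
    then have lt: "real d * real (card (S i)) < 4 * real n * ln (real d)" if "i < c" for i using that by force
    have "{0..<n} = (\<Union>i<c. S i)" using f(1) by (auto simp: S_def)
    then have "card {0..<n} = card (\<Union>i<c. S i)" by simp
    also have "\<dots> = (\<Sum>i<c. card (S i))" by (rule card_UN_disjoint) (auto simp: S_def)
    finally have "real d * real n = (\<Sum>i<c. real d * real (card (S i)))" by (simp add: sum_distrib_left)
    also have "\<dots> < (\<Sum>i<c. 4 * real n * ln (real d))"
      by (rule sum_strict_mono) (use lt c0 in auto)
    also have "\<dots> = real n * (real c * (4 * ln (real d)))" by simp
    also have "\<dots> \<le> real n * real d"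
      using \<chi> ln0 by (intro mult_left_mono) (auto simp: c_def field_simps)
    finally show False by simp
  qed
  then obtain i where i: "4 * real n * ln (real d) \<le> real d * real (card (S i))" by blast
  have "E \<inter> S i \<times> S i = {}" using f(2) by (fastforce simp: S_def)
  then show ?thesis using i by (intro exI[of _ "S i"]) (auto simp: S_def)
qed

text \<open>All \<open>d * card S\<close> edges at \<open>S\<close> end in the complement, which can
  receive only \<open>d\<close> per vertex.\<close>

lemma independent_set_le_half:
  assumes E: "E \<in> regular_graphs n d" and d: "d > 0" and S: "S \<subseteq> {0..<n}" "E \<inter> S \<times> S = {}"
  shows "2 * card S \<le> n"
proof -
  let ?C = "{0..<n} - S"
  note D = regular_graphsD[OF E]
  have finS: "finite S" using S(1) by (rule finite_subset) simp
  have "d * card S = card (E \<inter> S \<times> ?C)" using card_edges_across[OF E S(1)] S(2) by simp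
  also have "\<dots> = card (E \<inter> ?C \<times> S)" by (rule card_edges_swap[OF D(2)])
  also have "\<dots> \<le> card (E \<inter> ?C \<times> UNIV)" by (rule card_mono) (use D(5) in auto)
  also have "\<dots> = d * card ?C" by (rule card_edges_from[OF E]) auto
  finally have "card S \<le> card ?C" using d by simp
  also have "card ?C = n - card S" using card_Diff_subset[OF finS S(1)] by simp
  finally show ?thesis by linarith
qed

text \<open>By \<open>ln d \<ge> 2\<close> the critical size satisfies
  \<open>d * s \<ge> 8 * n\<close>, so there are at most \<open>(3 * d / 8) ^ s\<close> candidate
  sets. Each is independent with probability at most \<open>16 / d ^ s\<close>, and
  \<open>(3 / 8) ^ s\<close> is below \<open>1 / sqrt n\<close> because
  \<open>s \<ge> sqrt n\<close>.\<close>

lemma low_chromatic_bound: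
  assumes d: "d \<ge> 10" and n: "d ^ 3 \<le> n"
  shows "real (card {E \<in> regular_graphs n d. \<not> real (chromatic_number n E) > real d / (4 * ln (real d))})
     \<le> 16 * real (card (regular_graphs n d)) / sqrt (real n)"
proof -
  let ?reg = "regular_graphs n d"
  let ?R = "real (card ?reg)"
  let ?bad = "{E \<in> ?reg. \<not> real (chromatic_number n E) > real d / (4 * ln (real d))}"
  define s where "s = nat \<lceil>4 * real n * ln (real d) / real d\<rceil>"
  define Ss where "Ss = {S. S \<subseteq> {0..<n} \<and> card S = s}"
  have "d * d \<le> d * d * d" using d by simp
  then have dd: "d * d \<le> n" using n unfolding power3_eq_cube by (rule le_trans)
  have n0: "n > 0" using dd d by (cases n) auto
  note ln2 = ln_ge_2[OF d]
  have s_ge: "4 * real n * ln (real d) \<le> real d * real s"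
  proof -
    have "4 * real n * ln (real d) / real d \<le> real s" unfolding s_def by linarith
    then show ?thesis using d by (simp add: field_simps)
  qed
  have s8: "8 * real n \<le> real d * real s"
  proof -
    have "4 * real n * 2 \<le> 4 * real n * ln (real d)" using ln2 by (intro mult_left_mono) auto
    then show ?thesis using s_ge by simp
  qed
  have s0: "s > 0" using s8 n0 by (cases "s = 0") auto
  have sub: "E \<in> (\<Union>S\<in>Ss. with_inner n d S 0) \<and> 2 * s \<le> n" if E: "E \<in> ?bad" for E
  proof -
    have reg: "E \<in> ?reg" and \<chi>: "real (chromatic_number n E) \<le> real d / (4 * ln (real d))" using E by auto
    have G: "simple_graph n E" using reg by (simp add: regular_graphs_def)
    obtain S where S: "S \<subseteq> {0..<n}" "E \<inter> S \<times> S = {}" "4 * real n * ln (real d) \<le> real d * real (card S)"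
      using large_independent_set[OF G n0 _ \<chi>] d by auto
    have "4 * real n * ln (real d) / real d \<le> real (card S)" using S(3) d by (simp add: field_simps)
    then have "s \<le> card S" unfolding s_def by linarith
    then obtain S' where S': "S' \<subseteq> S" "card S' = s" by (meson obtain_subset_with_card_n)
    have ind: "E \<inter> S' \<times> S' = {}" using S(2) S'(1) by blast
    have "S' \<in> Ss" using S S' by (auto simp: Ss_def)
    moreover have "E \<in> with_inner n d S' 0" using reg ind by (simp add: with_inner_def)
    moreover have "2 * s \<le> n" using independent_set_le_half[OF reg _ _ ind] S S' d by auto
    ultimately show ?thesis by blast
  qed
  show ?thesis
  proof (cases "2 * s \<le> n")
    case False
    then have "?bad = {}" using sub by blast
    then have "card ?bad = 0" by (simp only: card.empty)
    then show ?thesis by simp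
  next
    case True
    have finSs: "finite Ss" by (rule finite_subset[of _ "Pow {0..<n}"]) (auto simp: Ss_def)
    have "real (card ?bad) \<le> real (card (\<Union>S\<in>Ss. with_inner n d S 0))"
    proof -
      have "finite (\<Union>S\<in>Ss. with_inner n d S 0)"
        by (rule finite_subset[OF _ finite_regular_graphs[of n d]]) (auto simp: with_inner_def)
      moreover have "?bad \<subseteq> (\<Union>S\<in>Ss. with_inner n d S 0)" using sub by blast
      ultimately show ?thesis unfolding of_nat_le_iff by (rule card_mono)
    qed
    also have "\<dots> \<le> real (card Ss) * (16 * ?R / real d ^ s)"
    proof (rule card_UN_le_bound[OF finSs])
      fix S assume "S \<in> Ss"
      then have "real (card (with_inner n d S 0)) * real d ^ s \<le> 16 * ?R"
        using independent_set_bound[OF d _ _ True s_ge n] by (auto simp: Ss_def)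
      then show "real (card (with_inner n d S 0)) \<le> 16 * ?R / real d ^ s"
        using d by (simp add: field_simps)
    qed
    also have "\<dots> \<le> (3 * real d / 8) ^ s * (16 * ?R / real d ^ s)"
    proof (rule mult_right_mono)
      have "card Ss = n choose s" unfolding Ss_def using n_subsets[of "{0..<n}" s] by simp
      then have "real (card Ss) \<le> (3 * real n / real s) ^ s" using binomial_le_power[OF s0] by simp
      also have "\<dots> \<le> (3 * real d / 8) ^ s"
        using s8 s0 by (intro power_mono) (auto simp: field_simps)
      finally show "real (card Ss) \<le> (3 * real d / 8) ^ s" .
    qed simp
    also have "\<dots> = (3 / 8) ^ s * (16 * ?R)"
      using d by (simp add: power_divide power_mult_distrib)
    also have "\<dots> \<le> (1 / sqrt (real n)) * (16 * ?R)"
    proof (rule mult_right_mono)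
      have "sqrt (real n) \<le> real s"
      proof -
        have "real d * real d \<le> real n" using dd by (metis of_nat_le_iff of_nat_mult)
        then have "(real d)\<^sup>2 \<le> real n" by (simp add: power2_eq_square)
        then have "real d \<le> sqrt (real n)" by (rule real_le_rsqrt)
        then have "real d * sqrt (real n) \<le> sqrt (real n) * sqrt (real n)" by (rule mult_right_mono) simp
        then have "real d * sqrt (real n) \<le> real n" by simp
        also have "\<dots> \<le> real d * real s" using s8 by simp
        finally show ?thesis using d by simp
      qed
      also have "\<dots> \<le> 2 ^ s" using of_nat_less_two_power[of s, where 'a = real] by simp
      finally have "1 / 2 ^ s \<le> 1 / sqrt (real n)" using n0 by (simp add: frac_le)
      moreover have "(3 / 8 :: real) ^ s \<le> (1 / 2) ^ s" by (rule power_mono) auto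
      ultimately show "(3 / 8) ^ s \<le> 1 / sqrt (real n)" by (simp add: power_one_over)
    qed simp
    finally show ?thesis by simp
  qed
qed

section \<open>Failure probability\<close>

text \<open>The constant is \<open>242 = 240 + 2\<close>: sparsity holds for sets of size up to
  \<open>n / d ^ (240 * d)\<close>, and acceptance loses a further
  \<open>d ^ (d + 6) \<le> d ^ (2 * d)\<close>. The failure bounds 1 and 16, in units of
  \<open>1 / sqrt n\<close>, add up to 17.\<close>

lemma prob_reg_lower_bound:
  assumes d: "d \<ge> 10" and n: "6 * real d ^ 3 \<le> ln (real n)" and ev: "even (d * n)"
  shows "1 - 17 / sqrt (real n) \<le> prob_reg n d
          (\<lambda>E. real (chromatic_number n E) > real d / (4 * ln (real d)) \<and>
               (\<forall>k. real k \<le> real n * real d powr (- 242 * real d) \<longrightarrow> coh_accepts (graph_struct n E) K3 k))"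
    (is "_ \<le> prob_reg n d ?good")
proof -
  let ?reg = "regular_graphs n d"
  let ?R = "real (card ?reg)"
  have d1: "real d \<ge> 10" using d by simp
  have d3: "real d ^ 3 \<ge> 1" using d1 by simp
  then have "ln (real n) > 0" using n by linarith
  then have n0: "n > 0" by (cases n) auto
  have "ln (real n) \<le> real n" using ln_le_minus_one[of "real n"] n0 by simp
  then have n6: "6 * real d ^ 3 \<le> real n" using n by simp
  then have "real (6 * d ^ 3) \<le> real n" by simp
  then have n6': "6 * d ^ 3 \<le> n" by (simp only: of_nat_le_iff)
  have n3: "d ^ 3 \<le> n" using n6' by simp
  have "10 * 10 \<le> d * d" using d by (rule mult_le_mono[OF d])
  then have "100 * d \<le> d * d * d" by (intro mult_le_mono1) simp
  then have dn: "100 * d \<le> n" using n3 unfolding power3_eq_cube by (rule le_trans)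
  have "?reg \<noteq> {}" by (rule regular_graphs_nonempty[OF _ ev]) (use dn d in linarith)
  then have reg0: "?R > 0" using finite_regular_graphs by (simp add: card_gt_0_iff)
  define K where "K = nat \<lfloor>real n / real d ^ (240 * d)\<rfloor>"
  have "real K \<le> real n / real d ^ (240 * d)" unfolding K_def by simp
  then have K: "real K * real d ^ (240 * d) \<le> real n" using d by (simp add: field_simps)
  define B1 where "B1 = {E \<in> ?reg. \<not> locally_sparse n E (20 * d) K}"
  define B2 where "B2 = {E \<in> ?reg. \<not> real (chromatic_number n E) > real d / (4 * ln (real d))}"
  have b1: "real (card B1) \<le> ?R / sqrt (real n)"
    unfolding B1_def by (rule not_locally_sparse_bound[OF d _ K]) (use dn in simp)
  have b2: "real (card B2) \<le> 16 * ?R / sqrt (real n)"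
    unfolding B2_def by (rule low_chromatic_bound[OF d n3])
  have good: "?reg - (B1 \<union> B2) \<subseteq> {E \<in> ?reg. ?good E}"
  proof
    fix E assume "E \<in> ?reg - (B1 \<union> B2)"
    then have E: "E \<in> ?reg" and sp: "locally_sparse n E (20 * d) K"
      and \<chi>: "real (chromatic_number n E) > real d / (4 * ln (real d))" by (auto simp: B1_def B2_def)
    have "coh_accepts (graph_struct n E) K3 k" if k: "real k \<le> real n * real d powr (- 242 * real d)" for k
    proof (rule coh_accepts_if_locally_sparse[OF _ _ _ sp])
      show "simple_graph n E" using E by (simp add: regular_graphs_def)
      show "card {v. (u, v) \<in> E} \<le> d" if "u < n" for u using regular_graphsD(4)[OF E that] by simp
      show "7 \<le> d" using d by simp
      have "real k * real d ^ (d + 6) \<le> real n * real d powr (- 242 * real d) * real d ^ (d + 6)"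
        using k by (rule mult_right_mono) simp
      also have "\<dots> \<le> real n * real d powr (- 242 * real d) * real d ^ (2 * d)"
        using d by (intro mult_left_mono power_increasing) auto
      also have "\<dots> = real n * real d powr (- real (240 * d))"
      proof -
        have "real d ^ (2 * d) = real d powr (real (2 * d))" using d by (subst powr_realpow) auto
        then have "real d powr (- 242 * real d) * real d ^ (2 * d) = real d powr (- 242 * real d + real (2 * d))"
          by (simp only: powr_add)
        also have "- 242 * real d + real (2 * d) = - real (240 * d)" by simp
        finally show ?thesis by (simp only: mult.assoc)
      qed
      also have "\<dots> = real n / real d ^ (240 * d)"
      proof -
        have "real d powr (real (240 * d)) = real d ^ (240 * d)" using d by (subst powr_realpow) auto
        then show ?thesis by (simp only: powr_minus divide_inverse)
      qed
      finally have "real (k * d ^ (d + 6)) \<le> real n / real d ^ (240 * d)" by simp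
      then show "k * d ^ (d + 6) \<le> K" unfolding K_def by (rule le_nat_floor)
    qed
    then show "E \<in> {E \<in> ?reg. ?good E}" using E \<chi> by blast
  qed
  have "card ?reg - card (B1 \<union> B2) \<le> card (?reg - (B1 \<union> B2))"
    by (rule diff_card_le_card_Diff) (use finite_regular_graphs in \<open>auto simp: B1_def B2_def\<close>)
  also have "\<dots> \<le> card {E \<in> ?reg. ?good E}"
    by (rule card_mono[OF _ good]) (use finite_regular_graphs in auto)
  finally have "card ?reg \<le> card {E \<in> ?reg. ?good E} + (card B1 + card B2)"
    using card_Un_le[of B1 B2] by linarith
  then have cover: "?R \<le> real (card {E \<in> ?reg. ?good E}) + (real (card B1) + real (card B2))"
    by (simp only: of_nat_le_iff flip: of_nat_add)
  have "?R * (1 - 17 / sqrt (real n)) =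
      ?R - (?R / sqrt (real n) + 16 * ?R / sqrt (real n))"
    by (simp add: right_diff_distrib flip: add_divide_distrib)
  also have "\<dots> \<le> ?R - (real (card B1) + real (card B2))"
    by (intro diff_left_mono add_mono b1 b2)
  also have "\<dots> \<le> real (card {E \<in> ?reg. ?good E})" using cover by linarith
  finally have "?R * (1 - 17 / sqrt (real n)) \<le> real (card {E \<in> ?reg. ?good E})" .
  then show ?thesis using reg0 unfolding prob_reg_def by (subst pos_le_divide_eq) (simp_all add: mult.commute)
qed

lemma prob_reg_le_1: "prob_reg n d P \<le> 1"
proof -
  have "card {E \<in> regular_graphs n d. P E} \<le> card (regular_graphs n d)"
    by (rule card_mono[OF finite_regular_graphs]) auto
  then show ?thesis
    unfolding prob_reg_def by (cases "card (regular_graphs n d) = 0") (auto simp: divide_le_eq_1)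
qed

theorem mainTheorem1:
  shows "\<exists>C::real. C > 0 \<and>
    (\<forall>d::nat \<Rightarrow> nat.
      (\<forall>\<^sub>F n in sequentially. 10 \<le> d n \<and> 6 * real (d n) ^ 3 \<le> ln (real n)) \<longrightarrow>
      ((\<lambda>n. prob_reg n (d n)
          (\<lambda>E. real (chromatic_number n E) > real (d n) / (4 * ln (real (d n))) \<and>
               (\<forall>k. real k \<le> real n * real (d n) powr (- C * real (d n)) \<longrightarrow>
                    coh_accepts (graph_struct n E) K3 k)))
         \<longlongrightarrow> 1) (inf sequentially (principal {n. even (d n * n)}))
      \<and>
      (\<forall>\<^sub>F n in inf sequentially (principal {n. even (d n * n)}).
         \<forall>k. real k \<le> real n * real (d n) powr (- C * real (d n)) \<longrightarrow>
           (\<exists>E. simple_graph n E \<and>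
                real (chromatic_number n E) > real (d n) / (4 * ln (real (d n))) \<and>
                coh_accepts (graph_struct n E) K3 k)))"
proof (intro exI[of _ 242] conjI allI impI)
  fix d :: "nat \<Rightarrow> nat"
  assume d: "\<forall>\<^sub>F n in sequentially. 10 \<le> d n \<and> 6 * real (d n) ^ 3 \<le> ln (real n)"
  let ?F = "inf sequentially (principal {n. even (d n * n)})"
  let ?good = "\<lambda>n E. real (chromatic_number n E) > real (d n) / (4 * ln (real (d n))) \<and>
       (\<forall>k. real k \<le> real n * real (d n) powr (- 242 * real (d n)) \<longrightarrow> coh_accepts (graph_struct n E) K3 k)"
  have low: "\<forall>\<^sub>F n in ?F. 1 - 17 / sqrt (real n) \<le> prob_reg n (d n) (?good n)"
    unfolding eventually_inf_principal using d
    by (rule eventually_mono) (use prob_reg_lower_bound in auto)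
  have lim: "((\<lambda>n. 1 - 17 / sqrt (real n)) \<longlongrightarrow> 1) sequentially"
  proof -
    have "filterlim (\<lambda>n. sqrt (real n)) at_top sequentially"
      by (rule filterlim_compose[OF sqrt_at_top filterlim_real_sequentially])
    then have "((\<lambda>n. 17 / sqrt (real n)) \<longlongrightarrow> 0) sequentially"
      by (rule real_tendsto_divide_at_top[OF tendsto_const])
    from tendsto_diff[OF tendsto_const this, of 1] show ?thesis by simp
  qed
  show "((\<lambda>n. prob_reg n (d n) (?good n)) \<longlongrightarrow> 1) ?F"
  proof (rule tendsto_sandwich[OF low])
    show "\<forall>\<^sub>F n in ?F. prob_reg n (d n) (?good n) \<le> 1" by (simp add: prob_reg_le_1)
    show "((\<lambda>n. 1 - 17 / sqrt (real n)) \<longlongrightarrow> 1) ?F" by (rule tendsto_mono[OF inf_le1 lim])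
  qed simp
  have "\<forall>\<^sub>F n in sequentially. 0 < 1 - 17 / sqrt (real n)"
    using order_tendstoD(1)[OF lim, of 0] by simp
  then have "\<forall>\<^sub>F n in ?F. 0 < 1 - 17 / sqrt (real n)"
    by (rule filter_leD[OF inf_le1])
  \<comment> \<open>Positive probability already yields a graph that is accepted although its
    chromatic number is large, which is all that the second claim asks for.\<close>
  with low have pos: "\<forall>\<^sub>F n in ?F. 0 < prob_reg n (d n) (?good n)"
    by eventually_elim linarith
  then show "\<forall>\<^sub>F n in ?F. \<forall>k. real k \<le> real n * real (d n) powr (- 242 * real (d n)) \<longrightarrow>
           (\<exists>E. simple_graph n E \<and>
                real (chromatic_number n E) > real (d n) / (4 * ln (real (d n))) \<and>
                coh_accepts (graph_struct n E) K3 k)"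
    (is "\<forall>\<^sub>F n in _. ?Q n")
  proof (rule eventually_mono)
    fix n assume "0 < prob_reg n (d n) (?good n)"
    then have "card {E \<in> regular_graphs n (d n). ?good n E} \<noteq> 0" by (intro notI) (simp add: prob_reg_def)
    then have "{E \<in> regular_graphs n (d n). ?good n E} \<noteq> {}" by (metis card.empty)
    then obtain E where "E \<in> regular_graphs n (d n)" "?good n E" by blast
    moreover then have "simple_graph n E" by (simp add: regular_graphs_def)
    ultimately show "?Q n" by blast
  qed
qed simp

end
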